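(* Let $\mathcal S=(\mathcal S,\otimes,\mathbb 1)$ be a symmetric monoidal category. Hopf algebras in the symmetric monoidal category $\mathcal F(\mathcal S)$ are in bijective correspondence with pairs $(\chi,A)$ where $\chi$ is a crossed module and $A$ is a Hopf $\chi$-algebra in $\mathcal S$.
   Context: A *Hopf algebra* in a symmetric monoidal category is a bialgebra object $(A,m,u,\Delta,\varepsilon)$ that admits an invertible antipode $S\colon A\to A$, i.e. $m(S\otimes\mathrm{id})\Delta=u\varepsilon=m(\mathrm{id}\otimes S)\Delta$. Associativity and unit constraints are suppressed. **Crossed module.** A group homomorphism $\chi\colon E\to H$ with a left action $(x,e)\mapsto {}^{x}e$ of $H$ on $E$ by group automorphisms such that $\chi({}^{x}e)=x\chi(e)x^{-1}$ and ${}^{\chi(e)}f=efe^{-1}$. **Hopf $\chi$-algebra in $\mathcal S$.** A family $A=\{A_x\}_{x\in H}$ of coalgebras in $\mathcal S$ (coproducts $\Delta_x$, counits $\varepsilon_x$) with coalgebra morphisms $\mu_{x,y}\colon A_x\otimes A_y\to A_{xy}$ and $\eta\colon\mathbb 1\to A_1$, isomorphisms $S_x\colon A_x\to A_{x^{-1}}$ in $\mathcal S$, and coalgebra isomorphisms $\phi_{x,e}\colon A_x\to A_{\chi(e)x}$ ($x,y\in H$, $e\in E$) such that the product is associative and unital, i.e. $\mu_{xy,z}(\mu_{x,y}\otimes\mathrm{id})=\mu_{x,yz}(\mathrm{id}\otimes\mu_{y,z})$ and $\mu_{x,1}(\mathrm{id}\otimes\eta)=\mathrm{id}_{A_x}=\mu_{1,x}(\eta\otimes\mathrm{id})$;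 $\mu_{x^{-1},x}(S_x\otimes\mathrm{id})\Delta_x=\eta\varepsilon_x=\mu_{x,x^{-1}}(\mathrm{id}\otimes S_x)\Delta_x$; $\phi_{x,1}=\mathrm{id}$; $\phi_{\chi(e)x,f}\phi_{x,e}=\phi_{x,fe}$; $\mu_{\chi(e)x,\chi(f)y}(\phi_{x,e}\otimes\phi_{y,f})=\phi_{xy,\,e\,{}^{x}f}\,\mu_{x,y}$. **The category $\mathcal F(\mathcal S)$.** Objects: pairs $(\mathcal C,F)$ with $\mathcal C$ a small category and $F\colon\mathcal C\to\mathcal S$ a functor. A morphism $(\mathcal C,F)\to(\mathcal D,G)$ is a pair $(\Gamma,\gamma)$ with $\Gamma\colon\mathcal C\to\mathcal D$ a functor and $\gamma$ a natural transformation from $F$ to $G\Gamma$. The composite of $(\Gamma,\gamma)\colon(\mathcal C,F)\to(\mathcal D,G)$ with $(\Lambda,\lambda)\colon(\mathcal D,G)\to(\mathcal K,L)$ is $(\Lambda\Gamma,\{\lambda_{\Gamma(X)}\circ\gamma_X\}_{X\in\mathcal C})$. Monoidal product: $(\mathcal C,F)\boxtimes(\mathcal D,G)=(\mathcal C\times\mathcal D,\otimes\circ(F\times G))$ and $(\Gamma,\gamma)\boxtimes(\Lambda,\lambda)=(\Gamma\times\Lambda,\{\gamma_X\otimes\lambda_Y\})$; unit object $(\mathbf 1,\ast\mapsto\mathbb 1)$ with $\mathbf 1$ the one-object, one-morphism category; constraints and symmetry are induced by those of $\mathbf{Cat}$ (cartesian product) and $\mathcal S$. **Crossed modules as Hopf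 algebras in $\mathbf{Cat}$.** Let $\mathbf{Cat}$ be the category of small categories and functors with its cartesian monoidal structure. To $\chi\colon E\to H$ is associated the Hopf algebra $\mathcal G_\chi$ in $\mathbf{Cat}$: objects are the elements of $H$; $\mathrm{Hom}(x,y)=\{e\in E\mid y=\chi(e)x\}$; composition is the product of $E$ ($f\circ e=fe$); product $m_\chi(x,y)=xy$, $m_\chi(x\xrightarrow{e}y,\,z\xrightarrow{f}t)=(xz\xrightarrow{e\,{}^{x}f}yt)$; unit $u_\chi(\ast)=1$; coproduct $\Delta_\chi$ and counit $\varepsilon_\chi$ the diagonal and the unique functor to $\mathbf 1$; antipode $S_\chi(x)=x^{-1}$, $S_\chi(x\xrightarrow{e}y)=(x^{-1}\xrightarrow{{}^{x^{-1}}(e^{-1})}y^{-1})$. As usual, Hopf algebras in $\mathbf{Cat}$ (equivalently group objects in $\mathbf{Cat}$) are identified with crossed modules through $\chi\leftrightarrow\mathcal G_\chi$. **The correspondence meant.** To $(\chi,A)$ corresponds the object $(\mathcal G_\chi,F_A)$ of $\mathcal F(\mathcal S)$ with $F_A(x)=A_x$, $F_A(x\xrightarrow{e}\chi(e)x)=\phi_{x,e}$, with product $(m_\chi,\{\mu_{x,y}\})$, unit $(u_\chi,\eta)$, coproduct $(\Delta_\chi,\{\Delta_x\})$, counit $(\varepsilon_\chi,\{\varepsilon_x\})$, and antipode $(S_\chi,\{S_x\})$. *)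

theory Defs
  imports "HOL-Algebra.Group"
begin

section \<open>Categories, functors, natural transformations\<close>

record ('o, 'a) cat =
  Ob :: "'o set"
  Ar :: "'a set"
  Dom :: "'a \<Rightarrow> 'o"
  Cod :: "'a \<Rightarrow> 'o"
  Id :: "'o \<Rightarrow> 'a"
  Comp :: "'a \<Rightarrow> 'a \<Rightarrow> 'a" (infixr "\<cdot>\<index>" 60)

definition homs :: "('o, 'a, 'z) cat_scheme \<Rightarrow> 'o \<Rightarrow> 'o \<Rightarrow> 'a set" where
  "homs C X Y = {f \<in> Ar C. Dom C f = X \<and> Cod C f = Y}"

locale category =
  fixes C :: "('o, 'a, 'z) cat_scheme" (structure)
  assumes Dom_in: "f \<in> Ar C \<Longrightarrow> Dom C f \<in> Ob C"
    and Cod_in: "f \<in> Ar C \<Longrightarrow> Cod C f \<in> Ob C"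
    and Id_in: "X \<in> Ob C \<Longrightarrow> Id C X \<in> homs C X X"
    and Comp_in: "f \<in> homs C X Y \<Longrightarrow> g \<in> homs C Y Z \<Longrightarrow> g \<cdot> f \<in> homs C X Z"
    and Id_right: "f \<in> homs C X Y \<Longrightarrow> f \<cdot> Id C X = f"
    and Id_left: "f \<in> homs C X Y \<Longrightarrow> Id C Y \<cdot> f = f"
    and Comp_assoc: "f \<in> homs C W X \<Longrightarrow> g \<in> homs C X Y \<Longrightarrow> h \<in> homs C Y Z
          \<Longrightarrow> (h \<cdot> g) \<cdot> f = h \<cdot> (g \<cdot> f)"

definition inverse_pair :: "('o, 'a, 'z) cat_scheme \<Rightarrow> 'a \<Rightarrow> 'a \<Rightarrow> bool" where
  "inverse_pair C f g \<longleftrightarrow> f \<in> Ar C \<and> g \<in> homs C (Cod C f) (Dom C f)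
     \<and> g \<cdot>\<^bsub>C\<^esub> f = Id C (Dom C f) \<and> f \<cdot>\<^bsub>C\<^esub> g = Id C (Cod C f)"

definition invertible :: "('o, 'a, 'z) cat_scheme \<Rightarrow> 'a \<Rightarrow> bool" where
  "invertible C f \<longleftrightarrow> (\<exists>g. inverse_pair C f g)"

definition inverse_of :: "('o, 'a, 'z) cat_scheme \<Rightarrow> 'a \<Rightarrow> 'a" where
  "inverse_of C f = (THE g. inverse_pair C f g)"

text \<open>Equality of small categories and of functors matters below.  HOL functions are total, so
  all structure maps of small categories, functors and natural transformations are required to be
  \<open>undefined\<close> outside their mathematical domain.\<close>

definition normalized_cat :: "('o, 'a) cat \<Rightarrow> bool" where
  "normalized_cat C \<longleftrightarrow> Dom C \<in> extensional (Ar C) \<and> Cod C \<in> extensional (Ar C)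
     \<and> Id C \<in> extensional (Ob C)
     \<and> (\<forall>g f. \<not> (g \<in> Ar C \<and> f \<in> Ar C \<and> Dom C g = Cod C f) \<longrightarrow> g \<cdot>\<^bsub>C\<^esub> f = undefined)"

record ('o, 'a, 'p, 'b) functr =
  FOb :: "'o \<Rightarrow> 'p"
  FAr :: "'a \<Rightarrow> 'b"

definition is_functor ::
  "('o, 'a, 'y) cat_scheme \<Rightarrow> ('p, 'b, 'z) cat_scheme \<Rightarrow> ('o, 'a, 'p, 'b) functr \<Rightarrow> bool" where
  "is_functor C D F \<longleftrightarrow>
     FOb F \<in> extensional (Ob C) \<and> FAr F \<in> extensional (Ar C)
     \<and> (\<forall>X \<in> Ob C. FOb F X \<in> Ob D)
     \<and> (\<forall>X Y. \<forall>f \<in> homs C X Y. FAr F f \<in> homs D (FOb F X) (FOb F Y))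
     \<and> (\<forall>X \<in> Ob C. FAr F (Id C X) = Id D (FOb F X))
     \<and> (\<forall>X Y Z. \<forall>f \<in> homs C X Y. \<forall>g \<in> homs C Y Z.
          FAr F (g \<cdot>\<^bsub>C\<^esub> f) = FAr F g \<cdot>\<^bsub>D\<^esub> FAr F f)"

definition id_functor :: "('o, 'a, 'y) cat_scheme \<Rightarrow> ('o, 'a, 'o, 'a) functr" where
  "id_functor C = \<lparr>FOb = (\<lambda>X \<in> Ob C. X), FAr = (\<lambda>f \<in> Ar C. f)\<rparr>"

definition comp_functor :: "('o, 'a, 'y) cat_scheme \<Rightarrow> ('p, 'b, 'q, 'c) functr
    \<Rightarrow> ('o, 'a, 'p, 'b) functr \<Rightarrow> ('o, 'a, 'q, 'c) functr" where
  "comp_functor C G F = \<lparr>FOb = compose (Ob C) (FOb G) (FOb F), FAr = compose (Ar C) (FAr G) (FAr F)\<rparr>"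

definition is_nat_trans :: "('o, 'a, 'y) cat_scheme \<Rightarrow> ('p, 'b, 'z) cat_scheme
    \<Rightarrow> ('o, 'a, 'p, 'b) functr \<Rightarrow> ('o, 'a, 'p, 'b) functr \<Rightarrow> ('o \<Rightarrow> 'b) \<Rightarrow> bool" where
  "is_nat_trans C D F G \<gamma> \<longleftrightarrow>
     \<gamma> \<in> extensional (Ob C)
     \<and> (\<forall>X \<in> Ob C. \<gamma> X \<in> homs D (FOb F X) (FOb G X))
     \<and> (\<forall>X Y. \<forall>f \<in> homs C X Y. \<gamma> Y \<cdot>\<^bsub>D\<^esub> FAr F f = FAr G f \<cdot>\<^bsub>D\<^esub> \<gamma> X)"


section \<open>Symmetric monoidal categories\<close>

text \<open>The constraints are kept explicit: no strictness is assumed.\<close>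

record ('o, 'a) smc = "('o, 'a) cat" +
  tobj :: "'o \<Rightarrow> 'o \<Rightarrow> 'o" (infixr "\<boxtimes>\<index>" 70)
  tarr :: "'a \<Rightarrow> 'a \<Rightarrow> 'a" (infixr "\<odot>\<index>" 70)
  tunit :: "'o"
  assoc :: "'o \<Rightarrow> 'o \<Rightarrow> 'o \<Rightarrow> 'a"
  lunit :: "'o \<Rightarrow> 'a"
  runit :: "'o \<Rightarrow> 'a"
  swap :: "'o \<Rightarrow> 'o \<Rightarrow> 'a"

locale symmetric_monoidal_category = category S
  for S :: "('o, 'a, 'z) smc_scheme" (structure) +
  assumes tobj_in: "X \<in> Ob S \<Longrightarrow> Y \<in> Ob S \<Longrightarrow> X \<boxtimes> Y \<in> Ob S"
    and tarr_in: "f \<in> homs S X Y \<Longrightarrow> g \<in> homs S X' Y'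
          \<Longrightarrow> f \<odot> g \<in> homs S (X \<boxtimes> X') (Y \<boxtimes> Y')"
    and tarr_Id: "X \<in> Ob S \<Longrightarrow> Y \<in> Ob S \<Longrightarrow> Id S X \<odot> Id S Y = Id S (X \<boxtimes> Y)"
    and tarr_Comp: "f \<in> homs S X Y \<Longrightarrow> g \<in> homs S Y Z \<Longrightarrow> f' \<in> homs S X' Y'
          \<Longrightarrow> g' \<in> homs S Y' Z' \<Longrightarrow> (g \<cdot> f) \<odot> (g' \<cdot> f') = (g \<odot> g') \<cdot> (f \<odot> f')"
    and tunit_in: "tunit S \<in> Ob S"
    and assoc_in: "X \<in> Ob S \<Longrightarrow> Y \<in> Ob S \<Longrightarrow> Z \<in> Ob S
          \<Longrightarrow> assoc S X Y Z \<in> homs S ((X \<boxtimes> Y) \<boxtimes> Z) (X \<boxtimes> (Y \<boxtimes> Z))"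
    and assoc_inv: "X \<in> Ob S \<Longrightarrow> Y \<in> Ob S \<Longrightarrow> Z \<in> Ob S \<Longrightarrow> invertible S (assoc S X Y Z)"
    and assoc_nat: "f \<in> homs S X X' \<Longrightarrow> g \<in> homs S Y Y' \<Longrightarrow> h \<in> homs S Z Z'
          \<Longrightarrow> assoc S X' Y' Z' \<cdot> ((f \<odot> g) \<odot> h) = (f \<odot> (g \<odot> h)) \<cdot> assoc S X Y Z"
    and lunit_in: "X \<in> Ob S \<Longrightarrow> lunit S X \<in> homs S (tunit S \<boxtimes> X) X"
    and lunit_inv: "X \<in> Ob S \<Longrightarrow> invertible S (lunit S X)"
    and lunit_nat: "f \<in> homs S X Y \<Longrightarrow> lunit S Y \<cdot> (Id S (tunit S) \<odot> f) = f \<cdot> lunit S X"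
    and runit_in: "X \<in> Ob S \<Longrightarrow> runit S X \<in> homs S (X \<boxtimes> tunit S) X"
    and runit_inv: "X \<in> Ob S \<Longrightarrow> invertible S (runit S X)"
    and runit_nat: "f \<in> homs S X Y \<Longrightarrow> runit S Y \<cdot> (f \<odot> Id S (tunit S)) = f \<cdot> runit S X"
    and swap_in: "X \<in> Ob S \<Longrightarrow> Y \<in> Ob S \<Longrightarrow> swap S X Y \<in> homs S (X \<boxtimes> Y) (Y \<boxtimes> X)"
    and swap_nat: "f \<in> homs S X X' \<Longrightarrow> g \<in> homs S Y Y'
          \<Longrightarrow> swap S X' Y' \<cdot> (f \<odot> g) = (g \<odot> f) \<cdot> swap S X Y"
    and swap_swap: "X \<in> Ob S \<Longrightarrow> Y \<in> Ob S \<Longrightarrow> swap S Y X \<cdot> swap S X Y = Id S (X \<boxtimes> Y)"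
    and pentagon: "W \<in> Ob S \<Longrightarrow> X \<in> Ob S \<Longrightarrow> Y \<in> Ob S \<Longrightarrow> Z \<in> Ob S
          \<Longrightarrow> assoc S W X (Y \<boxtimes> Z) \<cdot> assoc S (W \<boxtimes> X) Y Z
            = (Id S W \<odot> assoc S X Y Z) \<cdot> assoc S W (X \<boxtimes> Y) Z \<cdot> (assoc S W X Y \<odot> Id S Z)"
    and triangle: "X \<in> Ob S \<Longrightarrow> Y \<in> Ob S
          \<Longrightarrow> (Id S X \<odot> lunit S Y) \<cdot> assoc S X (tunit S) Y = runit S X \<odot> Id S Y"
    and hexagon: "X \<in> Ob S \<Longrightarrow> Y \<in> Ob S \<Longrightarrow> Z \<in> Ob S
          \<Longrightarrow> assoc S Y Z X \<cdot> swap S X (Y \<boxtimes> Z) \<cdot> assoc S X Y Z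
            = (Id S Y \<odot> swap S X Z) \<cdot> assoc S Y X Z \<cdot> (swap S X Y \<odot> Id S Z)"

text \<open>The canonical map \<open>(W \<otimes> X) \<otimes> (Y \<otimes> Z) \<rightarrow> (W \<otimes> Y) \<otimes> (X \<otimes> Z)\<close>.\<close>

definition interchange :: "('o, 'a, 'z) smc_scheme \<Rightarrow> 'o \<Rightarrow> 'o \<Rightarrow> 'o \<Rightarrow> 'o \<Rightarrow> 'a" where
  "interchange S W X Y Z =
     inverse_of S (assoc S W Y (X \<boxtimes>\<^bsub>S\<^esub> Z))
     \<cdot>\<^bsub>S\<^esub> (Id S W \<odot>\<^bsub>S\<^esub> (assoc S Y X Z \<cdot>\<^bsub>S\<^esub> (swap S X Y \<odot>\<^bsub>S\<^esub> Id S Z)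
           \<cdot>\<^bsub>S\<^esub> inverse_of S (assoc S X Y Z)))
     \<cdot>\<^bsub>S\<^esub> assoc S W X (Y \<boxtimes>\<^bsub>S\<^esub> Z)"


section \<open>Coalgebras and Hopf algebras in a symmetric monoidal category\<close>

record ('o, 'a) coalg =
  Crr :: "'o"
  Cmul :: "'a"
  Cun :: "'a"

definition coalgebra :: "('o, 'a, 'z) smc_scheme \<Rightarrow> ('o, 'a, 'y) coalg_scheme \<Rightarrow> bool" where
  "coalgebra S A \<longleftrightarrow>
     Crr A \<in> Ob S
     \<and> Cmul A \<in> homs S (Crr A) (Crr A \<boxtimes>\<^bsub>S\<^esub> Crr A)
     \<and> Cun A \<in> homs S (Crr A) (tunit S)
     \<and> assoc S (Crr A) (Crr A) (Crr A) \<cdot>\<^bsub>S\<^esub> (Cmul A \<odot>\<^bsub>S\<^esub> Id S (Crr A)) \<cdot>\<^bsub>S\<^esub> Cmul A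
       = (Id S (Crr A) \<odot>\<^bsub>S\<^esub> Cmul A) \<cdot>\<^bsub>S\<^esub> Cmul A
     \<and> lunit S (Crr A) \<cdot>\<^bsub>S\<^esub> (Cun A \<odot>\<^bsub>S\<^esub> Id S (Crr A)) \<cdot>\<^bsub>S\<^esub> Cmul A = Id S (Crr A)
     \<and> runit S (Crr A) \<cdot>\<^bsub>S\<^esub> (Id S (Crr A) \<odot>\<^bsub>S\<^esub> Cun A) \<cdot>\<^bsub>S\<^esub> Cmul A = Id S (Crr A)"

definition coalg_mor :: "('o, 'a, 'z) smc_scheme \<Rightarrow> ('o, 'a, 'x) coalg_scheme
    \<Rightarrow> ('o, 'a, 'y) coalg_scheme \<Rightarrow> 'a \<Rightarrow> bool" where
  "coalg_mor S A B f \<longleftrightarrow>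
     f \<in> homs S (Crr A) (Crr B)
     \<and> Cmul B \<cdot>\<^bsub>S\<^esub> f = (f \<odot>\<^bsub>S\<^esub> f) \<cdot>\<^bsub>S\<^esub> Cmul A
     \<and> Cun B \<cdot>\<^bsub>S\<^esub> f = Cun A"

definition tensor_coalg :: "('o, 'a, 'z) smc_scheme \<Rightarrow> ('o, 'a, 'x) coalg_scheme
    \<Rightarrow> ('o, 'a, 'y) coalg_scheme \<Rightarrow> ('o, 'a) coalg" where
  "tensor_coalg S A B =
     \<lparr>Crr = Crr A \<boxtimes>\<^bsub>S\<^esub> Crr B,
      Cmul = interchange S (Crr A) (Crr A) (Crr B) (Crr B) \<cdot>\<^bsub>S\<^esub> (Cmul A \<odot>\<^bsub>S\<^esub> Cmul B),
      Cun = lunit S (tunit S) \<cdot>\<^bsub>S\<^esub> (Cun A \<odot>\<^bsub>S\<^esub> Cun B)\<rparr>"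

definition unit_coalg :: "('o, 'a, 'z) smc_scheme \<Rightarrow> ('o, 'a) coalg" where
  "unit_coalg S =
     \<lparr>Crr = tunit S, Cmul = inverse_of S (lunit S (tunit S)), Cun = Id S (tunit S)\<rparr>"

record ('o, 'a) bialg = "('o, 'a) coalg" +
  Mul :: "'a"
  Unt :: "'a"

definition bialgebra :: "('o, 'a, 'z) smc_scheme \<Rightarrow> ('o, 'a) bialg \<Rightarrow> bool" where
  "bialgebra S A \<longleftrightarrow>
     coalgebra S A
     \<and> coalg_mor S (tensor_coalg S A A) A (Mul A)
     \<and> coalg_mor S (unit_coalg S) A (Unt A)
     \<and> Mul A \<cdot>\<^bsub>S\<^esub> (Mul A \<odot>\<^bsub>S\<^esub> Id S (Crr A))
       = Mul A \<cdot>\<^bsub>S\<^esub> (Id S (Crr A) \<odot>\<^bsub>S\<^esub> Mul A) \<cdot>\<^bsub>S\<^esub> assoc S (Crr A) (Crr A) (Crr A)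
     \<and> Mul A \<cdot>\<^bsub>S\<^esub> (Unt A \<odot>\<^bsub>S\<^esub> Id S (Crr A)) = lunit S (Crr A)
     \<and> Mul A \<cdot>\<^bsub>S\<^esub> (Id S (Crr A) \<odot>\<^bsub>S\<^esub> Unt A) = runit S (Crr A)"

definition antipode :: "('o, 'a, 'z) smc_scheme \<Rightarrow> ('o, 'a) bialg \<Rightarrow> 'a \<Rightarrow> bool" where
  "antipode S A s \<longleftrightarrow>
     s \<in> homs S (Crr A) (Crr A)
     \<and> Mul A \<cdot>\<^bsub>S\<^esub> (s \<odot>\<^bsub>S\<^esub> Id S (Crr A)) \<cdot>\<^bsub>S\<^esub> Cmul A = Unt A \<cdot>\<^bsub>S\<^esub> Cun A
     \<and> Mul A \<cdot>\<^bsub>S\<^esub> (Id S (Crr A) \<odot>\<^bsub>S\<^esub> s) \<cdot>\<^bsub>S\<^esub> Cmul A = Unt A \<cdot>\<^bsub>S\<^esub> Cun A"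

definition hopf_algebra :: "('o, 'a, 'z) smc_scheme \<Rightarrow> ('o, 'a) bialg \<Rightarrow> bool" where
  "hopf_algebra S A \<longleftrightarrow> bialgebra S A \<and> (\<exists>s. antipode S A s \<and> invertible S s)"

definition hopf_iso :: "('o, 'a, 'z) smc_scheme \<Rightarrow> ('o, 'a) bialg \<Rightarrow> ('o, 'a) bialg \<Rightarrow> 'a \<Rightarrow> bool"
where
  "hopf_iso S A B f \<longleftrightarrow>
     coalg_mor S A B f \<and> invertible S f
     \<and> f \<cdot>\<^bsub>S\<^esub> Mul A = Mul B \<cdot>\<^bsub>S\<^esub> (f \<odot>\<^bsub>S\<^esub> f)
     \<and> f \<cdot>\<^bsub>S\<^esub> Unt A = Unt B"


section \<open>Small categories\<close>

text \<open>A monoidal category of small categories needs one type that contains the cartesian products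
  of its sets.  A small category has its objects and arrows in \<open>'u univ\<close>; as \<open>'u\<close> is an arbitrary
  type, no bound on cardinality is imposed.\<close>

datatype 'u univ = Atom 'u | Star | Pr (pr1: "'u univ") (pr2: "'u univ")

definition ptimes :: "'u univ set \<Rightarrow> 'u univ set \<Rightarrow> 'u univ set" where
  "ptimes A B = {Pr a b | a b. a \<in> A \<and> b \<in> B}"

type_synonym 'u scat = "('u univ, 'u univ) cat"
type_synonym 'u sfunctr = "('u univ, 'u univ, 'u univ, 'u univ) functr"

text \<open>Arrows carry their source and target, so that hom-sets are disjoint.\<close>

record ('x, 'd) mor =
  Src :: 'x
  Tgt :: 'x
  Dat :: 'd

definition prod_cat :: "'u scat \<Rightarrow> 'u scat \<Rightarrow> 'u scat" where
  "prod_cat C D =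
     \<lparr>Ob = ptimes (Ob C) (Ob D),
      Ar = ptimes (Ar C) (Ar D),
      Dom = (\<lambda>p \<in> ptimes (Ar C) (Ar D). Pr (Dom C (pr1 p)) (Dom D (pr2 p))),
      Cod = (\<lambda>p \<in> ptimes (Ar C) (Ar D). Pr (Cod C (pr1 p)) (Cod D (pr2 p))),
      Id = (\<lambda>p \<in> ptimes (Ob C) (Ob D). Pr (Id C (pr1 p)) (Id D (pr2 p))),
      Comp = (\<lambda>q p. if q \<in> ptimes (Ar C) (Ar D) \<and> p \<in> ptimes (Ar C) (Ar D)
                         \<and> Dom C (pr1 q) = Cod C (pr1 p) \<and> Dom D (pr2 q) = Cod D (pr2 p)
                       then Pr (pr1 q \<cdot>\<^bsub>C\<^esub> pr1 p) (pr2 q \<cdot>\<^bsub>D\<^esub> pr2 p) else undefined)\<rparr>"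

definition one_cat :: "'u scat" where
  "one_cat =
     \<lparr>Ob = {Star}, Ar = {Star}, Dom = (\<lambda>f \<in> {Star}. Star), Cod = (\<lambda>f \<in> {Star}. Star),
      Id = (\<lambda>x \<in> {Star}. Star),
      Comp = (\<lambda>g f. if g = Star \<and> f = Star then Star else undefined)\<rparr>"

definition prod_functor :: "'u scat \<Rightarrow> 'u scat \<Rightarrow> 'u sfunctr \<Rightarrow> 'u sfunctr \<Rightarrow> 'u sfunctr" where
  "prod_functor C D F G =
     \<lparr>FOb = (\<lambda>p \<in> Ob (prod_cat C D). Pr (FOb F (pr1 p)) (FOb G (pr2 p))),
      FAr = (\<lambda>p \<in> Ar (prod_cat C D). Pr (FAr F (pr1 p)) (FAr G (pr2 p)))\<rparr>"

definition assoc_functor :: "'u scat \<Rightarrow> 'u scat \<Rightarrow> 'u scat \<Rightarrow> 'u sfunctr" where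
  "assoc_functor C D K =
     \<lparr>FOb = (\<lambda>p \<in> Ob (prod_cat (prod_cat C D) K). Pr (pr1 (pr1 p)) (Pr (pr2 (pr1 p)) (pr2 p))),
      FAr = (\<lambda>p \<in> Ar (prod_cat (prod_cat C D) K). Pr (pr1 (pr1 p)) (Pr (pr2 (pr1 p)) (pr2 p)))\<rparr>"

definition lunit_functor :: "'u scat \<Rightarrow> 'u sfunctr" where
  "lunit_functor C =
     \<lparr>FOb = (\<lambda>p \<in> Ob (prod_cat one_cat C). pr2 p), FAr = (\<lambda>p \<in> Ar (prod_cat one_cat C). pr2 p)\<rparr>"

definition runit_functor :: "'u scat \<Rightarrow> 'u sfunctr" where
  "runit_functor C =
     \<lparr>FOb = (\<lambda>p \<in> Ob (prod_cat C one_cat). pr1 p), FAr = (\<lambda>p \<in> Ar (prod_cat C one_cat). pr1 p)\<rparr>"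

definition swap_functor :: "'u scat \<Rightarrow> 'u scat \<Rightarrow> 'u sfunctr" where
  "swap_functor C D =
     \<lparr>FOb = (\<lambda>p \<in> Ob (prod_cat C D). Pr (pr2 p) (pr1 p)),
      FAr = (\<lambda>p \<in> Ar (prod_cat C D). Pr (pr2 p) (pr1 p))\<rparr>"

definition CAT :: "('u scat, ('u scat, 'u sfunctr) mor) smc" where
  "CAT =
     \<lparr>Ob = {C. category C \<and> normalized_cat C},
      Ar = {f. category (Src f) \<and> normalized_cat (Src f) \<and> category (Tgt f)
              \<and> normalized_cat (Tgt f) \<and> is_functor (Src f) (Tgt f) (Dat f)},
      Dom = Src,
      Cod = Tgt,
      Id = (\<lambda>C. \<lparr>Src = C, Tgt = C, Dat = id_functor C\<rparr>),
      Comp = (\<lambda>g f. \<lparr>Src = Src f, Tgt = Tgt g, Dat = comp_functor (Src f) (Dat g) (Dat f)\<rparr>),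
      tobj = prod_cat,
      tarr = (\<lambda>f g. \<lparr>Src = prod_cat (Src f) (Src g), Tgt = prod_cat (Tgt f) (Tgt g),
                     Dat = prod_functor (Src f) (Src g) (Dat f) (Dat g)\<rparr>),
      tunit = one_cat,
      assoc = (\<lambda>C D K. \<lparr>Src = prod_cat (prod_cat C D) K, Tgt = prod_cat C (prod_cat D K),
                        Dat = assoc_functor C D K\<rparr>),
      lunit = (\<lambda>C. \<lparr>Src = prod_cat one_cat C, Tgt = C, Dat = lunit_functor C\<rparr>),
      runit = (\<lambda>C. \<lparr>Src = prod_cat C one_cat, Tgt = C, Dat = runit_functor C\<rparr>),
      swap = (\<lambda>C D. \<lparr>Src = prod_cat C D, Tgt = prod_cat D C, Dat = swap_functor C D\<rparr>)\<rparr>"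


section \<open>The symmetric monoidal category \<open>\<F>(\<S>)\<close>\<close>

type_synonym ('u, 'o, 'a) fobj = "'u scat \<times> ('u univ, 'u univ, 'o, 'a) functr"
type_synonym ('u, 'o, 'a) fmor =
  "(('u, 'o, 'a) fobj, 'u sfunctr \<times> ('u univ \<Rightarrow> 'a)) mor"

definition fs_obj :: "('o, 'a, 'z) smc_scheme \<Rightarrow> ('u, 'o, 'a) fobj set" where
  "fs_obj S = {(C, F). category C \<and> normalized_cat C \<and> is_functor C S F}"

definition fs_arr :: "('o, 'a, 'z) smc_scheme \<Rightarrow> ('u, 'o, 'a) fmor set" where
  "fs_arr S = {f. Src f \<in> fs_obj S \<and> Tgt f \<in> fs_obj S
     \<and> is_functor (fst (Src f)) (fst (Tgt f)) (fst (Dat f))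
     \<and> is_nat_trans (fst (Src f)) S (snd (Src f))
         (comp_functor (fst (Src f)) (snd (Tgt f)) (fst (Dat f))) (snd (Dat f))}"

definition fs_tobj :: "('o, 'a, 'z) smc_scheme
    \<Rightarrow> ('u, 'o, 'a) fobj \<Rightarrow> ('u, 'o, 'a) fobj \<Rightarrow> ('u, 'o, 'a) fobj" where
  "fs_tobj S = (\<lambda>(C, F) (D, G).
     (prod_cat C D,
      \<lparr>FOb = (\<lambda>p \<in> Ob (prod_cat C D). FOb F (pr1 p) \<boxtimes>\<^bsub>S\<^esub> FOb G (pr2 p)),
       FAr = (\<lambda>p \<in> Ar (prod_cat C D). FAr F (pr1 p) \<odot>\<^bsub>S\<^esub> FAr G (pr2 p))\<rparr>))"

definition fs_unit :: "('o, 'a, 'z) smc_scheme \<Rightarrow> ('u, 'o, 'a) fobj" where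
  "fs_unit S =
     (one_cat, \<lparr>FOb = (\<lambda>x \<in> {Star}. tunit S), FAr = (\<lambda>f \<in> {Star}. Id S (tunit S))\<rparr>)"

definition FS :: "('o, 'a, 'z) smc_scheme \<Rightarrow> (('u, 'o, 'a) fobj, ('u, 'o, 'a) fmor) smc" where
  "FS S =
     \<lparr>Ob = fs_obj S,
      Ar = fs_arr S,
      Dom = Src,
      Cod = Tgt,
      Id = (\<lambda>X. \<lparr>Src = X, Tgt = X,
                 Dat = (id_functor (fst X), \<lambda>x \<in> Ob (fst X). Id S (FOb (snd X) x))\<rparr>),
      Comp = (\<lambda>g f. \<lparr>Src = Src f, Tgt = Tgt g,
                 Dat = (comp_functor (fst (Src f)) (fst (Dat g)) (fst (Dat f)),
                        \<lambda>x \<in> Ob (fst (Src f)). snd (Dat g) (FOb (fst (Dat f)) x) \<cdot>\<^bsub>S\<^esub> snd (Dat f) x)\<rparr>),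
      tobj = fs_tobj S,
      tarr = (\<lambda>f g. \<lparr>Src = fs_tobj S (Src f) (Src g), Tgt = fs_tobj S (Tgt f) (Tgt g),
                 Dat = (prod_functor (fst (Src f)) (fst (Src g)) (fst (Dat f)) (fst (Dat g)),
                        \<lambda>p \<in> Ob (prod_cat (fst (Src f)) (fst (Src g))).
                          snd (Dat f) (pr1 p) \<odot>\<^bsub>S\<^esub> snd (Dat g) (pr2 p))\<rparr>),
      tunit = fs_unit S,
      assoc = (\<lambda>X Y Z. \<lparr>Src = fs_tobj S (fs_tobj S X Y) Z, Tgt = fs_tobj S X (fs_tobj S Y Z),
                 Dat = (assoc_functor (fst X) (fst Y) (fst Z),
                        \<lambda>p \<in> Ob (prod_cat (prod_cat (fst X) (fst Y)) (fst Z)).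
                          assoc S (FOb (snd X) (pr1 (pr1 p))) (FOb (snd Y) (pr2 (pr1 p)))
                                  (FOb (snd Z) (pr2 p)))\<rparr>),
      lunit = (\<lambda>X. \<lparr>Src = fs_tobj S (fs_unit S) X, Tgt = X,
                 Dat = (lunit_functor (fst X),
                        \<lambda>p \<in> Ob (prod_cat one_cat (fst X)). lunit S (FOb (snd X) (pr2 p)))\<rparr>),
      runit = (\<lambda>X. \<lparr>Src = fs_tobj S X (fs_unit S), Tgt = X,
                 Dat = (runit_functor (fst X),
                        \<lambda>p \<in> Ob (prod_cat (fst X) one_cat). runit S (FOb (snd X) (pr1 p)))\<rparr>),
      swap = (\<lambda>X Y. \<lparr>Src = fs_tobj S X Y, Tgt = fs_tobj S Y X,
                 Dat = (swap_functor (fst X) (fst Y),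
                        \<lambda>p \<in> Ob (prod_cat (fst X) (fst Y)).
                          swap S (FOb (snd X) (pr1 p)) (FOb (snd Y) (pr2 p)))\<rparr>)\<rparr>"

text \<open>The forgetful functor \<open>(\<C>, F) \<mapsto> \<C>\<close> to small categories, on arrows and on bialgebra data.\<close>

definition base_mor :: "('u, 'o, 'a) fmor \<Rightarrow> ('u scat, 'u sfunctr) mor" where
  "base_mor f = \<lparr>Src = fst (Src f), Tgt = fst (Tgt f), Dat = fst (Dat f)\<rparr>"

definition base :: "(('u, 'o, 'a) fobj, ('u, 'o, 'a) fmor) bialg
    \<Rightarrow> ('u scat, ('u scat, 'u sfunctr) mor) bialg" where
  "base X = \<lparr>Crr = fst (Crr X), Cmul = base_mor (Cmul X), Cun = base_mor (Cun X),
             Mul = base_mor (Mul X), Unt = base_mor (Unt X)\<rparr>"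


section \<open>Crossed modules and Hopf \<open>\<chi>\<close>-algebras\<close>

record ('h, 'e) crossed =
  HG :: "'h monoid"
  EG :: "'e monoid"
  bd :: "'e \<Rightarrow> 'h"
  act :: "'h \<Rightarrow> 'e \<Rightarrow> 'e"

definition crossed_module :: "('h, 'e) crossed \<Rightarrow> bool" where
  "crossed_module X \<longleftrightarrow>
     group (HG X) \<and> group (EG X)
     \<and> bd X \<in> hom (EG X) (HG X)
     \<and> (\<forall>x \<in> carrier (HG X). act X x \<in> iso (EG X) (EG X))
     \<and> (\<forall>e \<in> carrier (EG X). act X \<one>\<^bsub>HG X\<^esub> e = e)
     \<and> (\<forall>x \<in> carrier (HG X). \<forall>y \<in> carrier (HG X). \<forall>e \<in> carrier (EG X).
          act X (x \<otimes>\<^bsub>HG X\<^esub> y) e = act X x (act X y e))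
     \<and> (\<forall>x \<in> carrier (HG X). \<forall>e \<in> carrier (EG X).
          bd X (act X x e) = x \<otimes>\<^bsub>HG X\<^esub> bd X e \<otimes>\<^bsub>HG X\<^esub> inv\<^bsub>HG X\<^esub> x)
     \<and> (\<forall>e \<in> carrier (EG X). \<forall>f \<in> carrier (EG X).
          act X (bd X e) f = e \<otimes>\<^bsub>EG X\<^esub> f \<otimes>\<^bsub>EG X\<^esub> inv\<^bsub>EG X\<^esub> e)"

text \<open>As for small categories: makes equality of crossed modules the intended one.\<close>

definition normalized_crossed :: "('h, 'e) crossed \<Rightarrow> bool" where
  "normalized_crossed X \<longleftrightarrow>
     (\<forall>x y. \<not> (x \<in> carrier (HG X) \<and> y \<in> carrier (HG X)) \<longrightarrow> x \<otimes>\<^bsub>HG X\<^esub> y = undefined)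
     \<and> (\<forall>e f. \<not> (e \<in> carrier (EG X) \<and> f \<in> carrier (EG X)) \<longrightarrow> e \<otimes>\<^bsub>EG X\<^esub> f = undefined)
     \<and> bd X \<in> extensional (carrier (EG X))
     \<and> (\<forall>x e. \<not> (x \<in> carrier (HG X) \<and> e \<in> carrier (EG X)) \<longrightarrow> act X x e = undefined)"

record ('h, 'e, 'o, 'a) chialg =
  Coa :: "'h \<Rightarrow> ('o, 'a) coalg"
  mu :: "'h \<Rightarrow> 'h \<Rightarrow> 'a"
  eta :: "'a"
  anti :: "'h \<Rightarrow> 'a"
  phi :: "'h \<Rightarrow> 'e \<Rightarrow> 'a"

definition hopf_chi_algebra ::
  "('o, 'a, 'z) smc_scheme \<Rightarrow> ('h, 'e) crossed \<Rightarrow> ('h, 'e, 'o, 'a) chialg \<Rightarrow> bool" where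
  "hopf_chi_algebra S X A \<longleftrightarrow>
     (let H = HG X; E = EG X; \<chi> = bd X; one = \<one>\<^bsub>H\<^esub>; ob = (\<lambda>x. Crr (Coa A x)) in
     (\<forall>x \<in> carrier H. coalgebra S (Coa A x))
     \<and> (\<forall>x \<in> carrier H. \<forall>y \<in> carrier H.
          coalg_mor S (tensor_coalg S (Coa A x) (Coa A y)) (Coa A (x \<otimes>\<^bsub>H\<^esub> y)) (mu A x y))
     \<and> coalg_mor S (unit_coalg S) (Coa A one) (eta A)
     \<and> (\<forall>x \<in> carrier H. anti A x \<in> homs S (ob x) (ob (inv\<^bsub>H\<^esub> x)) \<and> invertible S (anti A x))
     \<and> (\<forall>x \<in> carrier H. \<forall>e \<in> carrier E.
          coalg_mor S (Coa A x) (Coa A (\<chi> e \<otimes>\<^bsub>H\<^esub> x)) (phi A x e) \<and> invertible S (phi A x e))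
     \<and> (\<forall>x \<in> carrier H. \<forall>y \<in> carrier H. \<forall>z \<in> carrier H.
          mu A (x \<otimes>\<^bsub>H\<^esub> y) z \<cdot>\<^bsub>S\<^esub> (mu A x y \<odot>\<^bsub>S\<^esub> Id S (ob z))
          = mu A x (y \<otimes>\<^bsub>H\<^esub> z) \<cdot>\<^bsub>S\<^esub> (Id S (ob x) \<odot>\<^bsub>S\<^esub> mu A y z) \<cdot>\<^bsub>S\<^esub> assoc S (ob x) (ob y) (ob z))
     \<and> (\<forall>x \<in> carrier H. mu A x one \<cdot>\<^bsub>S\<^esub> (Id S (ob x) \<odot>\<^bsub>S\<^esub> eta A) = runit S (ob x))
     \<and> (\<forall>x \<in> carrier H. mu A one x \<cdot>\<^bsub>S\<^esub> (eta A \<odot>\<^bsub>S\<^esub> Id S (ob x)) = lunit S (ob x))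
     \<and> (\<forall>x \<in> carrier H.
          mu A (inv\<^bsub>H\<^esub> x) x \<cdot>\<^bsub>S\<^esub> (anti A x \<odot>\<^bsub>S\<^esub> Id S (ob x)) \<cdot>\<^bsub>S\<^esub> Cmul (Coa A x)
          = eta A \<cdot>\<^bsub>S\<^esub> Cun (Coa A x))
     \<and> (\<forall>x \<in> carrier H.
          mu A x (inv\<^bsub>H\<^esub> x) \<cdot>\<^bsub>S\<^esub> (Id S (ob x) \<odot>\<^bsub>S\<^esub> anti A x) \<cdot>\<^bsub>S\<^esub> Cmul (Coa A x)
          = eta A \<cdot>\<^bsub>S\<^esub> Cun (Coa A x))
     \<and> (\<forall>x \<in> carrier H. phi A x \<one>\<^bsub>E\<^esub> = Id S (ob x))
     \<and> (\<forall>x \<in> carrier H. \<forall>e \<in> carrier E. \<forall>f \<in> carrier E.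
          phi A (\<chi> e \<otimes>\<^bsub>H\<^esub> x) f \<cdot>\<^bsub>S\<^esub> phi A x e = phi A x (f \<otimes>\<^bsub>E\<^esub> e))
     \<and> (\<forall>x \<in> carrier H. \<forall>y \<in> carrier H. \<forall>e \<in> carrier E. \<forall>f \<in> carrier E.
          mu A (\<chi> e \<otimes>\<^bsub>H\<^esub> x) (\<chi> f \<otimes>\<^bsub>H\<^esub> y) \<cdot>\<^bsub>S\<^esub> (phi A x e \<odot>\<^bsub>S\<^esub> phi A y f)
          = phi A (x \<otimes>\<^bsub>H\<^esub> y) (e \<otimes>\<^bsub>E\<^esub> act X x f) \<cdot>\<^bsub>S\<^esub> mu A x y))"

definition normalized_chialg :: "('h, 'e) crossed \<Rightarrow> ('h, 'e, 'o, 'a) chialg \<Rightarrow> bool" where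
  "normalized_chialg X A \<longleftrightarrow>
     Coa A \<in> extensional (carrier (HG X))
     \<and> (\<forall>x y. \<not> (x \<in> carrier (HG X) \<and> y \<in> carrier (HG X)) \<longrightarrow> mu A x y = undefined)
     \<and> anti A \<in> extensional (carrier (HG X))
     \<and> (\<forall>x e. \<not> (x \<in> carrier (HG X) \<and> e \<in> carrier (EG X)) \<longrightarrow> phi A x e = undefined)"

definition chi_pairs ::
  "('o, 'a, 'z) smc_scheme \<Rightarrow> (('h, 'e) crossed \<times> ('h, 'e, 'o, 'a) chialg) set" where
  "chi_pairs S = {(X, A). crossed_module X \<and> normalized_crossed X
                         \<and> hopf_chi_algebra S X A \<and> normalized_chialg X A}"

definition crossed_iso :: "('h, 'e) crossed \<Rightarrow> ('h, 'e) crossed \<Rightarrow> ('h \<Rightarrow> 'h) \<Rightarrow> ('e \<Rightarrow> 'e) \<Rightarrow> bool"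
where
  "crossed_iso X Y \<beta> \<alpha> \<longleftrightarrow>
     \<beta> \<in> iso (HG X) (HG Y) \<and> \<alpha> \<in> iso (EG X) (EG Y)
     \<and> (\<forall>e \<in> carrier (EG X). bd Y (\<alpha> e) = \<beta> (bd X e))
     \<and> (\<forall>x \<in> carrier (HG X). \<forall>e \<in> carrier (EG X). \<alpha> (act X x e) = act Y (\<beta> x) (\<alpha> e))"

text \<open>Isomorphism of pairs: an isomorphism of crossed modules together with coalgebra isomorphisms
  \<open>\<theta>\<^sub>x : A\<^sub>x \<rightarrow> B\<^bsub>\<beta>(x)\<^esub>\<close> compatible with all the structure.\<close>

definition pair_iso :: "('o, 'a, 'z) smc_scheme \<Rightarrow> ('h, 'e) crossed \<times> ('h, 'e, 'o, 'a) chialg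
    \<Rightarrow> ('h, 'e) crossed \<times> ('h, 'e, 'o, 'a) chialg \<Rightarrow> bool" where
  "pair_iso S = (\<lambda>(X, A) (Y, B). \<exists>\<beta> \<alpha> \<theta>.
     crossed_iso X Y \<beta> \<alpha>
     \<and> (\<forall>x \<in> carrier (HG X).
          coalg_mor S (Coa A x) (Coa B (\<beta> x)) (\<theta> x) \<and> invertible S (\<theta> x))
     \<and> (\<forall>x \<in> carrier (HG X). \<forall>y \<in> carrier (HG X).
          \<theta> (x \<otimes>\<^bsub>HG X\<^esub> y) \<cdot>\<^bsub>S\<^esub> mu A x y = mu B (\<beta> x) (\<beta> y) \<cdot>\<^bsub>S\<^esub> (\<theta> x \<odot>\<^bsub>S\<^esub> \<theta> y))
     \<and> \<theta> \<one>\<^bsub>HG X\<^esub> \<cdot>\<^bsub>S\<^esub> eta A = eta B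
     \<and> (\<forall>x \<in> carrier (HG X). \<theta> (inv\<^bsub>HG X\<^esub> x) \<cdot>\<^bsub>S\<^esub> anti A x = anti B (\<beta> x) \<cdot>\<^bsub>S\<^esub> \<theta> x)
     \<and> (\<forall>x \<in> carrier (HG X). \<forall>e \<in> carrier (EG X).
          \<theta> (bd X e \<otimes>\<^bsub>HG X\<^esub> x) \<cdot>\<^bsub>S\<^esub> phi A x e = phi B (\<beta> x) (\<alpha> e) \<cdot>\<^bsub>S\<^esub> \<theta> x))"


section \<open>The Hopf algebra \<open>\<G>\<^sub>\<chi>\<close> in small categories\<close>

text \<open>The arrow \<open>e : x \<rightarrow> \<chi>(e)x\<close> is encoded as \<open>Pr x e\<close>.\<close>

type_synonym 'u scrossed = "('u univ, 'u univ) crossed"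

definition G_cat :: "'u scrossed \<Rightarrow> 'u scat" where
  "G_cat X = (let H = HG X; E = EG X; R = ptimes (carrier H) (carrier E) in
     \<lparr>Ob = carrier H,
      Ar = R,
      Dom = (\<lambda>a \<in> R. pr1 a),
      Cod = (\<lambda>a \<in> R. bd X (pr2 a) \<otimes>\<^bsub>H\<^esub> pr1 a),
      Id = (\<lambda>x \<in> carrier H. Pr x \<one>\<^bsub>E\<^esub>),
      Comp = (\<lambda>b a. if b \<in> R \<and> a \<in> R \<and> pr1 b = bd X (pr2 a) \<otimes>\<^bsub>H\<^esub> pr1 a
                    then Pr (pr1 a) (pr2 b \<otimes>\<^bsub>E\<^esub> pr2 a) else undefined)\<rparr>)"

definition G_mul :: "'u scrossed \<Rightarrow> 'u sfunctr" where
  "G_mul X =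
     \<lparr>FOb = (\<lambda>p \<in> Ob (prod_cat (G_cat X) (G_cat X)). pr1 p \<otimes>\<^bsub>HG X\<^esub> pr2 p),
      FAr = (\<lambda>p \<in> Ar (prod_cat (G_cat X) (G_cat X)).
               Pr (pr1 (pr1 p) \<otimes>\<^bsub>HG X\<^esub> pr1 (pr2 p))
                  (pr2 (pr1 p) \<otimes>\<^bsub>EG X\<^esub> act X (pr1 (pr1 p)) (pr2 (pr2 p))))\<rparr>"

definition G_un :: "'u scrossed \<Rightarrow> 'u sfunctr" where
  "G_un X = \<lparr>FOb = (\<lambda>x \<in> {Star}. \<one>\<^bsub>HG X\<^esub>), FAr = (\<lambda>f \<in> {Star}. Pr \<one>\<^bsub>HG X\<^esub> \<one>\<^bsub>EG X\<^esub>)\<rparr>"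

definition G_cmul :: "'u scrossed \<Rightarrow> 'u sfunctr" where
  "G_cmul X = \<lparr>FOb = (\<lambda>x \<in> Ob (G_cat X). Pr x x), FAr = (\<lambda>a \<in> Ar (G_cat X). Pr a a)\<rparr>"

definition G_cun :: "'u scrossed \<Rightarrow> 'u sfunctr" where
  "G_cun X = \<lparr>FOb = (\<lambda>x \<in> Ob (G_cat X). Star), FAr = (\<lambda>a \<in> Ar (G_cat X). Star)\<rparr>"

definition G_anti :: "'u scrossed \<Rightarrow> 'u sfunctr" where
  "G_anti X =
     \<lparr>FOb = (\<lambda>x \<in> Ob (G_cat X). inv\<^bsub>HG X\<^esub> x),
      FAr = (\<lambda>a \<in> Ar (G_cat X).
               Pr (inv\<^bsub>HG X\<^esub> pr1 a) (act X (inv\<^bsub>HG X\<^esub> pr1 a) (inv\<^bsub>EG X\<^esub> pr2 a)))\<rparr>"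

definition G_hopf :: "'u scrossed \<Rightarrow> ('u scat, ('u scat, 'u sfunctr) mor) bialg" where
  "G_hopf X = (let G = G_cat X in
     \<lparr>Crr = G,
      Cmul = \<lparr>Src = G, Tgt = prod_cat G G, Dat = G_cmul X\<rparr>,
      Cun = \<lparr>Src = G, Tgt = one_cat, Dat = G_cun X\<rparr>,
      Mul = \<lparr>Src = prod_cat G G, Tgt = G, Dat = G_mul X\<rparr>,
      Unt = \<lparr>Src = one_cat, Tgt = G, Dat = G_un X\<rparr>\<rparr>)"


section \<open>The Hopf algebra in \<open>\<F>(\<S>)\<close> attached to \<open>(\<chi>, A)\<close>\<close>

definition FA_obj :: "'u scrossed \<Rightarrow> ('u univ, 'u univ, 'o, 'a) chialg \<Rightarrow> ('u, 'o, 'a) fobj" where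
  "FA_obj X A =
     (G_cat X,
      \<lparr>FOb = (\<lambda>x \<in> Ob (G_cat X). Crr (Coa A x)),
       FAr = (\<lambda>a \<in> Ar (G_cat X). phi A (pr1 a) (pr2 a))\<rparr>)"

definition FA_hopf :: "('o, 'a, 'z) smc_scheme
    \<Rightarrow> 'u scrossed \<times> ('u univ, 'u univ, 'o, 'a) chialg
    \<Rightarrow> (('u, 'o, 'a) fobj, ('u, 'o, 'a) fmor) bialg" where
  "FA_hopf S = (\<lambda>(X, A).
     let P = FA_obj X A; PP = fs_tobj S P P; H = carrier (HG X) in
     \<lparr>Crr = P,
      Cmul = \<lparr>Src = P, Tgt = PP, Dat = (G_cmul X, \<lambda>x \<in> H. Cmul (Coa A x))\<rparr>,
      Cun = \<lparr>Src = P, Tgt = fs_unit S, Dat = (G_cun X, \<lambda>x \<in> H. Cun (Coa A x))\<rparr>,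
      Mul = \<lparr>Src = PP, Tgt = P, Dat = (G_mul X, \<lambda>p \<in> ptimes H H. mu A (pr1 p) (pr2 p))\<rparr>,
      Unt = \<lparr>Src = fs_unit S, Tgt = P, Dat = (G_un X, \<lambda>x \<in> {Star}. eta A)\<rparr>\<rparr>)"

definition FA_anti :: "'u scrossed \<times> ('u univ, 'u univ, 'o, 'a) chialg \<Rightarrow> ('u, 'o, 'a) fmor" where
  "FA_anti = (\<lambda>(X, A).
     \<lparr>Src = FA_obj X A, Tgt = FA_obj X A, Dat = (G_anti X, \<lambda>x \<in> carrier (HG X). anti A x)\<rparr>)"

text \<open>The arrow \<open>(\<Gamma>, id)\<close> of \<open>\<F>(\<S>)\<close> over an arrow \<open>\<Gamma>\<close> of small categories.\<close>

definition over_mor :: "('o, 'a, 'z) smc_scheme \<Rightarrow> ('u, 'o, 'a) fobj \<Rightarrow> ('u, 'o, 'a) fobj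
    \<Rightarrow> ('u scat, 'u sfunctr) mor \<Rightarrow> ('u, 'o, 'a) fmor" where
  "over_mor S P Q \<Gamma> =
     \<lparr>Src = P, Tgt = Q, Dat = (Dat \<Gamma>, \<lambda>x \<in> Ob (fst P). Id S (FOb (snd P) x))\<rparr>"

end

theory Submission
  imports Defs
begin

text \<open>An equation between arrows of \<open>\<F>(\<S>)\<close> is an equation between functors together with one
  equation in \<open>\<S>\<close> over every object of the source, so the Hopf algebra axioms in \<open>\<F>(\<S>)\<close> split into
  the axioms for the base in \<open>Cat\<close> and equations between fibres.  In the cartesian category \<open>Cat\<close>
  the counit laws force the comultiplication to be the diagonal; the base is thus a group object,
  and it is recovered from the group \<open>H\<close> of its objects and the group \<open>E\<close> of its arrows with source
  \<open>1\<close>, because composition is given by \<open>g \<circ> f = g \<cdot> id\<inverse> \<cdot> f\<close>.  The equations between fibres are the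
  axioms of a Hopf \<open>\<chi>\<close>-algebra, up to the naturality of the antipode and its preservation by
  isomorphisms; both follow from the uniqueness of convolution inverses in \<open>\<S>\<close>.\<close>

section \<open>Functors between small categories\<close>

text \<open>The bijection is about equality, but the base of a Hopf algebra in \<open>FS S\<close>
  need not have arrows of the form \<open>Pr x e\<close>, so in general it is only isomorphic to
  some \<open>G_hopf \<chi>\<close>. The proof therefore works relative to an identification
  \<Gamma> of the base and transports the fibres along the inverse of \<Gamma>. The isomorphism over
  \<Gamma> has identity components: an identity that is a coalgebra morphism forces its two
  coalgebras to be equal, so this isomorphism determines the Hopf \<chi>-algebra exactly and not
  merely up to isomorphism. With \<Gamma> the identity, the same construction gives surjectivity of
  \<open>FA_hopf\<close>.

  Equivariance of the boundary and the Peiffer identity express that the product of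
  \<open>G_cat\<close> respects targets and composition. In the other direction the Peiffer identity
  comes from the interchange law, which makes arrows into 1 commute with arrows out of 1. The
  antipode is a component of a Hopf \<chi>-algebra but not of a bialgebra record; its uniqueness is
  also what keeps \<open>FA_hopf\<close> injective.\<close>

lemma Pr_in_ptimes [simp]: "Pr a b \<in> ptimes A B \<longleftrightarrow> a \<in> A \<and> b \<in> B"
  by (auto simp: ptimes_def)

text \<open>Quantifiers over objects or arrows of a product become quantifiers over
  \<open>Pr a b\<close>, the form on which the selector rules for products compute.\<close>

lemma ball_ptimes [simp]: "(\<forall>p \<in> ptimes A B. P p) \<longleftrightarrow> (\<forall>a \<in> A. \<forall>b \<in> B. P (Pr a b))"
  by (auto simp: ptimes_def)

lemma ptimesE [elim!]:
  assumes "p \<in> ptimes A B" obtains a b where "p = Pr a b" "a \<in> A" "b \<in> B"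
  using assms by (auto simp: ptimes_def)

lemma restrict_eq_iff: "restrict f A = restrict g A \<longleftrightarrow> (\<forall>x \<in> A. f x = g x)"
  by (metis restrict_apply' restrict_ext)

lemma extensional_eq_iff:
  "f \<in> extensional A \<Longrightarrow> g \<in> extensional A \<Longrightarrow> f = g \<longleftrightarrow> (\<forall>x \<in> A. f x = g x)"
  by (auto intro: extensionalityI)

text \<open>Free of \<open>homs\<close>: sources and targets appear as equations, which rewriting
  can use, whereas rules about \<open>homs C X Y\<close> require the intermediate objects to be
  guessed. The forms below for functors serve the same purpose.\<close>

lemma category_iff: "category C \<longleftrightarrow>
    (\<forall>f \<in> Ar C. Dom C f \<in> Ob C \<and> Cod C f \<in> Ob C)
  \<and> (\<forall>X \<in> Ob C. Id C X \<in> Ar C \<and> Dom C (Id C X) = X \<and> Cod C (Id C X) = X)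
  \<and> (\<forall>f \<in> Ar C. \<forall>g \<in> Ar C. Dom C g = Cod C f \<longrightarrow>
       g \<cdot>\<^bsub>C\<^esub> f \<in> Ar C \<and> Dom C (g \<cdot>\<^bsub>C\<^esub> f) = Dom C f \<and> Cod C (g \<cdot>\<^bsub>C\<^esub> f) = Cod C g)
  \<and> (\<forall>f \<in> Ar C. f \<cdot>\<^bsub>C\<^esub> Id C (Dom C f) = f \<and> Id C (Cod C f) \<cdot>\<^bsub>C\<^esub> f = f)
  \<and> (\<forall>f \<in> Ar C. \<forall>g \<in> Ar C. \<forall>h \<in> Ar C. Dom C g = Cod C f \<longrightarrow> Dom C h = Cod C g \<longrightarrow>
       (h \<cdot>\<^bsub>C\<^esub> g) \<cdot>\<^bsub>C\<^esub> f = h \<cdot>\<^bsub>C\<^esub> (g \<cdot>\<^bsub>C\<^esub> f))"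
  unfolding category_def homs_def by (auto; blast)

lemma is_functor_iff: "is_functor C D F \<longleftrightarrow>
    FOb F \<in> extensional (Ob C) \<and> FAr F \<in> extensional (Ar C)
  \<and> (\<forall>X \<in> Ob C. FOb F X \<in> Ob D)
  \<and> (\<forall>f \<in> Ar C. FAr F f \<in> Ar D \<and> Dom D (FAr F f) = FOb F (Dom C f)
                \<and> Cod D (FAr F f) = FOb F (Cod C f))
  \<and> (\<forall>X \<in> Ob C. FAr F (Id C X) = Id D (FOb F X))
  \<and> (\<forall>f \<in> Ar C. \<forall>g \<in> Ar C. Dom C g = Cod C f \<longrightarrow>
       FAr F (g \<cdot>\<^bsub>C\<^esub> f) = FAr F g \<cdot>\<^bsub>D\<^esub> FAr F f)"
  unfolding is_functor_def homs_def by auto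

text \<open>The components stay in \<open>homs\<close>, because they will be arrows of
  \<open>S\<close>, whose axioms are stated with \<open>homs\<close>; only the naturality squares
  are indexed by arrows.\<close>

lemma is_nat_trans_iff: "is_nat_trans C D F G \<gamma> \<longleftrightarrow>
    \<gamma> \<in> extensional (Ob C)
  \<and> (\<forall>X \<in> Ob C. \<gamma> X \<in> homs D (FOb F X) (FOb G X))
  \<and> (\<forall>f \<in> Ar C. \<gamma> (Cod C f) \<cdot>\<^bsub>D\<^esub> FAr F f = FAr G f \<cdot>\<^bsub>D\<^esub> \<gamma> (Dom C f))"
  unfolding is_nat_trans_def homs_def by auto

lemma functr_eq_iff: "is_functor C D F \<Longrightarrow> is_functor C D' G \<Longrightarrow>
    F = G \<longleftrightarrow> (\<forall>x \<in> Ob C. FOb F x = FOb G x) \<and> (\<forall>f \<in> Ar C. FAr F f = FAr G f)"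
  unfolding is_functor_def
  by (auto intro!: functr.equality extensionalityI[of "FOb F" "Ob C" "FOb G"]
      extensionalityI[of "FAr F" "Ar C" "FAr G"])

section \<open>Products of small categories and the one-arrow category\<close>

lemma prod_cat_sel [simp]:
  "Ob (prod_cat C D) = ptimes (Ob C) (Ob D)"
  "Ar (prod_cat C D) = ptimes (Ar C) (Ar D)"
  "\<lbrakk>f \<in> Ar C; g \<in> Ar D\<rbrakk> \<Longrightarrow> Dom (prod_cat C D) (Pr f g) = Pr (Dom C f) (Dom D g)"
  "\<lbrakk>f \<in> Ar C; g \<in> Ar D\<rbrakk> \<Longrightarrow> Cod (prod_cat C D) (Pr f g) = Pr (Cod C f) (Cod D g)"
  "\<lbrakk>x \<in> Ob C; y \<in> Ob D\<rbrakk> \<Longrightarrow> Id (prod_cat C D) (Pr x y) = Pr (Id C x) (Id D y)"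
  "\<lbrakk>f \<in> Ar C; g \<in> Ar D; f' \<in> Ar C; g' \<in> Ar D; Dom C f' = Cod C f; Dom D g' = Cod D g\<rbrakk>
    \<Longrightarrow> Pr f' g' \<cdot>\<^bsub>prod_cat C D\<^esub> Pr f g = Pr (f' \<cdot>\<^bsub>C\<^esub> f) (g' \<cdot>\<^bsub>D\<^esub> g)"
  by (auto simp: prod_cat_def)

lemma one_cat_sel [simp]:
  "Ob one_cat = {Star}" "Ar one_cat = {Star}" "Dom one_cat Star = Star" "Cod one_cat Star = Star"
  "Id one_cat Star = Star" "Star \<cdot>\<^bsub>one_cat\<^esub> Star = Star"
  by (auto simp: one_cat_def)

lemma category_prod_cat: "category C \<Longrightarrow> category D \<Longrightarrow> category (prod_cat C D)"
  by (simp add: category_iff)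

lemma normalized_prod_cat: "normalized_cat (prod_cat C D)"
  unfolding normalized_cat_def
  by (auto simp: prod_cat_def extensional_def ptimes_def)

lemma category_one_cat: "category one_cat"
  by (simp add: category_iff)

lemma normalized_one_cat: "normalized_cat one_cat"
  unfolding normalized_cat_def
  by (auto simp: one_cat_def)

lemma is_functor_id: "category C \<Longrightarrow> is_functor C C (id_functor C)"
  by (auto simp: is_functor_iff id_functor_def category_iff)

lemma is_functor_comp:
  assumes "category C" "is_functor C D F" "is_functor D E G"
  shows "is_functor C E (comp_functor C G F)"
  using assms by (auto simp: is_functor_iff comp_functor_def category_iff compose_eq)

lemma is_functor_assoc: "category C \<Longrightarrow> category D \<Longrightarrow> category E \<Longrightarrow>
  is_functor (prod_cat (prod_cat C D) E) (prod_cat C (prod_cat D E)) (assoc_functor C D E)"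
  by (auto simp: is_functor_iff assoc_functor_def category_iff)

lemma is_functor_lunit: "category C \<Longrightarrow> is_functor (prod_cat one_cat C) C (lunit_functor C)"
  by (auto simp: is_functor_iff lunit_functor_def category_iff)

section \<open>The categories of small categories and of \<open>\<F>(\<S>)\<close>\<close>

lemma CAT_sel [simp]:
  "Ob CAT = {C. category C \<and> normalized_cat C}"
  "Ar CAT = {f. category (Src f) \<and> normalized_cat (Src f) \<and> category (Tgt f)
              \<and> normalized_cat (Tgt f) \<and> is_functor (Src f) (Tgt f) (Dat f)}"
  "Dom CAT = Src" "Cod CAT = Tgt"
  "Id CAT C = \<lparr>Src = C, Tgt = C, Dat = id_functor C\<rparr>"
  "g \<cdot>\<^bsub>CAT\<^esub> f = \<lparr>Src = Src f, Tgt = Tgt g, Dat = comp_functor (Src f) (Dat g) (Dat f)\<rparr>"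
  "C \<boxtimes>\<^bsub>CAT\<^esub> D = prod_cat C D"
  "f \<odot>\<^bsub>CAT\<^esub> g = \<lparr>Src = prod_cat (Src f) (Src g), Tgt = prod_cat (Tgt f) (Tgt g),
                     Dat = prod_functor (Src f) (Src g) (Dat f) (Dat g)\<rparr>"
  "tunit CAT = one_cat"
  "assoc CAT C D E = \<lparr>Src = prod_cat (prod_cat C D) E, Tgt = prod_cat C (prod_cat D E),
                        Dat = assoc_functor C D E\<rparr>"
  "lunit CAT C = \<lparr>Src = prod_cat one_cat C, Tgt = C, Dat = lunit_functor C\<rparr>"
  "runit CAT C = \<lparr>Src = prod_cat C one_cat, Tgt = C, Dat = runit_functor C\<rparr>"
  "swap CAT C D = \<lparr>Src = prod_cat C D, Tgt = prod_cat D C, Dat = swap_functor C D\<rparr>"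
  by (simp_all add: CAT_def)

lemma mor_eq_iff: "(f :: ('x, 'd) mor) = g \<longleftrightarrow> Src f = Src g \<and> Tgt f = Tgt g \<and> Dat f = Dat g"
  by (auto intro: mor.equality)

lemma functr_eqI: "FOb F = FOb G \<Longrightarrow> FAr F = FAr G \<Longrightarrow> (F :: ('o, 'a, 'p, 'b) functr) = G"
  by (auto intro: functr.equality)

lemma in_homs_CAT: "f \<in> homs CAT C D \<longleftrightarrow> Src f = C \<and> Tgt f = D \<and> category C \<and> normalized_cat C
    \<and> category D \<and> normalized_cat D \<and> is_functor C D (Dat f)"
  by (auto simp: homs_def)

lemma restrict_eqI: "g \<in> extensional A \<Longrightarrow> (\<And>x. x \<in> A \<Longrightarrow> f x = g x) \<Longrightarrow> restrict f A = g"
  by (rule extensionalityI[of _ A]) auto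

lemma functor_sel [simp]:
  "x \<in> Ob C \<Longrightarrow> FOb (comp_functor C G F) x = FOb G (FOb F x)"
  "f \<in> Ar C \<Longrightarrow> FAr (comp_functor C G F) f = FAr G (FAr F f)"
  "x \<in> Ob C \<Longrightarrow> FOb (id_functor C) x = x"
  "f \<in> Ar C \<Longrightarrow> FAr (id_functor C) f = f"
  by (simp_all add: comp_functor_def id_functor_def compose_def)

text \<open>The laws of composition hold as equations of records because functors are extensional:
  agreement on objects and arrows of the source is enough.\<close>

lemma comp_functor_id: "category C \<Longrightarrow> is_functor C D F \<Longrightarrow> comp_functor C F (id_functor C) = F"
  by (subst functr_eq_iff[of C D _ D]) (auto intro: is_functor_comp is_functor_id)

lemma id_comp_functor: "category C \<Longrightarrow> category D \<Longrightarrow> is_functor C D F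
    \<Longrightarrow> comp_functor C (id_functor D) F = F"
  by (subst functr_eq_iff[of C D _ D])
    (auto intro: is_functor_comp is_functor_id, auto simp: is_functor_iff)

lemma comp_functor_assoc: "is_functor C D F \<Longrightarrow>
    comp_functor C (comp_functor D K G) F = comp_functor C K (comp_functor C G F)"
  by (auto simp: comp_functor_def is_functor_iff compose_def restrict_eq_iff)

lemma category_CAT: "category CAT"
  unfolding category_iff
  by (auto simp: is_functor_id is_functor_comp comp_functor_id id_comp_functor comp_functor_assoc
      mor_eq_iff)

section \<open>Inverses in an arbitrary category\<close>

lemma (in category) inverse_pair_unique:
  assumes "inverse_pair C f g" "inverse_pair C f h"
  shows "g = h"
proof -
  have g: "g \<in> homs C (Cod C f) (Dom C f)" and h: "h \<in> homs C (Cod C f) (Dom C f)"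
    and f: "f \<in> homs C (Dom C f) (Cod C f)"
    using assms by (auto simp: inverse_pair_def homs_def)
  have "g = g \<cdot> (f \<cdot> h)"
    using assms Id_right[OF g] by (simp add: inverse_pair_def)
  also have "\<dots> = (g \<cdot> f) \<cdot> h"
    by (rule Comp_assoc[OF h f g, symmetric])
  also have "\<dots> = h"
    using assms Id_left[OF h] by (simp add: inverse_pair_def)
  finally show ?thesis .
qed

lemma (in category) inverse_of_eq: "inverse_pair C f g \<Longrightarrow> inverse_of C f = g"
  unfolding inverse_of_def by (rule the_equality) (auto dest: inverse_pair_unique)

lemma (in category) inverse_of:
  assumes "f \<in> homs C X Y" "invertible C f"
  shows "inverse_of C f \<in> homs C Y X" "inverse_of C f \<cdot> f = Id C X" "f \<cdot> inverse_of C f = Id C Y"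
proof -
  obtain g where g: "inverse_pair C f g" using assms by (auto simp: invertible_def)
  have "inverse_of C f = g" using g by (rule inverse_of_eq)
  with g assms show "inverse_of C f \<in> homs C Y X" "inverse_of C f \<cdot> f = Id C X" "f
      \<cdot> inverse_of C f = Id C Y"
    by (auto simp: inverse_pair_def homs_def)
qed

section \<open>Objects and arrows of \<open>FS S\<close>\<close>

abbreviation "fun_of f \<equiv> fst (Dat f)"
abbreviation "cmp f \<equiv> snd (Dat f)"

lemma FS_sel [simp]:
  "Ob (FS S) = fs_obj S" "Ar (FS S) = fs_arr S" "Dom (FS S) = Src" "Cod (FS S) = Tgt"
  "Id (FS S) P = \<lparr>Src = P, Tgt = P,
                 Dat = (id_functor (fst P), \<lambda>x \<in> Ob (fst P). Id S (FOb (snd P) x))\<rparr>"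
  "g \<cdot>\<^bsub>FS S\<^esub> f = \<lparr>Src = Src f, Tgt = Tgt g,
                 Dat = (comp_functor (fst (Src f)) (fst (Dat g)) (fst (Dat f)),
                        \<lambda>x \<in> Ob (fst (Src f)). snd (Dat g) (FOb (fst (Dat f)) x) \<cdot>\<^bsub>S\<^esub> snd (Dat f)
                            x)\<rparr>"
  "P \<boxtimes>\<^bsub>FS S\<^esub> Q = fs_tobj S P Q"
  "f \<odot>\<^bsub>FS S\<^esub> g = \<lparr>Src = fs_tobj S (Src f) (Src g), Tgt = fs_tobj S (Tgt f) (Tgt g),
                 Dat = (prod_functor (fst (Src f)) (fst (Src g)) (fst (Dat f)) (fst (Dat g)),
                        \<lambda>p \<in> Ob (prod_cat (fst (Src f)) (fst (Src g))).
                          snd (Dat f) (pr1 p) \<odot>\<^bsub>S\<^esub> snd (Dat g) (pr2 p))\<rparr>"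
  "tunit (FS S) = fs_unit S"
  "assoc (FS S) X Y Z = \<lparr>Src = fs_tobj S (fs_tobj S X Y) Z, Tgt = fs_tobj S X (fs_tobj S Y Z),
                 Dat = (assoc_functor (fst X) (fst Y) (fst Z),
                        \<lambda>p \<in> Ob (prod_cat (prod_cat (fst X) (fst Y)) (fst Z)).
                          assoc S (FOb (snd X) (pr1 (pr1 p))) (FOb (snd Y) (pr2 (pr1 p)))
                                  (FOb (snd Z) (pr2 p)))\<rparr>"
  "lunit (FS S) X = \<lparr>Src = fs_tobj S (fs_unit S) X, Tgt = X,
                 Dat = (lunit_functor (fst X),
                        \<lambda>p \<in> Ob (prod_cat one_cat (fst X)). lunit S (FOb (snd X) (pr2 p)))\<rparr>"
  "runit (FS S) X = \<lparr>Src = fs_tobj S X (fs_unit S), Tgt = X,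
                 Dat = (runit_functor (fst X),
                        \<lambda>p \<in> Ob (prod_cat (fst X) one_cat). runit S (FOb (snd X) (pr1 p)))\<rparr>"
  "swap (FS S) X Y = \<lparr>Src = fs_tobj S X Y, Tgt = fs_tobj S Y X,
                 Dat = (swap_functor (fst X) (fst Y),
                        \<lambda>p \<in> Ob (prod_cat (fst X) (fst Y)).
                          swap S (FOb (snd X) (pr1 p)) (FOb (snd Y) (pr2 p)))\<rparr>"
  by (simp_all add: FS_def)

lemma fs_tobj_sel [simp]:
  "fst (fs_tobj S P Q) = prod_cat (fst P) (fst Q)"
  "\<lbrakk>x \<in> Ob (fst P); y \<in> Ob (fst Q)\<rbrakk>
    \<Longrightarrow> FOb (snd (fs_tobj S P Q)) (Pr x y) = FOb (snd P) x \<boxtimes>\<^bsub>S\<^esub> FOb (snd Q) y"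
  "\<lbrakk>f \<in> Ar (fst P); g \<in> Ar (fst Q)\<rbrakk>
    \<Longrightarrow> FAr (snd (fs_tobj S P Q)) (Pr f g) = FAr (snd P) f \<odot>\<^bsub>S\<^esub> FAr (snd Q) g"
  by (simp_all add: fs_tobj_def case_prod_beta)

lemma fs_unit_sel [simp]:
  "fst (fs_unit S) = one_cat" "FOb (snd (fs_unit S)) Star = tunit S"
  "FAr (snd (fs_unit S)) Star = Id S (tunit S)"
  by (simp_all add: fs_unit_def)

lemma base_mor_sel [simp]:
  "Src (base_mor f) = fst (Src f)" "Tgt (base_mor f) = fst (Tgt f)" "Dat (base_mor f) = fst (Dat f)"
  by (simp_all add: base_mor_def)

lemma in_fs_obj: "P \<in> fs_obj S \<longleftrightarrow> category (fst P) \<and> normalized_cat (fst P)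
    \<and> is_functor (fst P) S (snd P)"
  by (cases P) (simp add: fs_obj_def)

lemma fs_objD: assumes "P \<in> fs_obj S" shows "category (fst P)" "normalized_cat (fst P)"
    "is_functor (fst P) S (snd P)"
  using assms by (auto simp: in_fs_obj)

lemma in_fs_arr: "f \<in> fs_arr S \<longleftrightarrow> Src f \<in> fs_obj S \<and> Tgt f \<in> fs_obj S
    \<and> is_functor (fst (Src f)) (fst (Tgt f)) (fun_of f)
    \<and> cmp f \<in> extensional (Ob (fst (Src f)))
    \<and> (\<forall>x \<in> Ob (fst (Src f)). cmp f x \<in> homs S (FOb (snd (Src f)) x) (FOb (snd (Tgt f)) (FOb
        (fun_of f) x)))
    \<and> (\<forall>a \<in> Ar (fst (Src f)). cmp f (Cod (fst (Src f)) a) \<cdot>\<^bsub>S\<^esub> FAr (snd (Src f)) a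
          = FAr (snd (Tgt f)) (FAr (fun_of f) a) \<cdot>\<^bsub>S\<^esub> cmp f (Dom (fst (Src f)) a))"
  unfolding fs_arr_def is_nat_trans_iff
  by (auto simp: comp_functor_def compose_def)

lemma in_homs_FS: "f \<in> homs (FS S) P Q \<longleftrightarrow> Src f = P \<and> Tgt f = Q \<and> P \<in> fs_obj S \<and> Q \<in> fs_obj S
    \<and> is_functor (fst P) (fst Q) (fun_of f)
    \<and> cmp f \<in> extensional (Ob (fst P))
    \<and> (\<forall>x \<in> Ob (fst P). cmp f x \<in> homs S (FOb (snd P) x) (FOb (snd Q) (FOb (fun_of f) x)))
    \<and> (\<forall>a \<in> Ar (fst P). cmp f (Cod (fst P) a) \<cdot>\<^bsub>S\<^esub> FAr (snd P) a
          = FAr (snd Q) (FAr (fun_of f) a) \<cdot>\<^bsub>S\<^esub> cmp f (Dom (fst P) a))"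
  by (auto simp: homs_def in_fs_arr)

lemma base_mor_in_homs: "f \<in> homs (FS S) P Q \<Longrightarrow> base_mor f \<in> homs CAT (fst P) (fst Q)"
  by (simp add: in_homs_FS in_homs_CAT in_fs_obj)

lemma is_functor_homs: "is_functor C D F \<Longrightarrow> f \<in> Ar C
    \<Longrightarrow> FAr F f \<in> homs D (FOb F (Dom C f)) (FOb F (Cod C f))"
  by (auto simp: is_functor_iff homs_def)

context symmetric_monoidal_category
begin

lemma fs_functor_homs:
  "P \<in> fs_obj S \<Longrightarrow> a \<in> Ar (fst P)
    \<Longrightarrow> FAr (snd P) a \<in> homs S (FOb (snd P) (Dom (fst P) a)) (FOb (snd P) (Cod (fst P) a))"
  by (simp add: in_fs_obj is_functor_homs)

lemma Id_in_homs_FS: "P \<in> fs_obj S \<Longrightarrow> Id (FS S) P \<in> homs (FS S) P P"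
proof -
  assume P: "P \<in> fs_obj S"
  have "Id S (FOb (snd P) (Cod (fst P) a)) \<cdot> FAr (snd P) a = FAr (snd P) a"
    "FAr (snd P) a \<cdot> Id S (FOb (snd P) (Dom (fst P) a)) = FAr (snd P) a" if "a \<in> Ar (fst P)" for a
    using fs_functor_homs[OF P that] by (auto intro: Id_left Id_right)
  with P show ?thesis
    by (auto simp: in_homs_FS Id_in in_fs_obj is_functor_id category.Dom_in category.Cod_in)
      (auto simp: is_functor_iff intro!: Id_in)
qed

text \<open>Naturality of the composite at an arrow a is the square of f at a pasted with the square
  of g at the image of a; everything else is typing.\<close>

lemma Comp_in_homs_FS:
  assumes f: "f \<in> homs (FS S) P Q" and g: "g \<in> homs (FS S) Q R"
  shows "g \<cdot>\<^bsub>FS S\<^esub> f \<in> homs (FS S) P R"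
proof -
  let ?F = "fun_of f" and ?G = "fun_of g"
  have P: "category (fst P)" using f by (simp add: in_homs_FS in_fs_obj)
  have nat: "(cmp g (FOb ?F (Cod (fst P) a)) \<cdot> cmp f (Cod (fst P) a)) \<cdot> FAr (snd P) a
      = FAr (snd R) (FAr ?G (FAr ?F a)) \<cdot> cmp g (FOb ?F (Dom (fst P) a)) \<cdot> cmp f (Dom (fst P) a)"
    if a: "a \<in> Ar (fst P)" for a
  proof -
    let ?x = "Dom (fst P) a" and ?y = "Cod (fst P) a"
    have xy: "?x \<in> Ob (fst P)" "?y \<in> Ob (fst P)" using P a by (auto simp: category_iff)
    have Fa: "FAr ?F a \<in> Ar (fst Q)" "Dom (fst Q) (FAr ?F a) = FOb ?F ?x" "Cod (fst Q) (FAr ?F a)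
        = FOb ?F ?y"
      and Fxy: "FOb ?F ?x \<in> Ob (fst Q)" "FOb ?F ?y \<in> Ob (fst Q)"
      using f a xy by (auto simp: in_homs_FS is_functor_iff)
    note t = fs_functor_homs[of P a] fs_functor_homs[of Q "FAr ?F a"] fs_functor_homs[of R "FAr ?G
        (FAr ?F a)"]
    have t1: "FAr (snd P) a \<in> homs S (FOb (snd P) ?x) (FOb (snd P) ?y)"
      "FAr (snd Q) (FAr ?F a) \<in> homs S (FOb (snd Q) (FOb ?F ?x)) (FOb (snd Q) (FOb ?F ?y))"
      using t f a Fa by (auto simp: in_homs_FS)
    have "FAr ?G (FAr ?F a) \<in> Ar (fst R)" "Dom (fst R) (FAr ?G (FAr ?F a)) = FOb ?G (FOb ?F ?x)"
      "Cod (fst R) (FAr ?G (FAr ?F a)) = FOb ?G (FOb ?F ?y)"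
      using g Fa by (auto simp: in_homs_FS is_functor_iff)
    then have t2: "FAr (snd R) (FAr ?G (FAr ?F a)) \<in> homs S (FOb (snd R) (FOb ?G (FOb ?F ?x)))
        (FOb (snd R) (FOb ?G (FOb ?F ?y)))"
      using t(3) g by (auto simp: in_homs_FS)
    have c: "cmp f ?x \<in> homs S (FOb (snd P) ?x) (FOb (snd Q) (FOb ?F ?x))"
      "cmp f ?y \<in> homs S (FOb (snd P) ?y) (FOb (snd Q) (FOb ?F ?y))"
      "cmp g (FOb ?F ?x) \<in> homs S (FOb (snd Q) (FOb ?F ?x)) (FOb (snd R) (FOb ?G (FOb ?F ?x)))"
      "cmp g (FOb ?F ?y) \<in> homs S (FOb (snd Q) (FOb ?F ?y)) (FOb (snd R) (FOb ?G (FOb ?F ?y)))"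
      using f g xy Fxy by (auto simp: in_homs_FS)
    have nf: "cmp f ?y \<cdot> FAr (snd P) a = FAr (snd Q) (FAr ?F a) \<cdot> cmp f ?x"
      using f a by (simp add: in_homs_FS)
    have ng: "cmp g (FOb ?F ?y) \<cdot> FAr (snd Q) (FAr ?F a) = FAr (snd R) (FAr ?G (FAr ?F a))
        \<cdot> cmp g (FOb ?F ?x)"
    proof -
      have "\<forall>b \<in> Ar (fst Q). cmp g (Cod (fst Q) b) \<cdot> FAr (snd Q) b
          = FAr (snd R) (FAr ?G b) \<cdot> cmp g (Dom (fst Q) b)"
        using g by (simp add: in_homs_FS)
      from bspec[OF this Fa(1)] show ?thesis by (simp only: Fa)
    qed
    show ?thesis
      using Comp_assoc[OF t1(1) c(2) c(4)] Comp_assoc[OF c(1) t1(2) c(4)] Comp_assoc[OF c(1) c(3)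
          t2] nf ng
      by simp
  qed
  have "cmp g (FOb ?F x) \<cdot> cmp f x \<in> homs S (FOb (snd P) x) (FOb (snd R) (FOb ?G (FOb ?F x)))"
    if "x \<in> Ob (fst P)" for x
    using f g that by (auto simp: in_homs_FS is_functor_iff intro!: Comp_in)
  moreover have "Dom (fst P) a \<in> Ob (fst P)" "Cod (fst P) a \<in> Ob (fst P)" if "a \<in> Ar (fst P)" for a
    using P that by (auto simp: category_iff)
  moreover have "is_functor (fst P) (fst R) (comp_functor (fst P) ?G ?F)"
    using f g P by (auto simp: in_homs_FS intro: is_functor_comp)
  ultimately show ?thesis
    using f g nat by (simp add: in_homs_FS)
qed

lemma category_FS: "category (FS S)"
proof
  show "Dom (FS S) f \<in> Ob (FS S)" "Cod (FS S) f \<in> Ob (FS S)" if "f \<in> Ar (FS S)" for f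
    using that by (auto simp: in_fs_arr)
  show "Id (FS S) X \<in> homs (FS S) X X" if "X \<in> Ob (FS S)" for X
    using that Id_in_homs_FS[of X] by simp
  show "g \<cdot>\<^bsub>FS S\<^esub> f \<in> homs (FS S) X Z" if "f \<in> homs (FS S) X Y" "g \<in> homs (FS S) Y Z" for f g X Y Z
    using that by (rule Comp_in_homs_FS)
  show "f \<cdot>\<^bsub>FS S\<^esub> Id (FS S) X = f" if f: "f \<in> homs (FS S) X Y" for f X Y
  proof -
    have "cmp f (FOb (id_functor (fst X)) x) \<cdot> Id S (FOb (snd X) x) = cmp f x" if "x \<in> Ob (fst X)"
        for x
      using f that by (auto simp: id_functor_def in_homs_FS intro!: Id_right)
    with f show ?thesis
      by (auto simp: mor_eq_iff prod_eq_iff in_homs_FS fs_objD comp_functor_id[of "fst X" "fst Y"]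
          intro!: restrict_eqI)
  qed
  show "Id (FS S) Y \<cdot>\<^bsub>FS S\<^esub> f = f" if f: "f \<in> homs (FS S) X Y" for f X Y
  proof -
    have X: "category (fst X)" "category (fst Y)" using f by (auto simp: in_homs_FS in_fs_obj)
    have "Id S (FOb (snd Y) (FOb (fun_of f) x)) \<cdot> cmp f x = cmp f x" "FOb (fun_of f) x
        \<in> Ob (fst Y)" 
      if "x \<in> Ob (fst X)" for x
      using f that by (auto simp: id_functor_def is_functor_iff in_homs_FS intro!: Id_left)
    with f X show ?thesis
      by (auto simp: mor_eq_iff prod_eq_iff in_homs_FS id_comp_functor intro!: restrict_eqI)
  qed
  show "(h \<cdot>\<^bsub>FS S\<^esub> g) \<cdot>\<^bsub>FS S\<^esub> f = h \<cdot>\<^bsub>FS S\<^esub> g \<cdot>\<^bsub>FS S\<^esub> f"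
    if f: "f \<in> homs (FS S) W X" and g: "g \<in> homs (FS S) X Y" and h: "h \<in> homs (FS S) Y Z"
        for f g h W X Y Z
  proof -
    have X: "category (fst W)" using f by (simp add: in_homs_FS in_fs_obj)
    have "(cmp h (FOb (fun_of g) (FOb (fun_of f) x)) \<cdot> cmp g (FOb (fun_of f) x)) \<cdot> cmp f x
       = cmp h (FOb (fun_of g) (FOb (fun_of f) x)) \<cdot> cmp g (FOb (fun_of f) x) \<cdot> cmp f x"
      "FOb (fun_of f) x \<in> Ob (fst X)"
      if "x \<in> Ob (fst W)" for x
      using f g h that by (auto simp: is_functor_iff in_homs_FS intro!: Comp_assoc)
    with f g h X show ?thesis
      by (auto simp: mor_eq_iff prod_eq_iff in_homs_FS comp_functor_assoc restrict_eq_iff)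
  qed
qed

end

section \<open>Inverses and the interchange map\<close>

text \<open>An inverse functor can now be verified value by value; the equations with
  \<open>id_functor\<close> are unfolded once and for all.\<close>

lemma inverse_pair_CAT: "inverse_pair CAT f g \<longleftrightarrow>
    f \<in> homs CAT (Src f) (Tgt f) \<and> g \<in> homs CAT (Tgt f) (Src f)
  \<and> (\<forall>x \<in> Ob (Src f). FOb (Dat g) (FOb (Dat f) x) = x)
  \<and> (\<forall>a \<in> Ar (Src f). FAr (Dat g) (FAr (Dat f) a) = a)
  \<and> (\<forall>x \<in> Ob (Tgt f). FOb (Dat f) (FOb (Dat g) x) = x)
  \<and> (\<forall>a \<in> Ar (Tgt f). FAr (Dat f) (FAr (Dat g) a) = a)"
proof (cases "f \<in> homs CAT (Src f) (Tgt f) \<and> g \<in> homs CAT (Tgt f) (Src f)")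
  case True
  then have "is_functor (Src f) (Src f) (comp_functor (Src f) (Dat g) (Dat f))"
    "is_functor (Tgt f) (Tgt f) (comp_functor (Tgt f) (Dat f) (Dat g))"
    "is_functor (Src f) (Src f) (id_functor (Src f))" "is_functor (Tgt f) (Tgt f) (id_functor (Tgt
        f))"
    by (auto simp: in_homs_CAT intro: is_functor_comp is_functor_id)
  with True show ?thesis
    unfolding inverse_pair_def by (auto simp: functr_eq_iff in_homs_CAT mor_eq_iff)
next
  case False
  then show ?thesis by (auto simp: inverse_pair_def in_homs_CAT)
qed

context symmetric_monoidal_category
begin

text \<open>Over the inverse functor G the component at y must invert the component of f at the
  preimage of y. Its naturality is the naturality of f with both vertical arrows moved to the other
  side.\<close>

lemma inverse_pair_FS:
  assumes f: "f \<in> homs (FS S) P Q" and g: "inverse_pair CAT (base_mor f) g"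
    and inv: "\<And>x. x \<in> Ob (fst P) \<Longrightarrow> invertible S (cmp f x)"
  shows "inverse_pair (FS S) f \<lparr>Src = Q, Tgt = P,
    Dat = (Dat g, \<lambda>y \<in> Ob (fst Q). inverse_of S (cmp f (FOb (Dat g) y)))\<rparr>"
proof -
  let ?F = "fun_of f" and ?G = "Dat g"
  let ?g = "\<lparr>Src = Q, Tgt = P, Dat = (?G, \<lambda>y \<in> Ob (fst Q). inverse_of S (cmp f (FOb ?G y)))\<rparr>"
  have G: "is_functor (fst Q) (fst P) ?G"
    and GF: "\<And>x. x \<in> Ob (fst P) \<Longrightarrow> FOb ?G (FOb ?F x) = x"
    "\<And>a. a \<in> Ar (fst P) \<Longrightarrow> FAr ?G (FAr ?F a) = a"
    and FG: "\<And>x. x \<in> Ob (fst Q) \<Longrightarrow> FOb ?F (FOb ?G x) = x"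
    "\<And>a. a \<in> Ar (fst Q) \<Longrightarrow> FAr ?F (FAr ?G a) = a"
    using f g by (auto simp: inverse_pair_CAT in_homs_FS in_homs_CAT)
  have P: "P \<in> fs_obj S" "category (fst P)" and Q: "Q \<in> fs_obj S" "category (fst Q)"
    using f by (auto simp: in_homs_FS fs_objD)
  have F: "is_functor (fst P) (fst Q) ?F" using f by (simp add: in_homs_FS)
  have c: "cmp f x \<in> homs S (FOb (snd P) x) (FOb (snd Q) (FOb ?F x))" if "x \<in> Ob (fst P)" for x
    using f that by (simp add: in_homs_FS)
  note i = inverse_of[OF c inv]
  have Gob: "FOb ?G y \<in> Ob (fst P)" if "y \<in> Ob (fst Q)" for y
    using G that by (simp add: is_functor_iff)
  have nat: "inverse_of S (cmp f (FOb ?G (Cod (fst Q) b))) \<cdot> FAr (snd Q) b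
      = FAr (snd P) (FAr ?G b) \<cdot> inverse_of S (cmp f (FOb ?G (Dom (fst Q) b)))"
    if b: "b \<in> Ar (fst Q)" for b
  proof -
    \<comment> \<open>Naturality of f is only available for arrows of the source, so b is pulled
      back to a; then b is the image of a.\<close>
    define a where "a = FAr ?G b"
    let ?x = "Dom (fst P) a" and ?y = "Cod (fst P) a"
    have a: "a \<in> Ar (fst P)" "FOb ?G (Dom (fst Q) b) = ?x" "FOb ?G (Cod (fst Q) b) = ?y" "FAr ?F a
        = b"
      using G b FG by (auto simp: a_def is_functor_iff)
    have xy: "?x \<in> Ob (fst P)" "?y \<in> Ob (fst P)" using P a by (auto simp: category.Dom_in
        category.Cod_in)
    have n: "cmp f ?y \<cdot> FAr (snd P) a = FAr (snd Q) b \<cdot> cmp f ?x"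
      using f a by (simp add: in_homs_FS)
    have Pa: "FAr (snd P) a \<in> homs S (FOb (snd P) ?x) (FOb (snd P) ?y)"
      using fs_functor_homs[OF P(1) a(1)] .
    have "Dom (fst Q) b = FOb ?F ?x" "Cod (fst Q) b = FOb ?F ?y"
      using F a by (auto simp: is_functor_iff)
    then have Qb: "FAr (snd Q) b \<in> homs S (FOb (snd Q) (FOb ?F ?x)) (FOb (snd Q) (FOb ?F ?y))"
      using fs_functor_homs[OF Q(1) b] by simp
    let ?i = "inverse_of S (cmp f ?x)" and ?j = "inverse_of S (cmp f ?y)"
    have "?j \<cdot> FAr (snd Q) b = ?j \<cdot> (FAr (snd Q) b \<cdot> (cmp f ?x \<cdot> ?i))"
      using i(3)[OF xy(1)] Id_right[OF Qb] xy by simp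
    also have "\<dots> = ?j \<cdot> ((cmp f ?y \<cdot> FAr (snd P) a) \<cdot> ?i)"
      using Comp_assoc[OF i(1)[OF xy(1)] c[OF xy(1)] Qb] xy n by simp
    also have "\<dots> = ?j \<cdot> (cmp f ?y \<cdot> (FAr (snd P) a \<cdot> ?i))"
      using Comp_assoc[OF i(1)[OF xy(1)] Pa c[OF xy(2)]] xy by simp
    also have "\<dots> = (?j \<cdot> cmp f ?y) \<cdot> (FAr (snd P) a \<cdot> ?i)"
      using Comp_assoc[OF Comp_in[OF i(1)[OF xy(1)] Pa] c[OF xy(2)] i(1)[OF xy(2)]] xy by simp
    also have "\<dots> = FAr (snd P) a \<cdot> ?i"
      using i(2)[OF xy(2)] Id_left[OF Comp_in[OF i(1)[OF xy(1)] Pa]] xy by simp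
    finally show ?thesis using a by (simp add: a_def)
  qed
  have "inverse_of S (cmp f (FOb ?G y)) \<in> homs S (FOb (snd Q) y) (FOb (snd P) (FOb ?G y))"
    if "y \<in> Ob (fst Q)" for y
    using i(1)[of "FOb ?G y"] Gob[OF that] FG that by simp
  then have g': "?g \<in> homs (FS S) Q P"
    using P Q G nat by (simp add: in_homs_FS category.Dom_in category.Cod_in)
  have "comp_functor (fst P) ?G ?F = id_functor (fst P)" "comp_functor (fst Q) ?F ?G
      = id_functor (fst Q)"
    using g f by (auto simp: inverse_pair_def in_homs_FS)
  moreover have "FOb ?F x \<in> Ob (fst Q)" if "x \<in> Ob (fst P)" for x
    using F that by (simp add: is_functor_iff)
  moreover have "cmp f (FOb ?G y) \<cdot> inverse_of S (cmp f (FOb ?G y)) = Id S (FOb (snd Q) y)"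
    if "y \<in> Ob (fst Q)" for y
    using i(3)[OF Gob[OF that]] Gob[OF that] FG that by simp
  moreover have "f \<in> fs_arr S" "Src f = P" "Tgt f = Q" using f by (auto simp: homs_def)
  ultimately show ?thesis
    using g' GF i(2) by (simp add: inverse_pair_def restrict_eq_iff)
qed

text \<open>This splits invertibility of an antipode into invertibility of its base and of each
  arrow S_x, the form demanded of a Hopf \<chi>-algebra. It also serves for isomorphisms of Hopf
  algebras.\<close>

lemma invertible_FS_iff:
  assumes f: "f \<in> homs (FS S) P Q"
  shows "invertible (FS S) f \<longleftrightarrow>
    invertible CAT (base_mor f) \<and> (\<forall>x \<in> Ob (fst P). invertible S (cmp f x))"
proof
  assume "invertible (FS S) f"
  then obtain g where g: "inverse_pair (FS S) f g" by (auto simp: invertible_def)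
  have [simp]: "Src f = P" "Tgt f = Q" using f by (auto simp: in_homs_FS)
  have gh: "g \<in> homs (FS S) Q P" using g f by (auto simp: inverse_pair_def)
  then have [simp]: "Src g = Q" "Tgt g = P" by (auto simp: in_homs_FS)
  have F: "is_functor (fst P) (fst Q) (fun_of f)" using f by (simp add: in_homs_FS)
  have b: "inverse_pair CAT (base_mor f) (base_mor g)"
    using g base_mor_in_homs[OF f] base_mor_in_homs[OF gh] f gh
    by (simp add: inverse_pair_def in_homs_CAT)
  have "inverse_pair S (cmp f x) (cmp g (FOb (fun_of f) x))" if x: "x \<in> Ob (fst P)" for x
  proof -
    have y: "FOb (fun_of f) x \<in> Ob (fst Q)" using F x by (simp add: is_functor_iff)
    have G: "FOb (fun_of g) (FOb (fun_of f) x) = x"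
      using b x by (simp add: inverse_pair_CAT)
    have c: "cmp f x \<in> homs S (FOb (snd P) x) (FOb (snd Q) (FOb (fun_of f) x))"
      "cmp g (FOb (fun_of f) x) \<in> homs S (FOb (snd Q) (FOb (fun_of f) x)) (FOb (snd P) x)"
      using f gh x y G by (auto simp: in_homs_FS)
    have "\<forall>x \<in> Ob (fst P). cmp g (FOb (fun_of f) x) \<cdot> cmp f x = Id S (FOb (snd P) x)"
      "\<forall>y \<in> Ob (fst Q). cmp f (FOb (fun_of g) y) \<cdot> cmp g y = Id S (FOb (snd Q) y)"
      using g by (auto simp: inverse_pair_def restrict_eq_iff)
    with x y G c show ?thesis by (auto simp: inverse_pair_def homs_def)
  qed
  with b show "invertible CAT (base_mor f) \<and> (\<forall>x \<in> Ob (fst P). invertible S (cmp f x))"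
    by (auto simp: invertible_def)
next
  assume "invertible CAT (base_mor f) \<and> (\<forall>x \<in> Ob (fst P). invertible S (cmp f x))"
  with inverse_pair_FS[OF f] show "invertible (FS S) f"
    by (auto simp: invertible_def)
qed

lemma fs_tobj_in: assumes "P \<in> fs_obj S" "Q \<in> fs_obj S" shows "fs_tobj S P Q \<in> fs_obj S"
proof -
  note P = fs_objD[OF assms(1)] and Q = fs_objD[OF assms(2)]
  have "is_functor (prod_cat (fst P) (fst Q)) S (snd (fs_tobj S P Q))"
    unfolding is_functor_iff prod_cat_sel ball_ptimes
  proof (intro conjI ballI impI)
    show "FOb (snd (fs_tobj S P Q)) \<in> extensional (ptimes (Ob (fst P)) (Ob (fst Q)))"
      "FAr (snd (fs_tobj S P Q)) \<in> extensional (ptimes (Ar (fst P)) (Ar (fst Q)))"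
      by (auto simp: fs_tobj_def case_prod_beta)
  next
    fix x y assume "x \<in> Ob (fst P)" "y \<in> Ob (fst Q)"
    then show "FOb (snd (fs_tobj S P Q)) (Pr x y) \<in> Ob S"
      using P Q by (simp add: is_functor_iff tobj_in)
    show "FAr (snd (fs_tobj S P Q)) (Id (prod_cat (fst P) (fst Q)) (Pr x y)) =
       Id S (FOb (snd (fs_tobj S P Q)) (Pr x y))"
      using P Q \<open>x \<in> _\<close> \<open>y \<in> _\<close> by (simp add: is_functor_iff category_iff tarr_Id)
  next
    fix a b assume ab: "a \<in> Ar (fst P)" "b \<in> Ar (fst Q)"
    have "FAr (snd P) a \<odot> FAr (snd Q) b \<in> homs S (FOb (snd P) (Dom (fst P) a) \<boxtimes> FOb (snd Q) (Dom
        (fst Q) b))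
       (FOb (snd P) (Cod (fst P) a) \<boxtimes> FOb (snd Q) (Cod (fst Q) b))"
      by (intro tarr_in fs_functor_homs assms ab)
    then show "FAr (snd (fs_tobj S P Q)) (Pr a b) \<in> Ar S"
      "Dom S (FAr (snd (fs_tobj S P Q)) (Pr a b)) = FOb (snd (fs_tobj S P Q)) (Dom (prod_cat (fst
          P) (fst Q)) (Pr a b))"
      "Cod S (FAr (snd (fs_tobj S P Q)) (Pr a b)) = FOb (snd (fs_tobj S P Q)) (Cod (prod_cat (fst
          P) (fst Q)) (Pr a b))"
      using P Q ab by (auto simp: homs_def category.Dom_in category.Cod_in)
    fix c d assume cd: "c \<in> Ar (fst P)" "d \<in> Ar (fst Q)"
      and e: "Dom (prod_cat (fst P) (fst Q)) (Pr c d) = Cod (prod_cat (fst P) (fst Q)) (Pr a b)"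
    have e: "Dom (fst P) c = Cod (fst P) a" "Dom (fst Q) d = Cod (fst Q) b" using e ab cd by auto
    have in_: "c \<cdot>\<^bsub>fst P\<^esub> a \<in> Ar (fst P)" "d \<cdot>\<^bsub>fst Q\<^esub> b \<in> Ar (fst Q)" using P Q ab cd e
        by (auto simp: category_iff)
    have "(FAr (snd P) c \<cdot> FAr (snd P) a) \<odot> (FAr (snd Q) d \<cdot> FAr (snd Q) b)
      = (FAr (snd P) c \<odot> FAr (snd Q) d) \<cdot> (FAr (snd P) a \<odot> FAr (snd Q) b)"
      using fs_functor_homs[OF assms(1) cd(1)] fs_functor_homs[OF assms(2) cd(2)] unfolding e
      by (rule tarr_Comp[OF fs_functor_homs[OF assms(1) ab(1)] _ fs_functor_homs[OF assms(2)
          ab(2)]])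
    then show "FAr (snd (fs_tobj S P Q)) (Pr c d \<cdot>\<^bsub>prod_cat (fst P) (fst Q)\<^esub> Pr a b) =
       FAr (snd (fs_tobj S P Q)) (Pr c d) \<cdot> FAr (snd (fs_tobj S P Q)) (Pr a b)"
      using P Q ab cd e in_ by (simp add: is_functor_iff)
  qed
  then show ?thesis using P Q by (simp add: in_fs_obj category_prod_cat normalized_prod_cat)
qed

lemma fs_unit_in: "fs_unit S \<in> fs_obj S"
  using Id_in[OF tunit_in]
  by (simp add: in_fs_obj category_one_cat normalized_one_cat is_functor_iff tunit_in homs_def)
    (simp add: fs_unit_def Id_left[OF Id_in[OF tunit_in]])

end

text \<open>\<open>interchange\<close> and \<open>unit_coalg\<close> contain
  \<open>inverse_of\<close>, a definite description. Explicit inverses such as this one are what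
  evaluates it, first in \<open>CAT\<close> and then in \<open>FS S\<close>.\<close>

definition unassoc_functor :: "'u scat \<Rightarrow> 'u scat \<Rightarrow> 'u scat \<Rightarrow> 'u sfunctr" where
  "unassoc_functor C D K =
     \<lparr>FOb = (\<lambda>p \<in> Ob (prod_cat C (prod_cat D K)). Pr (Pr (pr1 p) (pr1 (pr2 p))) (pr2 (pr2 p))),
      FAr = (\<lambda>p \<in> Ar (prod_cat C (prod_cat D K)). Pr (Pr (pr1 p) (pr1 (pr2 p))) (pr2 (pr2 p)))\<rparr>"

lemma is_functor_unassoc: "category C \<Longrightarrow> category D \<Longrightarrow> category E \<Longrightarrow>
  is_functor (prod_cat C (prod_cat D E)) (prod_cat (prod_cat C D) E) (unassoc_functor C D E)"
  by (auto simp: is_functor_iff unassoc_functor_def category_iff)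

definition unlunit_functor :: "'u scat \<Rightarrow> 'u sfunctr" where
  "unlunit_functor C = \<lparr>FOb = (\<lambda>p \<in> Ob C. Pr Star p), FAr = (\<lambda>p \<in> Ar C. Pr Star p)\<rparr>"

lemma is_functor_unlunit: "category C \<Longrightarrow> is_functor C (prod_cat one_cat C) (unlunit_functor C)"
  by (auto simp: is_functor_iff unlunit_functor_def category_iff)

lemmas cat_rules = category_prod_cat normalized_prod_cat category_one_cat normalized_one_cat

lemma inverse_pair_assoc_CAT:
  assumes "C \<in> Ob CAT" "D \<in> Ob CAT" "E \<in> Ob CAT"
  shows "inverse_pair CAT (assoc CAT C D E)
    \<lparr>Src = prod_cat C (prod_cat D E), Tgt = prod_cat (prod_cat C D) E, Dat = unassoc_functor C D E\<rparr>"
  using assms unfolding inverse_pair_CAT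
  by (auto simp: in_homs_CAT is_functor_assoc is_functor_unassoc cat_rules)
    (auto simp: assoc_functor_def unassoc_functor_def)

lemma inverse_pair_lunit_CAT:
  assumes "C \<in> Ob CAT"
  shows "inverse_pair CAT (lunit CAT C) \<lparr>Src = C, Tgt = prod_cat one_cat C, Dat
      = unlunit_functor C\<rparr>"
  using assms unfolding inverse_pair_CAT
  by (auto simp: in_homs_CAT is_functor_lunit is_functor_unlunit cat_rules)
    (auto simp: lunit_functor_def unlunit_functor_def)

definition middle_functor :: "'u scat \<Rightarrow> 'u scat \<Rightarrow> 'u scat \<Rightarrow> 'u scat \<Rightarrow> 'u sfunctr" where
  "middle_functor B C D E =
     \<lparr>FOb = (\<lambda>p \<in> Ob (prod_cat (prod_cat B C) (prod_cat D E)).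
               Pr (Pr (pr1 (pr1 p)) (pr1 (pr2 p))) (Pr (pr2 (pr1 p)) (pr2 (pr2 p)))),
      FAr = (\<lambda>p \<in> Ar (prod_cat (prod_cat B C) (prod_cat D E)).
               Pr (Pr (pr1 (pr1 p)) (pr1 (pr2 p))) (Pr (pr2 (pr1 p)) (pr2 (pr2 p))))\<rparr>"

lemmas structure_functor_defs = comp_functor_def id_functor_def compose_def prod_functor_def
    assoc_functor_def
  unassoc_functor_def lunit_functor_def unlunit_functor_def runit_functor_def swap_functor_def
      middle_functor_def

lemma structure_functor_sel [simp]:
  "x \<in> Ob C \<Longrightarrow> y \<in> Ob D \<Longrightarrow> FOb (prod_functor C D F G) (Pr x y) = Pr (FOb F x) (FOb G y)"
  "a \<in> Ar C \<Longrightarrow> b \<in> Ar D \<Longrightarrow> FAr (prod_functor C D F G) (Pr a b) = Pr (FAr F a) (FAr G b)"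
  "x \<in> Ob C \<Longrightarrow> y \<in> Ob D \<Longrightarrow> FOb (swap_functor C D) (Pr x y) = Pr y x"
  "a \<in> Ar C \<Longrightarrow> b \<in> Ar D \<Longrightarrow> FAr (swap_functor C D) (Pr a b) = Pr b a"
  "x \<in> Ob C \<Longrightarrow> y \<in> Ob D \<Longrightarrow> z \<in> Ob E \<Longrightarrow> FOb (assoc_functor C D E) (Pr (Pr x y) z) = Pr x (Pr y z)"
  "a \<in> Ar C \<Longrightarrow> b \<in> Ar D \<Longrightarrow> c \<in> Ar E \<Longrightarrow> FAr (assoc_functor C D E) (Pr (Pr a b) c) = Pr a (Pr b c)"
  "x \<in> Ob C \<Longrightarrow> y \<in> Ob D \<Longrightarrow> z \<in> Ob E \<Longrightarrow> FOb (unassoc_functor C D E) (Pr x (Pr y z)) = Pr (Pr x y) z"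
  "a \<in> Ar C \<Longrightarrow> b \<in> Ar D \<Longrightarrow> c \<in> Ar E \<Longrightarrow> FAr (unassoc_functor C D E) (Pr a (Pr b c)) = Pr (Pr a b) c"
  "x \<in> Ob C \<Longrightarrow> FOb (lunit_functor C) (Pr Star x) = x"
  "a \<in> Ar C \<Longrightarrow> FAr (lunit_functor C) (Pr Star a) = a"
  "x \<in> Ob C \<Longrightarrow> FOb (runit_functor C) (Pr x Star) = x"
  "a \<in> Ar C \<Longrightarrow> FAr (runit_functor C) (Pr a Star) = a"
  "x \<in> Ob C \<Longrightarrow> FOb (unlunit_functor C) x = Pr Star x"
  "a \<in> Ar C \<Longrightarrow> FAr (unlunit_functor C) a = Pr Star a"
  "v \<in> Ob B \<Longrightarrow> x \<in> Ob C \<Longrightarrow> y \<in> Ob D \<Longrightarrow> z \<in> Ob E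
    \<Longrightarrow> FOb (middle_functor B C D E) (Pr (Pr v x) (Pr y z)) = Pr (Pr v y) (Pr x z)"
  "a \<in> Ar B \<Longrightarrow> b \<in> Ar C \<Longrightarrow> c \<in> Ar D \<Longrightarrow> d \<in> Ar E
    \<Longrightarrow> FAr (middle_functor B C D E) (Pr (Pr a b) (Pr c d)) = Pr (Pr a c) (Pr b d)"
  by (simp_all add: structure_functor_defs)

context symmetric_monoidal_category
begin

lemma lunit_in_homs_FS:
  assumes "P \<in> fs_obj S" shows "lunit (FS S) P \<in> homs (FS S) (fs_tobj S (fs_unit S) P) P"
proof -
  note P = fs_objD[OF assms]
  have ob: "FOb (snd P) x \<in> Ob S" if "x \<in> Ob (fst P)" for x using P that
      by (simp add: is_functor_iff)
  show ?thesis
    using assms P ob by (auto simp: in_homs_FS fs_tobj_in fs_unit_in is_functor_lunit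
        category.Dom_in category.Cod_in
        lunit_in lunit_nat[OF fs_functor_homs])
qed

lemma assoc_in_homs_FS:
  assumes "P \<in> fs_obj S" "Q \<in> fs_obj S" "R \<in> fs_obj S"
  shows "assoc (FS S) P Q R \<in> homs (FS S) (fs_tobj S (fs_tobj S P Q) R) (fs_tobj S P (fs_tobj S Q
      R))"
proof -
  note P = fs_objD[OF assms(1)] and Q = fs_objD[OF assms(2)] and R = fs_objD[OF assms(3)]
  have ob: "FOb (snd X) x \<in> Ob S" if "X \<in> fs_obj S" "x \<in> Ob (fst X)" for x
      and X :: "('b, 'o, 'a) fobj"
    using that by (simp add: in_fs_obj is_functor_iff)
  show ?thesis
    using assms P Q R by (auto simp: in_homs_FS fs_tobj_in is_functor_assoc category.Dom_in
        category.Cod_in)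
      (auto simp: assoc_functor_def ob assoc_in assoc_nat[OF fs_functor_homs fs_functor_homs
          fs_functor_homs])
qed

lemma inverse_of_assoc_FS:
  assumes "P \<in> fs_obj S" "Q \<in> fs_obj S" "R \<in> fs_obj S"
  shows "inverse_of (FS S) (assoc (FS S) P Q R) =
    \<lparr>Src = fs_tobj S P (fs_tobj S Q R), Tgt = fs_tobj S (fs_tobj S P Q) R,
     Dat = (unassoc_functor (fst P) (fst Q) (fst R),
            \<lambda>p \<in> Ob (prod_cat (fst P) (prod_cat (fst Q) (fst R))).
              inverse_of S (assoc S (FOb (snd P) (pr1 p)) (FOb (snd Q) (pr1 (pr2 p))) (FOb (snd R)
                  (pr2 (pr2 p)))))\<rparr>"
proof -
  have ob: "FOb (snd X) x \<in> Ob S" if "X \<in> fs_obj S" "x \<in> Ob (fst X)" for x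
      and X :: "('b, 'o, 'a) fobj"
    using that by (simp add: in_fs_obj is_functor_iff)
  have "inverse_pair CAT (base_mor (assoc (FS S) P Q R))
    \<lparr>Src = prod_cat (fst P) (prod_cat (fst Q) (fst R)), Tgt = prod_cat (prod_cat (fst P) (fst Q))
        (fst R),
     Dat = unassoc_functor (fst P) (fst Q) (fst R)\<rparr>"
    using inverse_pair_assoc_CAT[of "fst P" "fst Q" "fst R"] assms
    by (simp add: fs_objD base_mor_def)
  moreover have "invertible S (cmp (assoc (FS S) P Q R) x)" if "x
      \<in> Ob (fst (fs_tobj S (fs_tobj S P Q) R))" for x
    using that assms by (auto simp: assoc_inv ob)
  ultimately have "inverse_pair (FS S) (assoc (FS S) P Q R) \<lparr>Src
      = fs_tobj S P (fs_tobj S Q R), Tgt = fs_tobj S (fs_tobj S P Q) R,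
     Dat = (unassoc_functor (fst P) (fst Q) (fst R),
            \<lambda>p \<in> Ob (prod_cat (fst P) (prod_cat (fst Q) (fst R))).
              inverse_of S (cmp (assoc (FS S) P Q R) (FOb (unassoc_functor (fst P) (fst Q) (fst
                  R)) p)))\<rparr>"
    using inverse_pair_FS[OF assoc_in_homs_FS[OF assms]] by fastforce
  then show ?thesis
    by (subst category.inverse_of_eq[OF category_FS], assumption) (simp add: restrict_eq_iff)
qed

lemma inverse_of_lunit_unit_FS:
  "inverse_of (FS S) (lunit (FS S) (fs_unit S)) =
    \<lparr>Src = fs_unit S, Tgt = fs_tobj S (fs_unit S) (fs_unit S),
     Dat = (unlunit_functor one_cat, \<lambda>p \<in> {Star}. inverse_of S (lunit S (tunit S)))\<rparr>"
proof -
  have "inverse_pair CAT (base_mor (lunit (FS S) (fs_unit S)))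
    \<lparr>Src = one_cat, Tgt = prod_cat one_cat one_cat, Dat = unlunit_functor one_cat\<rparr>"
    using inverse_pair_lunit_CAT[of one_cat] by (simp add: base_mor_def cat_rules)
  moreover have "invertible S (cmp (lunit (FS S) (fs_unit S)) x)" if "x
      \<in> Ob (fst (fs_tobj S (fs_unit S) (fs_unit S)))" for x
    using that by (auto simp: lunit_inv tunit_in)
  ultimately have "inverse_pair (FS S) (lunit (FS S) (fs_unit S)) \<lparr>Src = fs_unit S, Tgt
      = fs_tobj S (fs_unit S) (fs_unit S),
     Dat = (unlunit_functor one_cat,
            \<lambda>p \<in> Ob one_cat.
              inverse_of S (cmp (lunit (FS S) (fs_unit S)) (FOb (unlunit_functor one_cat) p)))\<rparr>"
    using inverse_pair_FS[OF lunit_in_homs_FS[OF fs_unit_in]] by fastforce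
  then show ?thesis
    by (subst category.inverse_of_eq[OF category_FS], assumption) (simp add: restrict_eq_iff)
qed

end

lemma inverse_of_assoc_CAT:
  assumes "C \<in> Ob CAT" "D \<in> Ob CAT" "E \<in> Ob CAT"
  shows "inverse_of CAT (assoc CAT C D E) =
    \<lparr>Src = prod_cat C (prod_cat D E), Tgt = prod_cat (prod_cat C D) E, Dat = unassoc_functor C D E\<rparr>"
  by (rule category.inverse_of_eq[OF category_CAT inverse_pair_assoc_CAT[OF assms]])

lemma inverse_of_lunit_unit_CAT:
  "inverse_of CAT (lunit CAT one_cat) =
    \<lparr>Src = one_cat, Tgt = prod_cat one_cat one_cat, Dat = unlunit_functor one_cat\<rparr>"
  by (rule category.inverse_of_eq[OF category_CAT inverse_pair_lunit_CAT]) (simp add: cat_rules)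

text \<open>The left-hand side is the base composite produced by unfolding
  \<open>interchange\<close>; it merely exchanges the two inner factors.\<close>

lemma middle_functor_eq:
  "comp_functor (prod_cat (prod_cat B C) (prod_cat D E))
     (unassoc_functor B D (prod_cat C E))
     (comp_functor (prod_cat (prod_cat B C) (prod_cat D E))
       (prod_functor B (prod_cat C (prod_cat D E)) (id_functor B)
         (comp_functor (prod_cat C (prod_cat D E)) (assoc_functor D C E)
           (comp_functor (prod_cat C (prod_cat D E))
              (prod_functor (prod_cat C D) E (swap_functor C D) (id_functor E)) (unassoc_functor C
                  D E))))
       (assoc_functor B C (prod_cat D E)))
   = middle_functor B C D E"
  by (simp add: structure_functor_defs restrict_eq_iff)

lemma interchange_CAT:
  assumes "B \<in> Ob CAT" "C \<in> Ob CAT" "D \<in> Ob CAT" "E \<in> Ob CAT"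
  shows "interchange CAT B C D E = \<lparr>Src = prod_cat (prod_cat B C) (prod_cat D E),
    Tgt = prod_cat (prod_cat B D) (prod_cat C E), Dat = middle_functor B C D E\<rparr>"
  using assms unfolding interchange_def middle_functor_eq[symmetric]
  by (subst (1 2) inverse_of_assoc_CAT) (simp_all add: cat_rules)

lemma (in symmetric_monoidal_category) interchange_FS:
  assumes "N \<in> fs_obj S" "P \<in> fs_obj S" "Q \<in> fs_obj S" "R \<in> fs_obj S"
  shows "interchange (FS S) N P Q R = \<lparr>Src = fs_tobj S (fs_tobj S N P) (fs_tobj S Q R),
    Tgt = fs_tobj S (fs_tobj S N Q) (fs_tobj S P R),
    Dat = (middle_functor (fst N) (fst P) (fst Q) (fst R),
      \<lambda>p \<in> Ob (prod_cat (prod_cat (fst N) (fst P)) (prod_cat (fst Q) (fst R))).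
        interchange S (FOb (snd N) (pr1 (pr1 p))) (FOb (snd P) (pr2 (pr1 p)))
                      (FOb (snd Q) (pr1 (pr2 p))) (FOb (snd R) (pr2 (pr2 p))))\<rparr>"
  \<comment> \<open>\<open>inverse_of\<close> has to be evaluated while \<open>assoc (FS S)\<close>
    is still folded. Hence only the tensor product of objects, \<open>FS_sel(7)\<close>, is
    unfolded, so that the arguments match.\<close>
  unfolding interchange_def middle_functor_eq[symmetric] FS_sel(7)
    inverse_of_assoc_FS[OF assms(1,3) fs_tobj_in[OF assms(2,4)]] inverse_of_assoc_FS[OF
        assms(2,3,4)]
  \<comment> \<open>The base composites on both sides are kept unevaluated and coincide as terms;
    only the components in \<open>S\<close> are left to compare.\<close>
  by (simp only: FS_sel mor.simps fst_conv snd_conv prod.inject mor.ext_inject simp_thms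
      fs_tobj_sel)
    (simp add: restrict_eq_iff interchange_def)

section \<open>Diagonals and terminal functors of small categories\<close>

definition diag_functor :: "'u scat \<Rightarrow> 'u sfunctr" where
  "diag_functor C = \<lparr>FOb = (\<lambda>x \<in> Ob C. Pr x x), FAr = (\<lambda>a \<in> Ar C. Pr a a)\<rparr>"

definition terminal_functor :: "'u scat \<Rightarrow> 'u sfunctr" where
  "terminal_functor C = \<lparr>FOb = (\<lambda>x \<in> Ob C. Star), FAr = (\<lambda>a \<in> Ar C. Star)\<rparr>"

lemma cartesian_functor_sel [simp]:
  "x \<in> Ob C \<Longrightarrow> FOb (diag_functor C) x = Pr x x"
  "a \<in> Ar C \<Longrightarrow> FAr (diag_functor C) a = Pr a a"
  "x \<in> Ob C \<Longrightarrow> FOb (terminal_functor C) x = Star"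
  "a \<in> Ar C \<Longrightarrow> FAr (terminal_functor C) a = Star"
  by (simp_all add: diag_functor_def terminal_functor_def)

lemma is_functor_diag: "category C \<Longrightarrow> is_functor C (prod_cat C C) (diag_functor C)"
  by (auto simp: is_functor_iff diag_functor_def category_iff)

lemma is_functor_terminal: "category C \<Longrightarrow> is_functor C one_cat (terminal_functor C)"
  by (auto simp: is_functor_iff terminal_functor_def category_iff)

lemma functor_to_one: "category C \<Longrightarrow> is_functor C one_cat F \<Longrightarrow> F = terminal_functor C"
  using is_functor_terminal[of C] by (simp add: functr_eq_iff) (auto simp: is_functor_iff)

text \<open>In a cartesian monoidal category the counit laws force the comultiplication to be the
    diagonal.\<close>

lemma comultiplication_is_diagonal:
  assumes C: "category C" and D: "is_functor C (prod_cat C C) D" and E: "is_functor C one_cat E"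
    and l: "comp_functor C (lunit_functor C) (comp_functor C (prod_functor C C E (id_functor C))
        D) = id_functor C"
    and r: "comp_functor C (runit_functor C) (comp_functor C (prod_functor C C (id_functor C) E)
        D) = id_functor C"
  shows "D = diag_functor C"
proof -
  note E = functor_to_one[OF C E]
  have "FOb D x = Pr x x" if x: "x \<in> Ob C" for x
  proof -
    obtain y z where yz: "FOb D x = Pr y z" "y \<in> Ob C" "z \<in> Ob C"
      using D x by (auto simp: is_functor_iff)
    have "z = x" using fun_cong[OF arg_cong[OF l, of FOb], of x] x yz E
      by (simp add: prod_functor_def lunit_functor_def)
    moreover have "y = x" using fun_cong[OF arg_cong[OF r, of FOb], of x] x yz E
      by (simp add: prod_functor_def runit_functor_def)
    ultimately show ?thesis using yz by simp
  qed
  moreover have "FAr D x = Pr x x" if x: "x \<in> Ar C" for x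
  proof -
    obtain y z where yz: "FAr D x = Pr y z" "y \<in> Ar C" "z \<in> Ar C"
      using D x by (auto simp: is_functor_iff)
    have "z = x" using fun_cong[OF arg_cong[OF l, of FAr], of x] x yz E
      by (simp add: prod_functor_def lunit_functor_def)
    moreover have "y = x" using fun_cong[OF arg_cong[OF r, of FAr], of x] x yz E
      by (simp add: prod_functor_def runit_functor_def)
    ultimately show ?thesis using yz by simp
  qed
  ultimately show ?thesis
    by (simp add: functr_eq_iff[OF D is_functor_diag[OF C]])
qed

section \<open>Bialgebras and antipodes, fibre by fibre\<close>

text \<open>One equivalence for each shape in which an equation of functors occurs among the Hopf
  algebra axioms.\<close>

lemma comp_functor_eq_iff:
  "comp_functor C G F = comp_functor C G' F' \<longleftrightarrow>
    (\<forall>x \<in> Ob C. FOb G (FOb F x) = FOb G' (FOb F' x)) \<and> (\<forall>a \<in> Ar C. FAr G (FAr F a)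
        = FAr G' (FAr F' a))"
  "comp_functor C G F = id_functor C \<longleftrightarrow>
    (\<forall>x \<in> Ob C. FOb G (FOb F x) = x) \<and> (\<forall>a \<in> Ar C. FAr G (FAr F a) = a)"
  "comp_functor C G F = terminal_functor C \<longleftrightarrow>
    (\<forall>x \<in> Ob C. FOb G (FOb F x) = Star) \<and> (\<forall>a \<in> Ar C. FAr G (FAr F a) = Star)"
  "comp_functor one_cat G F = id_functor one_cat \<longleftrightarrow> FOb G (FOb F Star) = Star \<and> FAr G (FAr F Star)
      = Star"
  "comp_functor (prod_cat one_cat C) G F = lunit_functor C \<longleftrightarrow>
    (\<forall>x \<in> Ob C. FOb G (FOb F (Pr Star x)) = x) \<and> (\<forall>a \<in> Ar C. FAr G (FAr F (Pr Star a)) = a)"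
  "comp_functor (prod_cat C one_cat) G F = runit_functor C \<longleftrightarrow>
    (\<forall>x \<in> Ob C. FOb G (FOb F (Pr x Star)) = x) \<and> (\<forall>a \<in> Ar C. FAr G (FAr F (Pr a Star)) = a)"
  by (simp_all add: comp_functor_def id_functor_def terminal_functor_def lunit_functor_def
      runit_functor_def
      restrict_eq_iff compose_def)

text \<open>Comultiplication and counit of a bialgebra in \<open>CAT\<close> leave no choice, so the
  product m and the unit u are the only data.\<close>

definition cat_bialg :: "'u scat \<Rightarrow> 'u sfunctr \<Rightarrow> 'u sfunctr \<Rightarrow> ('u scat, ('u scat, 'u sfunctr) mor)
    bialg" where
  "cat_bialg C m u =
     \<lparr>Crr = C,
      Cmul = \<lparr>Src = C, Tgt = prod_cat C C, Dat = diag_functor C\<rparr>,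
      Cun = \<lparr>Src = C, Tgt = one_cat, Dat = terminal_functor C\<rparr>,
      Mul = \<lparr>Src = prod_cat C C, Tgt = C, Dat = m\<rparr>,
      Unt = \<lparr>Src = one_cat, Tgt = C, Dat = u\<rparr>\<rparr>"

text \<open>A monoid object in small categories, in other words a strict monoidal category.\<close>

definition cat_monoid :: "'u scat \<Rightarrow> 'u sfunctr \<Rightarrow> 'u sfunctr \<Rightarrow> bool" where
  "cat_monoid C m u \<longleftrightarrow>
     category C \<and> normalized_cat C \<and> is_functor (prod_cat C C) C m \<and> is_functor one_cat C u
     \<and> (\<forall>x \<in> Ob C. \<forall>y \<in> Ob C. \<forall>z \<in> Ob C.
          FOb m (Pr (FOb m (Pr x y)) z) = FOb m (Pr x (FOb m (Pr y z))))
     \<and> (\<forall>a \<in> Ar C. \<forall>b \<in> Ar C. \<forall>c \<in> Ar C.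
          FAr m (Pr (FAr m (Pr a b)) c) = FAr m (Pr a (FAr m (Pr b c))))
     \<and> (\<forall>x \<in> Ob C. FOb m (Pr (FOb u Star) x) = x \<and> FOb m (Pr x (FOb u Star)) = x)
     \<and> (\<forall>a \<in> Ar C. FAr m (Pr (FAr u Star) a) = a \<and> FAr m (Pr a (FAr u Star)) = a)"

lemma functor_in:
  "is_functor C D F \<Longrightarrow> x \<in> Ob C \<Longrightarrow> FOb F x \<in> Ob D"
  "is_functor C D F \<Longrightarrow> a \<in> Ar C \<Longrightarrow> FAr F a \<in> Ar D"
  "is_functor C D F \<Longrightarrow> a \<in> Ar C \<Longrightarrow> Dom D (FAr F a) = FOb F (Dom C a)"
  "is_functor C D F \<Longrightarrow> a \<in> Ar C \<Longrightarrow> Cod D (FAr F a) = FOb F (Cod C a)"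
  "is_functor C D F \<Longrightarrow> x \<in> Ob C \<Longrightarrow> FAr F (Id C x) = Id D (FOb F x)"
  by (auto simp: is_functor_iff)

lemma mul_functor_in:
  assumes "is_functor (prod_cat C D) E m"
  shows "x \<in> Ob C \<Longrightarrow> y \<in> Ob D \<Longrightarrow> FOb m (Pr x y) \<in> Ob E"
    "a \<in> Ar C \<Longrightarrow> b \<in> Ar D \<Longrightarrow> FAr m (Pr a b) \<in> Ar E"
    "a \<in> Ar C \<Longrightarrow> b \<in> Ar D \<Longrightarrow> Dom E (FAr m (Pr a b)) = FOb m (Pr (Dom C a) (Dom D b))"
    "a \<in> Ar C \<Longrightarrow> b \<in> Ar D \<Longrightarrow> Cod E (FAr m (Pr a b)) = FOb m (Pr (Cod C a) (Cod D b))"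
  using functor_in[OF assms, of "Pr x y"] functor_in[OF assms, of "Pr a b"] by auto

lemma unit_functor_in:
  assumes "is_functor one_cat C u"
  shows "FOb u Star \<in> Ob C" "FAr u Star \<in> Ar C" "FAr u Star = Id C (FOb u Star)"
  using functor_in[OF assms, of Star] by auto

text \<open>The coalgebra axioms, and compatibility of m and u with them, hold for all functors
  because the diagonal is natural and \<open>one_cat\<close> is terminal. Only the monoid laws
  remain.\<close>

lemma bialgebra_cat_bialg_iff: "bialgebra CAT (cat_bialg C m u) \<longleftrightarrow> cat_monoid C m u"
proof (cases "category C \<and> normalized_cat C \<and> is_functor (prod_cat C C) C m
    \<and> is_functor one_cat C u")
  case True
  then have C: "category C" "normalized_cat C" and m: "is_functor (prod_cat C C) C m"
      and u: "is_functor one_cat C u"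
    by auto
  note in_ = mul_functor_in[OF m] unit_functor_in(1,2)[OF u]
  have "interchange CAT C C C C = \<lparr>Src = prod_cat (prod_cat C C) (prod_cat C C),
    Tgt = prod_cat (prod_cat C C) (prod_cat C C), Dat = middle_functor C C C C\<rparr>"
    using C by (intro interchange_CAT) auto
  note defs = coalgebra_def coalg_mor_def tensor_coalg_def unit_coalg_def cat_bialg_def in_homs_CAT
    inverse_of_lunit_unit_CAT[unfolded CAT_sel] this
  have "coalgebra CAT (cat_bialg C m u)"
    using C by (simp add: defs cat_rules is_functor_diag is_functor_terminal comp_functor_eq_iff)
  moreover have "coalg_mor CAT (tensor_coalg CAT (cat_bialg C m u) (cat_bialg C m u)) (cat_bialg C
      m u) (Mul (cat_bialg C m u))"
    using C m by (simp add: defs cat_rules comp_functor_eq_iff in_)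
  moreover have "coalg_mor CAT (unit_coalg CAT) (cat_bialg C m u) (Unt (cat_bialg C m u))"
    using C u by (simp add: defs cat_rules comp_functor_eq_iff in_)
  ultimately show ?thesis
    using True unfolding bialgebra_def cat_monoid_def
    by (simp add: comp_functor_eq_iff in_ cat_bialg_def) blast
next
  case False
  then show ?thesis
    by (auto simp: bialgebra_def cat_monoid_def coalg_mor_def cat_bialg_def in_homs_CAT
        unit_coalg_def)
qed

section \<open>Bialgebras in \<open>FS S\<close> described by their components\<close>

definition fs_bialg :: "('o, 'a, 'z) smc_scheme \<Rightarrow> ('u, 'o, 'a) fobj \<Rightarrow> 'u sfunctr \<Rightarrow> 'u sfunctr
    \<Rightarrow> ('u univ \<Rightarrow> 'a) \<Rightarrow> ('u univ \<Rightarrow> 'a) \<Rightarrow> ('u univ \<Rightarrow> 'a) \<Rightarrow> ('u univ \<Rightarrow> 'a)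
    \<Rightarrow> (('u, 'o, 'a) fobj, ('u, 'o, 'a) fmor) bialg" where
  "fs_bialg S P m u \<delta> \<epsilon> \<mu> \<eta> =
     \<lparr>Crr = P,
      Cmul = \<lparr>Src = P, Tgt = fs_tobj S P P, Dat = (diag_functor (fst P), \<delta>)\<rparr>,
      Cun = \<lparr>Src = P, Tgt = fs_unit S, Dat = (terminal_functor (fst P), \<epsilon>)\<rparr>,
      Mul = \<lparr>Src = fs_tobj S P P, Tgt = P, Dat = (m, \<mu>)\<rparr>,
      Unt = \<lparr>Src = fs_unit S, Tgt = P, Dat = (u, \<eta>)\<rparr>\<rparr>"

definition fiber :: "('u, 'o, 'a) fobj \<Rightarrow> ('u univ \<Rightarrow> 'a) \<Rightarrow> ('u univ \<Rightarrow> 'a) \<Rightarrow> 'u univ \<Rightarrow> ('o, 'a)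
    coalg" where
  "fiber P \<delta> \<epsilon> x = \<lparr>Crr = FOb (snd P) x, Cmul = \<delta> x, Cun = \<epsilon> x\<rparr>"

lemma fiber_sel [simp]:
  "Crr (fiber P \<delta> \<epsilon> x) = FOb (snd P) x" "Cmul (fiber P \<delta> \<epsilon> x) = \<delta> x" "Cun (fiber P \<delta> \<epsilon> x) = \<epsilon> x"
  by (simp_all add: fiber_def)

text \<open>The condition on arrows is the naturality of \<delta> and \<epsilon>, read from the side
  of the functor: every arrow of the base acts by a coalgebra morphism.\<close>

definition fibered_coalgebra :: "('o, 'a, 'z) smc_scheme \<Rightarrow> ('u, 'o, 'a) fobj
    \<Rightarrow> ('u univ \<Rightarrow> 'a) \<Rightarrow> ('u univ \<Rightarrow> 'a) \<Rightarrow> bool" where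
  "fibered_coalgebra S P \<delta> \<epsilon> \<longleftrightarrow>
     \<delta> \<in> extensional (Ob (fst P)) \<and> \<epsilon> \<in> extensional (Ob (fst P))
     \<and> (\<forall>x \<in> Ob (fst P). coalgebra S (fiber P \<delta> \<epsilon> x))
     \<and> (\<forall>a \<in> Ar (fst P). coalg_mor S (fiber P \<delta> \<epsilon> (Dom (fst P) a)) (fiber P \<delta> \<epsilon> (Cod (fst P) a))
         (FAr (snd P) a))"

text \<open>The equation indexed by two arrows is the naturality of \<mu>; over \<open>G_cat\<close>
  it becomes the compatibility of \<phi> with the product.\<close>

definition fibered_bialgebra :: "('o, 'a, 'z) smc_scheme \<Rightarrow> ('u, 'o, 'a) fobj \<Rightarrow> 'u sfunctr \<Rightarrow> 'u
    sfunctr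
    \<Rightarrow> ('u univ \<Rightarrow> 'a) \<Rightarrow> ('u univ \<Rightarrow> 'a) \<Rightarrow> ('u univ \<Rightarrow> 'a) \<Rightarrow> ('u univ \<Rightarrow> 'a) \<Rightarrow> bool" where
  "fibered_bialgebra S P m u \<delta> \<epsilon> \<mu> \<eta> \<longleftrightarrow>
     P \<in> fs_obj S \<and> cat_monoid (fst P) m u
     \<and> fibered_coalgebra S P \<delta> \<epsilon>
     \<and> \<mu> \<in> extensional (ptimes (Ob (fst P)) (Ob (fst P))) \<and> \<eta> \<in> extensional {Star}
     \<and> (\<forall>x \<in> Ob (fst P). \<forall>y \<in> Ob (fst P).
          coalg_mor S (tensor_coalg S (fiber P \<delta> \<epsilon> x) (fiber P \<delta> \<epsilon> y)) (fiber P \<delta> \<epsilon> (FOb m (Pr x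
              y))) (\<mu> (Pr x y)))
     \<and> coalg_mor S (unit_coalg S) (fiber P \<delta> \<epsilon> (FOb u Star)) (\<eta> Star)
     \<and> (\<forall>a \<in> Ar (fst P). \<forall>b \<in> Ar (fst P).
          \<mu> (Pr (Cod (fst P) a) (Cod (fst P) b)) \<cdot>\<^bsub>S\<^esub> (FAr (snd P) a \<odot>\<^bsub>S\<^esub> FAr (snd P) b)
          = FAr (snd P) (FAr m (Pr a b)) \<cdot>\<^bsub>S\<^esub> \<mu> (Pr (Dom (fst P) a) (Dom (fst P) b)))
     \<and> (\<forall>x \<in> Ob (fst P). \<forall>y \<in> Ob (fst P). \<forall>z \<in> Ob (fst P).
          \<mu> (Pr (FOb m (Pr x y)) z) \<cdot>\<^bsub>S\<^esub> (\<mu> (Pr x y) \<odot>\<^bsub>S\<^esub> Id S (FOb (snd P) z))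
          = \<mu> (Pr x (FOb m (Pr y z))) \<cdot>\<^bsub>S\<^esub> (Id S (FOb (snd P) x) \<odot>\<^bsub>S\<^esub> \<mu> (Pr y z))
            \<cdot>\<^bsub>S\<^esub> assoc S (FOb (snd P) x) (FOb (snd P) y) (FOb (snd P) z))
     \<and> (\<forall>x \<in> Ob (fst P). \<mu> (Pr (FOb u Star) x) \<cdot>\<^bsub>S\<^esub> (\<eta> Star \<odot>\<^bsub>S\<^esub> Id S (FOb (snd P) x))
         = lunit S (FOb (snd P) x))
     \<and> (\<forall>x \<in> Ob (fst P). \<mu> (Pr x (FOb u Star)) \<cdot>\<^bsub>S\<^esub> (Id S (FOb (snd P) x) \<odot>\<^bsub>S\<^esub> \<eta> Star)
         = runit S (FOb (snd P) x))"

context symmetric_monoidal_category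
begin

lemma coalgebra_fs_bialg_iff:
  assumes P: "P \<in> fs_obj S"
  shows "coalgebra (FS S) (fs_bialg S P m u \<delta> \<epsilon> \<mu> \<eta>) \<longleftrightarrow> fibered_coalgebra S P \<delta> \<epsilon>"
proof -
  note P' = fs_objD[OF P]
  \<comment> \<open>\<open>fs_unit\<close> sends its arrow to an identity, which shows up in the
    naturality square of \<epsilon>. Cancelling it leaves the counit equation of
    \<open>coalg_mor\<close>.\<close>
  have "Id S (tunit S) \<cdot> \<epsilon> x = \<epsilon> x" if "\<epsilon> x \<in> homs S (FOb (snd P) x) (tunit S)" for x
    using that by (rule Id_left)
  moreover have "FOb (snd P) x \<in> Ob S" if "x \<in> Ob (fst P)" for x
    using P' that by (simp add: is_functor_iff)
  ultimately show ?thesis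
    using P P' unfolding coalgebra_def fs_bialg_def fibered_coalgebra_def coalg_mor_def
    by (simp add: in_homs_FS fs_tobj_in fs_unit_in is_functor_diag is_functor_terminal
        restrict_eq_iff comp_functor_eq_iff fs_functor_homs category.Dom_in category.Cod_in cong:
            conj_cong ball_cong) blast
qed

text \<open>Projection of the axioms to the base. It settles the degenerate case of the equivalence
  that follows.\<close>

lemma cat_monoid_of_bialgebra_FS:
  assumes b: "bialgebra (FS S) (fs_bialg S P m u \<delta> \<epsilon> \<mu> \<eta>)"
  shows "P \<in> fs_obj S \<and> cat_monoid (fst P) m u"
proof -
  have P: "P \<in> fs_obj S" and m: "is_functor (prod_cat (fst P) (fst P)) (fst P) m"
      and u: "is_functor one_cat (fst P) u"
    using b by (auto simp: bialgebra_def coalgebra_def fs_bialg_def coalg_mor_def in_homs_FS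
        tensor_coalg_def unit_coalg_def)
  note in_ = mul_functor_in[OF m] unit_functor_in(1,2)[OF u]
  show ?thesis using b fs_objD[OF P] P m u in_
    unfolding bialgebra_def cat_monoid_def
    by (simp add: fs_bialg_def comp_functor_eq_iff)
qed

text \<open>Once the base is known to be a strict monoidal category, the functor part of each
  equation is true and the axiom shrinks to its equation between components. This is why the monoid
  laws of the base are decided first.\<close>

lemma bialgebra_fs_bialg_iff:
  "bialgebra (FS S) (fs_bialg S P m u \<delta> \<epsilon> \<mu> \<eta>) \<longleftrightarrow> fibered_bialgebra S P m u \<delta> \<epsilon> \<mu> \<eta>"
proof (cases "P \<in> fs_obj S \<and> cat_monoid (fst P) m u")
  case True
  then have P: "P \<in> fs_obj S" and M: "cat_monoid (fst P) m u" by auto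
  then have m: "is_functor (prod_cat (fst P) (fst P)) (fst P) m"
      and u: "is_functor one_cat (fst P) u"
    and monoid: "\<And>x y z. \<lbrakk>x \<in> Ob (fst P); y \<in> Ob (fst P); z \<in> Ob (fst P)\<rbrakk> \<Longrightarrow>
          FOb m (Pr (FOb m (Pr x y)) z) = FOb m (Pr x (FOb m (Pr y z)))"
     "\<And>x y z. \<lbrakk>x \<in> Ar (fst P); y \<in> Ar (fst P); z \<in> Ar (fst P)\<rbrakk> \<Longrightarrow>
          FAr m (Pr (FAr m (Pr x y)) z) = FAr m (Pr x (FAr m (Pr y z)))"
     "\<And>x. x \<in> Ob (fst P) \<Longrightarrow> FOb m (Pr (FOb u Star) x) = x"
     "\<And>x. x \<in> Ob (fst P) \<Longrightarrow> FOb m (Pr x (FOb u Star)) = x"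
     "\<And>x. x \<in> Ar (fst P) \<Longrightarrow> FAr m (Pr (FAr u Star) x) = x"
     "\<And>x. x \<in> Ar (fst P) \<Longrightarrow> FAr m (Pr x (FAr u Star)) = x"
    by (auto simp: cat_monoid_def)
  note P' = fs_objD[OF P]
  note in_ = mul_functor_in[OF m] unit_functor_in(1,2)[OF u]
  let ?X = "fs_bialg S P m u \<delta> \<epsilon> \<mu> \<eta>"
  have "coalg_mor (FS S) (tensor_coalg (FS S) ?X ?X) ?X (Mul ?X) \<longleftrightarrow>
     \<mu> \<in> extensional (ptimes (Ob (fst P)) (Ob (fst P)))
     \<and> (\<forall>x \<in> Ob (fst P). \<forall>y \<in> Ob (fst P).
          coalg_mor S (tensor_coalg S (fiber P \<delta> \<epsilon> x) (fiber P \<delta> \<epsilon> y)) (fiber P \<delta> \<epsilon> (FOb m (Pr x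
              y))) (\<mu> (Pr x y)))
     \<and> (\<forall>a \<in> Ar (fst P). \<forall>b \<in> Ar (fst P).
          \<mu> (Pr (Cod (fst P) a) (Cod (fst P) b)) \<cdot>\<^bsub>S\<^esub> (FAr (snd P) a \<odot>\<^bsub>S\<^esub> FAr (snd P) b)
          = FAr (snd P) (FAr m (Pr a b)) \<cdot>\<^bsub>S\<^esub> \<mu> (Pr (Dom (fst P) a) (Dom (fst P) b)))"
    using P P' m
    by (simp add: coalg_mor_def tensor_coalg_def fs_bialg_def in_homs_FS fs_tobj_in
        interchange_FS[unfolded FS_sel] restrict_eq_iff comp_functor_eq_iff in_ category.Dom_in
            category.Cod_in
        cong: conj_cong ball_cong) blast
  moreover have "coalg_mor (FS S) (unit_coalg (FS S)) ?X (Unt ?X) \<longleftrightarrow>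
     \<eta> \<in> extensional {Star} \<and> coalg_mor S (unit_coalg S) (fiber P \<delta> \<epsilon> (FOb u Star)) (\<eta> Star)"
  proof -
    \<comment> \<open>The only arrow of \<open>one_cat\<close> is an identity and u preserves it, so
      the naturality square of \<eta> reduces to the two identity laws of \<open>S\<close>.\<close>
    have "FAr (snd P) (Id (fst P) (FOb u Star)) = Id S (FOb (snd P) (FOb u Star))"
      using functor_in(5)[OF P'(3)] in_ by simp
    moreover have "\<eta> Star \<cdot> Id S (tunit S) = Id S (FOb (snd P) (FOb u Star)) \<cdot> \<eta> Star"
      if "\<eta> Star \<in> homs S (tunit S) (FOb (snd P) (FOb u Star))"
      using Id_left[OF that] Id_right[OF that] by simp
    ultimately have "Unt ?X \<in> homs (FS S) (fs_unit S) P \<longleftrightarrow>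
        \<eta> \<in> extensional {Star} \<and> \<eta> Star \<in> homs S (tunit S) (FOb (snd P) (FOb u Star))"
      using P u by (simp add: fs_bialg_def in_homs_FS fs_unit_in in_ unit_functor_in(3)[OF u]
          cong: conj_cong)
    moreover have "Cmul ?X \<cdot>\<^bsub>FS S\<^esub> Unt ?X
        = (Unt ?X \<odot>\<^bsub>FS S\<^esub> Unt ?X) \<cdot>\<^bsub>FS S\<^esub> inverse_of (FS S) (lunit (FS S) (fs_unit S)) \<longleftrightarrow>
        \<delta> (FOb u Star) \<cdot> \<eta> Star = (\<eta> Star \<odot> \<eta> Star) \<cdot> inverse_of S (lunit S (tunit S))"
      unfolding inverse_of_lunit_unit_FS
      by (simp add: fs_bialg_def restrict_eq_iff comp_functor_eq_iff in_)
    moreover have "Cun ?X \<cdot>\<^bsub>FS S\<^esub> Unt ?X = Id (FS S) (fs_unit S) \<longleftrightarrow>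
        \<epsilon> (FOb u Star) \<cdot> \<eta> Star = Id S (tunit S)"
      by (simp add: fs_bialg_def restrict_eq_iff comp_functor_eq_iff in_)
    moreover have "Crr ?X = P" by (simp add: fs_bialg_def)
    ultimately show ?thesis
      unfolding coalg_mor_def unit_coalg_def by (simp only: coalg.simps FS_sel fiber_sel) blast
  qed
  moreover have "Mul ?X \<cdot>\<^bsub>FS S\<^esub> (Mul ?X \<odot>\<^bsub>FS S\<^esub> Id (FS S) (Crr ?X))
       = Mul ?X \<cdot>\<^bsub>FS S\<^esub> (Id (FS S) (Crr ?X) \<odot>\<^bsub>FS S\<^esub> Mul ?X) \<cdot>\<^bsub>FS S\<^esub> assoc (FS S) (Crr ?X) (Crr ?X)
           (Crr ?X)
     \<longleftrightarrow> (\<forall>x \<in> Ob (fst P). \<forall>y \<in> Ob (fst P). \<forall>z \<in> Ob (fst P).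
          \<mu> (Pr (FOb m (Pr x y)) z) \<cdot>\<^bsub>S\<^esub> (\<mu> (Pr x y) \<odot>\<^bsub>S\<^esub> Id S (FOb (snd P) z))
          = \<mu> (Pr x (FOb m (Pr y z))) \<cdot>\<^bsub>S\<^esub> (Id S (FOb (snd P) x) \<odot>\<^bsub>S\<^esub> \<mu> (Pr y z))
            \<cdot>\<^bsub>S\<^esub> assoc S (FOb (snd P) x) (FOb (snd P) y) (FOb (snd P) z))"
    by (simp add: fs_bialg_def restrict_eq_iff comp_functor_eq_iff monoid in_)
  moreover have "Mul ?X \<cdot>\<^bsub>FS S\<^esub> (Unt ?X \<odot>\<^bsub>FS S\<^esub> Id (FS S) (Crr ?X)) = lunit (FS S) (Crr ?X)
     \<longleftrightarrow> (\<forall>x \<in> Ob (fst P). \<mu> (Pr (FOb u Star) x) \<cdot>\<^bsub>S\<^esub> (\<eta> Star \<odot>\<^bsub>S\<^esub> Id S (FOb (snd P) x))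
         = lunit S (FOb (snd P) x))"
    by (simp add: fs_bialg_def restrict_eq_iff comp_functor_eq_iff monoid in_)
  moreover have "Mul ?X \<cdot>\<^bsub>FS S\<^esub> (Id (FS S) (Crr ?X) \<odot>\<^bsub>FS S\<^esub> Unt ?X) = runit (FS S) (Crr ?X)
     \<longleftrightarrow> (\<forall>x \<in> Ob (fst P). \<mu> (Pr x (FOb u Star)) \<cdot>\<^bsub>S\<^esub> (Id S (FOb (snd P) x) \<odot>\<^bsub>S\<^esub> \<eta> Star)
         = runit S (FOb (snd P) x))"
    by (simp add: fs_bialg_def restrict_eq_iff comp_functor_eq_iff monoid in_)
  ultimately show ?thesis
    unfolding bialgebra_def coalgebra_fs_bialg_iff[OF P] fibered_bialgebra_def
    using P M by (simp only:) blast
next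
  case False
  then have "\<not> fibered_bialgebra S P m u \<delta> \<epsilon> \<mu> \<eta>"
    by (simp only: fibered_bialgebra_def) blast
  with False cat_monoid_of_bialgebra_FS[of P m u \<delta> \<epsilon> \<mu> \<eta>] show ?thesis
    by blast
qed

text \<open>The counit laws project to the base, where they make the comultiplication diagonal. Thus
  every bialgebra is in the normal form \<open>fs_bialg\<close>, and the preceding equivalence
  covers all of them.\<close>

lemma bialgebra_FS_eq:
  assumes "bialgebra (FS S) X"
  shows "X = fs_bialg S (Crr X) (fun_of (Mul X)) (fun_of (Unt X)) (cmp (Cmul X)) (cmp (Cun X))
      (cmp (Mul X)) (cmp (Unt X))"
proof -
  let ?C = "fst (Crr X)"
  have h: "Cmul X \<in> homs (FS S) (Crr X) (fs_tobj S (Crr X) (Crr X))" "Cun X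
      \<in> homs (FS S) (Crr X) (fs_unit S)"
    "Mul X \<in> homs (FS S) (fs_tobj S (Crr X) (Crr X)) (Crr X)" "Unt X
        \<in> homs (FS S) (fs_unit S) (Crr X)"
    using assms unfolding bialgebra_def coalgebra_def coalg_mor_def tensor_coalg_def
        unit_coalg_def by simp_all
  have C: "category ?C" and D: "Src (Cmul X) = Crr X" "Tgt (Cmul X) = fs_tobj S (Crr X) (Crr X)"
    "is_functor ?C (prod_cat ?C ?C) (fun_of (Cmul X))"
    and E: "Src (Cun X) = Crr X" "Tgt (Cun X) = fs_unit S" "is_functor ?C one_cat (fun_of (Cun X))"
    and M: "Src (Mul X) = fs_tobj S (Crr X) (Crr X)" "Tgt (Mul X) = Crr X"
    and U: "Src (Unt X) = fs_unit S" "Tgt (Unt X) = Crr X"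
    using h by (auto simp: in_homs_FS fs_objD)
  have "comp_functor ?C (lunit_functor ?C) (comp_functor ?C (prod_functor ?C ?C (fun_of (Cun X))
      (id_functor ?C)) (fun_of (Cmul X))) = id_functor ?C"
    "comp_functor ?C (runit_functor ?C) (comp_functor ?C (prod_functor ?C ?C (id_functor ?C)
        (fun_of (Cun X))) (fun_of (Cmul X))) = id_functor ?C"
    using assms by (auto simp: bialgebra_def coalgebra_def D E)
  from comultiplication_is_diagonal[OF C D(3) E(3) this] functor_to_one[OF C E(3)] D E M U
  show ?thesis by (auto intro!: bialg.equality simp: fs_bialg_def mor_eq_iff prod_eq_iff)
qed

end

lemma base_fs_bialg: "base (fs_bialg S P m u \<delta> \<epsilon> \<mu> \<eta>) = cat_bialg (fst P) m u"
  by (simp add: base_def fs_bialg_def cat_bialg_def base_mor_def)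

section \<open>Antipodes and isomorphisms in components\<close>

definition cat_antipode :: "'u scat \<Rightarrow> 'u sfunctr \<Rightarrow> 'u sfunctr \<Rightarrow> 'u sfunctr \<Rightarrow> bool" where
  "cat_antipode C m u \<sigma> \<longleftrightarrow>
     is_functor C C \<sigma>
     \<and> (\<forall>x \<in> Ob C. FOb m (Pr (FOb \<sigma> x) x) = FOb u Star \<and> FOb m (Pr x (FOb \<sigma> x)) = FOb u Star)
     \<and> (\<forall>a \<in> Ar C. FAr m (Pr (FAr \<sigma> a) a) = FAr u Star \<and> FAr m (Pr a (FAr \<sigma> a)) = FAr u Star)"

lemma antipode_cat_bialg_iff:
  assumes "category C" "normalized_cat C"
  shows "antipode CAT (cat_bialg C m u) s \<longleftrightarrow> Src s = C \<and> Tgt s = C \<and> cat_antipode C m u (Dat s)"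
  using assms
  by (simp add: antipode_def cat_bialg_def in_homs_CAT cat_antipode_def comp_functor_eq_iff
      functor_in
      cong: conj_cong) blast

lemma (in symmetric_monoidal_category) antipode_fs_bialg_iff:
  shows "antipode (FS S) (fs_bialg S P m u \<delta> \<epsilon> \<mu> \<eta>) s \<longleftrightarrow> s \<in> homs (FS S) P P
    \<and> cat_antipode (fst P) m u (fun_of s)
    \<and> (\<forall>x \<in> Ob (fst P).
        \<mu> (Pr (FOb (fun_of s) x) x) \<cdot> (cmp s x \<odot> Id S (FOb (snd P) x)) \<cdot> \<delta> x = \<eta> Star \<cdot> \<epsilon> x)
    \<and> (\<forall>x \<in> Ob (fst P).
        \<mu> (Pr x (FOb (fun_of s) x)) \<cdot> (Id S (FOb (snd P) x) \<odot> cmp s x) \<cdot> \<delta> x = \<eta> Star \<cdot> \<epsilon> x)"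
  by (auto simp: antipode_def fs_bialg_def in_homs_FS cat_antipode_def comp_functor_eq_iff
      functor_in
      restrict_eq_iff cong: conj_cong)

definition monoid_functor :: "'u scat \<Rightarrow> 'u sfunctr \<Rightarrow> 'u sfunctr \<Rightarrow> 'u sfunctr \<Rightarrow> 'u sfunctr \<Rightarrow> 'u
    sfunctr \<Rightarrow> bool" where
  "monoid_functor C m u m' u' F \<longleftrightarrow>
     (\<forall>x \<in> Ob C. \<forall>y \<in> Ob C. FOb F (FOb m (Pr x y)) = FOb m' (Pr (FOb F x) (FOb F y)))
     \<and> (\<forall>a \<in> Ar C. \<forall>b \<in> Ar C. FAr F (FAr m (Pr a b)) = FAr m' (Pr (FAr F a) (FAr F b)))
     \<and> FOb F (FOb u Star) = FOb u' Star \<and> FAr F (FAr u Star) = FAr u' Star"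

text \<open>Here the right-hand side is an arbitrary functor rather than a composite or a
  constraint, so its extensionality has to come from its being a functor.\<close>

lemma comp_functor_eq_unit:
  "is_functor one_cat D u' \<Longrightarrow> comp_functor one_cat F u = u' \<longleftrightarrow>
    FOb F (FOb u Star) = FOb u' Star \<and> FAr F (FAr u Star) = FAr u' Star"
proof -
  assume "is_functor one_cat D u'"
  then have u': "FOb u' \<in> extensional {Star}" "FAr u' \<in> extensional {Star}"
    by (auto simp: is_functor_iff)
  have "comp_functor one_cat F u = u' \<longleftrightarrow>
      (\<lambda>x \<in> {Star}. FOb F (FOb u x)) = FOb u' \<and> (\<lambda>x \<in> {Star}. FAr F (FAr u x)) = FAr u'"
    by (auto simp: comp_functor_def compose_def intro!: functr_eqI)
  then show ?thesis
    by (simp add: extensional_eq_iff[OF _ u'(1)] extensional_eq_iff[OF _ u'(2)])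
qed

text \<open>Any functor commutes with diagonals and with the functors to \<open>one_cat\<close>;
  only product and unit give conditions.\<close>

lemma hopf_iso_cat_bialg_iff:
  assumes "category C" "normalized_cat C" "category D" "normalized_cat D" "is_functor one_cat D u'"
  shows "hopf_iso CAT (cat_bialg C m u) (cat_bialg D m' u') f \<longleftrightarrow>
    f \<in> homs CAT C D \<and> invertible CAT f \<and> monoid_functor C m u m' u' (Dat f)"
  using assms
  by (auto simp: hopf_iso_def coalg_mor_def cat_bialg_def in_homs_CAT monoid_functor_def
      comp_functor_eq_iff
      functor_in comp_functor_eq_unit[where D=D and u'=u'] mor_eq_iff cong: conj_cong)

lemma (in symmetric_monoidal_category) hopf_iso_fs_bialg_iff:
  assumes P: "P \<in> fs_obj S" and Q: "Q \<in> fs_obj S" and u': "is_functor one_cat (fst Q) u'" "\<eta>'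
      \<in> extensional {Star}"
    and \<epsilon>: "\<epsilon> \<in> extensional (Ob (fst P))"
  shows "hopf_iso (FS S) (fs_bialg S P m u \<delta> \<epsilon> \<mu> \<eta>) (fs_bialg S Q m' u' \<delta>' \<epsilon>' \<mu>' \<eta>') f \<longleftrightarrow>
    f \<in> homs (FS S) P Q \<and> invertible CAT (base_mor f) \<and> monoid_functor (fst P) m u m' u' (fun_of f)
    \<and> (\<forall>x \<in> Ob (fst P). coalg_mor S (fiber P \<delta> \<epsilon> x) (fiber Q \<delta>' \<epsilon>' (FOb (fun_of f) x)) (cmp f x)
         \<and> invertible S (cmp f x))
    \<and> (\<forall>x \<in> Ob (fst P). \<forall>y \<in> Ob (fst P). cmp f (FOb m (Pr x y)) \<cdot> \<mu> (Pr x y)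
         = \<mu>' (Pr (FOb (fun_of f) x) (FOb (fun_of f) y)) \<cdot> (cmp f x \<odot> cmp f y))
    \<and> cmp f (FOb u Star) \<cdot> \<eta> Star = \<eta>' Star"
proof -
  \<comment> \<open>The counit and unit equations have \<epsilon> and \<eta>' themselves on one
    side, not restrictions; extensionality makes these two equations pointwise as well.\<close>
  have *: "(\<lambda>x\<in>{Star}. g x) = \<eta>' \<longleftrightarrow> g Star = \<eta>' Star" for g
    using u'(2) extensional_eq_iff[of "restrict g {Star}" "{Star}" \<eta>'] by simp
  have **: "(\<lambda>x\<in>Ob (fst P). g x) = \<epsilon> \<longleftrightarrow> (\<forall>x \<in> Ob (fst P). g x = \<epsilon> x)" for g
    using \<epsilon> extensional_eq_iff[of "restrict g (Ob (fst P))" "Ob (fst P)" \<epsilon>] by simp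
  have "hopf_iso (FS S) (fs_bialg S P m u \<delta> \<epsilon> \<mu> \<eta>) (fs_bialg S Q m' u' \<delta>' \<epsilon>' \<mu>' \<eta>') f \<longleftrightarrow>
    f \<in> homs (FS S) P Q \<and> invertible (FS S) f \<and> monoid_functor (fst P) m u m' u' (fun_of f)
    \<and> (\<forall>x \<in> Ob (fst P). coalg_mor S (fiber P \<delta> \<epsilon> x) (fiber Q \<delta>' \<epsilon>' (FOb (fun_of f) x)) (cmp f x))
    \<and> (\<forall>x \<in> Ob (fst P). \<forall>y \<in> Ob (fst P). cmp f (FOb m (Pr x y)) \<cdot> \<mu> (Pr x y)
         = \<mu>' (Pr (FOb (fun_of f) x) (FOb (fun_of f) y)) \<cdot> (cmp f x \<odot> cmp f y))
    \<and> cmp f (FOb u Star) \<cdot> \<eta> Star = \<eta>' Star"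
    using fs_objD[OF P] fs_objD[OF Q]
    by (auto simp: hopf_iso_def coalg_mor_def fs_bialg_def in_homs_FS monoid_functor_def
        comp_functor_eq_iff
      functor_in comp_functor_eq_unit[OF u'(1)] mor_eq_iff restrict_eq_iff * ** cong: conj_cong)
  with invertible_FS_iff[of f P Q] show ?thesis by blast
qed

section \<open>Crossed modules and Hopf algebras in small categories\<close>

lemma (in group) inv_cancel_left [simp]:
  "x \<in> carrier G \<Longrightarrow> y \<in> carrier G \<Longrightarrow> inv x \<otimes> (x \<otimes> y) = y"
  "x \<in> carrier G \<Longrightarrow> y \<in> carrier G \<Longrightarrow> x \<otimes> (inv x \<otimes> y) = y"
  by (simp_all add: m_assoc[symmetric])

section \<open>Calculation in a crossed module\<close>

locale crossed =
  fixes X :: "('h, 'e) crossed"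
  assumes crossed: "crossed_module X"
begin

abbreviation "H \<equiv> HG X"
abbreviation "E \<equiv> EG X"

sublocale H: group H using crossed by (simp add: crossed_module_def)
sublocale E: group E using crossed by (simp add: crossed_module_def)
sublocale bd: group_hom E H "bd X"
  using crossed by unfold_locales (simp add: crossed_module_def)

lemma act_group_hom: "x \<in> carrier H \<Longrightarrow> group_hom E E (act X x)"
  using crossed by (auto simp: group_hom_def group_hom_axioms_def E.group_axioms
      crossed_module_def iso_def)

lemma act_simps [simp]:
  assumes "x \<in> carrier H"
  shows "e \<in> carrier E \<Longrightarrow> act X x e \<in> carrier E"
    "e \<in> carrier E \<Longrightarrow> f \<in> carrier E \<Longrightarrow> act X x (e \<otimes>\<^bsub>E\<^esub> f) = act X x e \<otimes>\<^bsub>E\<^esub> act X x f"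
    "act X x \<one>\<^bsub>E\<^esub> = \<one>\<^bsub>E\<^esub>"
    "e \<in> carrier E \<Longrightarrow> act X x (inv\<^bsub>E\<^esub> e) = inv\<^bsub>E\<^esub> (act X x e)"
  using group_hom.hom_closed[OF act_group_hom[OF assms]] group_hom.hom_mult[OF act_group_hom[OF
      assms]]
    group_hom.hom_one[OF act_group_hom[OF assms]] group_hom.hom_inv[OF act_group_hom[OF assms]]
  by auto

lemma act_mult:
  "x \<in> carrier H \<Longrightarrow> y \<in> carrier H \<Longrightarrow> e \<in> carrier E \<Longrightarrow> act X (x \<otimes>\<^bsub>H\<^esub> y) e = act X x (act X y e)"
  using crossed by (simp add: crossed_module_def)

lemma act_one [simp]: "e \<in> carrier E \<Longrightarrow> act X \<one>\<^bsub>H\<^esub> e = e"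
  using crossed by (simp add: crossed_module_def)

lemma act_inv_cancel [simp]:
  assumes "x \<in> carrier H" "e \<in> carrier E"
  shows "act X x (act X (inv\<^bsub>H\<^esub> x) e) = e" "act X (inv\<^bsub>H\<^esub> x) (act X x e) = e"
  using assms act_mult[of x "inv\<^bsub>H\<^esub> x" e] act_mult[of "inv\<^bsub>H\<^esub> x" x e] by auto

text \<open>Products are nested to the right, unlike in \<open>crossed_module\<close>, to agree with
  the normal form that \<open>m_assoc\<close> produces.\<close>

lemma bd_act [simp]:
  "x \<in> carrier H \<Longrightarrow> e \<in> carrier E \<Longrightarrow> bd X (act X x e) = x \<otimes>\<^bsub>H\<^esub> (bd X e \<otimes>\<^bsub>H\<^esub> inv\<^bsub>H\<^esub> x)"
  using crossed by (simp add: crossed_module_def H.m_assoc)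

lemma act_bd [simp]:
  "e \<in> carrier E \<Longrightarrow> f \<in> carrier E \<Longrightarrow> act X (bd X e) f = e \<otimes>\<^bsub>E\<^esub> (f \<otimes>\<^bsub>E\<^esub> inv\<^bsub>E\<^esub> e)"
  using crossed by (simp add: crossed_module_def E.m_assoc)

text \<open>Simplification turns the boundary of an inverse into the inverse of a boundary, to which
  \<open>act_bd\<close> does not apply; this is the Peiffer identity for that form.\<close>

lemma act_inv_bd [simp]:
  "e \<in> carrier E \<Longrightarrow> f \<in> carrier E \<Longrightarrow> act X (inv\<^bsub>H\<^esub> bd X e) f = inv\<^bsub>E\<^esub> e \<otimes>\<^bsub>E\<^esub> (f \<otimes>\<^bsub>E\<^esub> e)"
  using act_bd[of "inv\<^bsub>E\<^esub> e" f] by (simp add: bd.hom_inv del: act_bd)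

end

section \<open>The group object of a crossed module\<close>

lemma G_cat_sel [simp]:
  "Ob (G_cat X) = carrier (HG X)"
  "Ar (G_cat X) = ptimes (carrier (HG X)) (carrier (EG X))"
  "x \<in> carrier (HG X) \<Longrightarrow> e \<in> carrier (EG X) \<Longrightarrow> Dom (G_cat X) (Pr x e) = x"
  "x \<in> carrier (HG X) \<Longrightarrow> e \<in> carrier (EG X) \<Longrightarrow> Cod (G_cat X) (Pr x e) = bd X e \<otimes>\<^bsub>HG X\<^esub> x"
  "x \<in> carrier (HG X) \<Longrightarrow> Id (G_cat X) x = Pr x \<one>\<^bsub>EG X\<^esub>"
  "x \<in> carrier (HG X) \<Longrightarrow> e \<in> carrier (EG X) \<Longrightarrow> y \<in> carrier (HG X) \<Longrightarrow> f \<in> carrier (EG X)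
    \<Longrightarrow> y = bd X e \<otimes>\<^bsub>HG X\<^esub> x \<Longrightarrow> Pr y f \<cdot>\<^bsub>G_cat X\<^esub> Pr x e = Pr x (f \<otimes>\<^bsub>EG X\<^esub> e)"
  by (simp_all add: G_cat_def Let_def)

lemma G_functor_sel [simp]:
  "x \<in> carrier (HG X) \<Longrightarrow> y \<in> carrier (HG X) \<Longrightarrow> FOb (G_mul X) (Pr x y) = x \<otimes>\<^bsub>HG X\<^esub> y"
  "x \<in> carrier (HG X) \<Longrightarrow> y \<in> carrier (HG X) \<Longrightarrow> e \<in> carrier (EG X) \<Longrightarrow> f \<in> carrier (EG X)
    \<Longrightarrow> FAr (G_mul X) (Pr (Pr x e) (Pr y f)) = Pr (x \<otimes>\<^bsub>HG X\<^esub> y) (e \<otimes>\<^bsub>EG X\<^esub> act X x f)"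
  "FOb (G_un X) Star = \<one>\<^bsub>HG X\<^esub>" "FAr (G_un X) Star = Pr \<one>\<^bsub>HG X\<^esub> \<one>\<^bsub>EG X\<^esub>"
  "x \<in> carrier (HG X) \<Longrightarrow> FOb (G_anti X) x = inv\<^bsub>HG X\<^esub> x"
  "x \<in> carrier (HG X) \<Longrightarrow> e \<in> carrier (EG X)
    \<Longrightarrow> FAr (G_anti X) (Pr x e) = Pr (inv\<^bsub>HG X\<^esub> x) (act X (inv\<^bsub>HG X\<^esub> x) (inv\<^bsub>EG X\<^esub> e))"
  by (simp_all add: G_mul_def G_un_def G_anti_def)

lemma G_hopf_eq: "G_hopf X = cat_bialg (G_cat X) (G_mul X) (G_un X)"
  by (simp add: G_hopf_def cat_bialg_def G_cmul_def G_cun_def diag_functor_def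
      terminal_functor_def Let_def)

lemma normalized_G_cat: "normalized_cat (G_cat X)"
  unfolding normalized_cat_def by (auto simp: G_cat_def Let_def)

context
  fixes X :: "'u scrossed"
  assumes X: "crossed_module X"
begin

interpretation crossed X by unfold_locales (rule X)

lemma category_G_cat: "category (G_cat X)"
  by (auto simp: category_iff E.m_assoc H.m_assoc)

text \<open>Both crossed module axioms enter here. Targets agree by equivariance of
  \<open>bd\<close>. For composites, the Peiffer identity replaces the action of
  \<open>bd X e\<close> on a factor by conjugation with e, and the conjugating e cancels against the
  neighbouring factor.\<close>

lemma is_functor_G_mul: "is_functor (prod_cat (G_cat X) (G_cat X)) (G_cat X) (G_mul X)"
  by (auto simp: is_functor_iff E.m_assoc H.m_assoc act_mult) (auto simp: G_mul_def)

lemma is_functor_G_un: "is_functor one_cat (G_cat X) (G_un X)"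
  by (auto simp: is_functor_iff) (auto simp: G_un_def)

lemma is_functor_G_anti: "is_functor (G_cat X) (G_cat X) (G_anti X)"
  by (auto simp: is_functor_iff E.m_assoc H.m_assoc act_mult H.inv_mult_group E.inv_mult_group
      ) (auto simp: G_anti_def)

lemma cat_monoid_G: "cat_monoid (G_cat X) (G_mul X) (G_un X)"
  unfolding cat_monoid_def
  by (auto simp: category_G_cat normalized_G_cat is_functor_G_mul is_functor_G_un H.m_assoc
      E.m_assoc act_mult)

lemma cat_antipode_G: "cat_antipode (G_cat X) (G_mul X) (G_un X) (G_anti X)"
  unfolding cat_antipode_def by (auto simp: is_functor_G_anti)

text \<open>\<open>G_anti\<close> is inversion in the groups of objects and arrows, hence an
  involution and its own witness.\<close>

lemma invertible_G_anti: "invertible CAT \<lparr>Src = G_cat X, Tgt = G_cat X, Dat = G_anti X\<rparr>"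
  unfolding invertible_def inverse_pair_CAT
  by (rule exI[of _ "\<lparr>Src = G_cat X, Tgt = G_cat X, Dat = G_anti X\<rparr>"])
    (auto simp: in_homs_CAT category_G_cat normalized_G_cat is_functor_G_anti)

end

section \<open>The crossed module of a group object in small categories\<close>

locale group_cat =
  fixes C :: "'u scat" and m u \<sigma> :: "'u sfunctr"
  assumes mon: "cat_monoid C m u" and anti: "cat_antipode C m u \<sigma>"
begin

text \<open>\<open>Obs\<close> becomes the component \<open>HG\<close> of a normalized crossed
  module, hence the guard in its product. \<open>Ars\<close> is used only for calculation and
  carries the bare product of arrows.\<close>

definition "Obs = \<lparr>carrier = Ob C, mult = (\<lambda>x y. if x \<in> Ob C \<and> y
    \<in> Ob C then FOb m (Pr x y) else undefined),
  one = FOb u Star\<rparr>"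
definition "Ars = \<lparr>carrier = Ar C, mult = (\<lambda>a b. FAr m (Pr a b)), one = FAr u Star\<rparr>"

lemma carriers [simp]: "carrier Obs = Ob C" "carrier Ars = Ar C"
  by (simp_all add: Obs_def Ars_def)

lemma cat: "category C" and norm: "normalized_cat C" and m: "is_functor (prod_cat C C) C m"
  and u: "is_functor one_cat C u" and \<sigma>: "is_functor C C \<sigma>"
  using mon anti by (simp_all add: cat_monoid_def cat_antipode_def)

sublocale category C by (rule cat)

sublocale Ob: group Obs
  using mon anti by (intro groupI)
    (auto simp: Obs_def cat_monoid_def cat_antipode_def mul_functor_in unit_functor_in
      intro!: bexI[of _ "FOb \<sigma> _"] functor_in)

sublocale Ar: group Ars
  using mon anti by (intro groupI)
    (auto simp: Ars_def cat_monoid_def cat_antipode_def mul_functor_in unit_functor_in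
      intro!: bexI[of _ "FAr \<sigma> _"] functor_in)

text \<open>Source, target and identities are group homomorphisms because the product is a functor:
  C is a category internal to groups.\<close>

sublocale dom: group_hom Ars Obs "Dom C"
  by unfold_locales (auto simp: hom_def Dom_in, simp add: Ars_def Obs_def mul_functor_in[OF m]
      Dom_in)

sublocale cod: group_hom Ars Obs "Cod C"
  by unfold_locales (auto simp: hom_def Cod_in, simp add: Ars_def Obs_def mul_functor_in[OF m]
      Cod_in)

lemma Id_simps [simp]:
  "x \<in> Ob C \<Longrightarrow> Id C x \<in> Ar C" "x \<in> Ob C \<Longrightarrow> Dom C (Id C x) = x" "x \<in> Ob C \<Longrightarrow> Cod C (Id C x) = x"
  using Id_in by (auto simp: homs_def)

sublocale idt: group_hom Obs Ars "Id C"
proof unfold_locales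
  have "FAr m (Pr (Id C x) (Id C y)) = Id C (FOb m (Pr x y))" if "x \<in> Ob C" "y \<in> Ob C" for x y
    using functor_in(5)[OF m, of "Pr x y"] that by simp
  then show "Id C \<in> hom Obs Ars"
    by (auto simp: hom_def) (simp add: Ars_def Obs_def)
qed

lemma Comp_simps:
  assumes "f \<in> Ar C" "g \<in> Ar C" "Dom C g = Cod C f"
  shows "g \<cdot>\<^bsub>C\<^esub> f \<in> Ar C" "Dom C (g \<cdot>\<^bsub>C\<^esub> f) = Dom C f" "Cod C (g \<cdot>\<^bsub>C\<^esub> f) = Cod C g"
  using cat assms by (auto simp: category_iff)

lemma interchange_law:
  assumes "f \<in> Ar C" "g \<in> Ar C" "Dom C g = Cod C f" "f' \<in> Ar C" "g' \<in> Ar C" "Dom C g' = Cod C f'"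
  shows "(g \<otimes>\<^bsub>Ars\<^esub> g') \<cdot>\<^bsub>C\<^esub> (f \<otimes>\<^bsub>Ars\<^esub> f') = (g \<cdot>\<^bsub>C\<^esub> f) \<otimes>\<^bsub>Ars\<^esub> (g' \<cdot>\<^bsub>C\<^esub> f')"
proof -
  have "FAr m (Pr g g' \<cdot>\<^bsub>prod_cat C C\<^esub> Pr f f') = FAr m (Pr g g') \<cdot>\<^bsub>C\<^esub> FAr m (Pr f f')"
    using m assms by (auto simp: is_functor_iff)
  then show ?thesis using assms by (simp add: Ars_def)
qed

lemma Comp_Id [simp]: "f \<in> Ar C \<Longrightarrow> x = Dom C f \<Longrightarrow> f \<cdot>\<^bsub>C\<^esub> Id C x = f"
   "f \<in> Ar C \<Longrightarrow> x = Cod C f \<Longrightarrow> Id C x \<cdot>\<^bsub>C\<^esub> f = f"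
  using cat by (auto simp: category_iff)

lemma Id_one: "Id C \<one>\<^bsub>Obs\<^esub> = \<one>\<^bsub>Ars\<^esub>"
  by (rule idt.hom_one)

text \<open>By the interchange law applied to \<open>g = g \<cdot> 1\<close> and \<open>f = i \<cdot> (i\<inverse>
    \<cdot> f)\<close>, where \<open>i\<close> is the identity
  of the common object, composition is determined by the group law.\<close>

lemma Comp_eq:
  assumes f: "f \<in> Ar C" and g: "g \<in> Ar C" and y: "Dom C g = Cod C f"
  shows "g \<cdot>\<^bsub>C\<^esub> f = g \<otimes>\<^bsub>Ars\<^esub> (inv\<^bsub>Ars\<^esub> Id C (Cod C f) \<otimes>\<^bsub>Ars\<^esub> f)"
proof -
  let ?i = "Id C (Cod C f)" and ?k = "inv\<^bsub>Ars\<^esub> Id C (Cod C f) \<otimes>\<^bsub>Ars\<^esub> f"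
  have i: "?i \<in> Ar C" "Cod C f \<in> Ob C" using f Cod_in by auto
  have k: "?k \<in> Ar C" "Cod C ?k = \<one>\<^bsub>Obs\<^esub>"
    using Ar.m_closed[of "inv\<^bsub>Ars\<^esub> ?i" f] cod.hom_mult[of "inv\<^bsub>Ars\<^esub> ?i" f] i f
        by (auto simp: Ar.inv_closed[simplified])
  have "g \<cdot>\<^bsub>C\<^esub> f = (g \<otimes>\<^bsub>Ars\<^esub> \<one>\<^bsub>Ars\<^esub>) \<cdot>\<^bsub>C\<^esub> (?i \<otimes>\<^bsub>Ars\<^esub> ?k)"
    using f g i Ar.r_one[of g] Ar.inv_cancel_left(2)[of ?i f] by simp
  also have "\<dots> = (g \<cdot>\<^bsub>C\<^esub> ?i) \<otimes>\<^bsub>Ars\<^esub> (\<one>\<^bsub>Ars\<^esub> \<cdot>\<^bsub>C\<^esub> ?k)"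
    using f g i k y Ar.one_closed by (intro interchange_law) auto
  also have "\<one>\<^bsub>Ars\<^esub> \<cdot>\<^bsub>C\<^esub> ?k = ?k"
    using k by (simp add: Id_one[symmetric] del: idt.hom_one)
  also have "g \<cdot>\<^bsub>C\<^esub> ?i = g" using g y by simp
  finally show ?thesis .
qed

text \<open>An Eckmann-Hilton argument: padding with the identity of 1, the interchange law turns
  the product of k and f into the composite of f after k. By \<open>Comp_eq\<close> at the object 1
  that composite is the product in the other order.\<close>

lemma commute:
  assumes k: "k \<in> Ar C" "Cod C k = \<one>\<^bsub>Obs\<^esub>" and f: "f \<in> Ar C" "Dom C f = \<one>\<^bsub>Obs\<^esub>"
  shows "k \<otimes>\<^bsub>Ars\<^esub> f = f \<otimes>\<^bsub>Ars\<^esub> k"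
proof -
  have 1: "\<one>\<^bsub>Ars\<^esub> \<in> Ar C" using Ar.one_closed by simp
  have "k \<otimes>\<^bsub>Ars\<^esub> f = (Id C \<one>\<^bsub>Obs\<^esub> \<cdot>\<^bsub>C\<^esub> k) \<otimes>\<^bsub>Ars\<^esub> (f \<cdot>\<^bsub>C\<^esub> Id C \<one>\<^bsub>Obs\<^esub>)"
    using k f by (simp del: idt.hom_one)
  also have "\<dots> = (\<one>\<^bsub>Ars\<^esub> \<otimes>\<^bsub>Ars\<^esub> f) \<cdot>\<^bsub>C\<^esub> (k \<otimes>\<^bsub>Ars\<^esub> \<one>\<^bsub>Ars\<^esub>)"
    unfolding Id_one using k f 1 by (intro interchange_law[symmetric]) auto
  also have "\<dots> = f \<cdot>\<^bsub>C\<^esub> k" using k f by simp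
  also have "\<dots> = f \<otimes>\<^bsub>Ars\<^esub> k"
    using k f Ar.one_closed by (simp add: Comp_eq)
  finally show ?thesis .
qed

text \<open>These are the arrows out of 1, which play the role of \<open>Pr \<one> e\<close> in
  \<open>G_cat\<close>; they form the kernel of the source homomorphism.\<close>

definition "kernel_dom = {a \<in> Ar C. Dom C a = \<one>\<^bsub>Obs\<^esub>}"

definition crossed_of :: "'u scrossed" where
  "crossed_of = \<lparr>HG = Obs,
     EG = \<lparr>carrier = kernel_dom,
           mult = (\<lambda>a b. if a \<in> kernel_dom \<and> b \<in> kernel_dom then a \<otimes>\<^bsub>Ars\<^esub> b else undefined),
           one = \<one>\<^bsub>Ars\<^esub>\<rparr>,
     bd = (\<lambda>e \<in> kernel_dom. Cod C e),
     act = (\<lambda>x e. if x \<in> Ob C \<and> e \<in> kernel_dom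
              then Id C x \<otimes>\<^bsub>Ars\<^esub> (e \<otimes>\<^bsub>Ars\<^esub> inv\<^bsub>Ars\<^esub> Id C x) else undefined)\<rparr>"

lemma normalized_crossed_of: "normalized_crossed crossed_of"
  by (simp add: normalized_crossed_def crossed_of_def) (auto simp: Obs_def)

lemmas closed = Ar.m_closed[simplified] Ar.inv_closed[simplified] Ob.m_closed[simplified]
    Ob.inv_closed[simplified]
  Ar.one_closed[simplified] Ob.one_closed[simplified] Dom_in Cod_in

lemmas ar_simps = closed Ar.m_assoc Ob.m_assoc Ar.inv_mult_group Ob.inv_mult_group
  dom.hom_mult[simplified] cod.hom_mult[simplified] idt.hom_mult[simplified]
  dom.hom_inv[simplified] cod.hom_inv[simplified] idt.hom_inv[simplified]

lemma kernel_dom_group: "group (EG crossed_of)"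
proof (rule groupI)
  show "\<exists>y \<in> carrier (EG crossed_of). y \<otimes>\<^bsub>EG crossed_of\<^esub> x = \<one>\<^bsub>EG crossed_of\<^esub>" if "x
      \<in> carrier (EG crossed_of)" for x
    using that by (intro bexI[of _ "inv\<^bsub>Ars\<^esub> x"]) (auto simp: crossed_of_def kernel_dom_def
        ar_simps)
qed (auto simp: crossed_of_def kernel_dom_def ar_simps)

lemma kernel_dom_inv: "e \<in> kernel_dom \<Longrightarrow> inv\<^bsub>EG crossed_of\<^esub> e = inv\<^bsub>Ars\<^esub> e"
  by (rule group.inv_equality[OF kernel_dom_group]) (auto simp: crossed_of_def kernel_dom_def
      ar_simps)

lemma conj_in_kernel_dom:
  "x \<in> Ob C \<Longrightarrow> e \<in> kernel_dom \<Longrightarrow> Id C x \<otimes>\<^bsub>Ars\<^esub> (e \<otimes>\<^bsub>Ars\<^esub> inv\<^bsub>Ars\<^esub> Id C x) \<in> kernel_dom"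
  by (simp add: kernel_dom_def ar_simps)

text \<open>The shape of the action of an inverse object after \<open>ar_simps\<close> has moved the
  inverse out of \<open>Id\<close>.\<close>

lemma conj_inv_in_kernel_dom:
  "x \<in> Ob C \<Longrightarrow> e \<in> kernel_dom \<Longrightarrow> inv\<^bsub>Ars\<^esub> Id C x \<otimes>\<^bsub>Ars\<^esub> (e \<otimes>\<^bsub>Ars\<^esub> Id C x) \<in> kernel_dom"
  by (simp add: kernel_dom_def ar_simps)

lemma kernel_dom_mult: "e \<in> kernel_dom \<Longrightarrow> f \<in> kernel_dom \<Longrightarrow> e \<otimes>\<^bsub>Ars\<^esub> f \<in> kernel_dom"
  by (simp add: kernel_dom_def ar_simps)

lemma kernel_dom_one: "\<one>\<^bsub>Ars\<^esub> \<in> kernel_dom"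
  by (simp add: kernel_dom_def ar_simps)

lemma kernel_dom_inv_in: "e \<in> kernel_dom \<Longrightarrow> inv\<^bsub>Ars\<^esub> e \<in> kernel_dom"
  by (simp add: kernel_dom_def ar_simps)

lemma kernel_dom_Ar: "e \<in> kernel_dom \<Longrightarrow> e \<in> Ar C"
  by (simp add: kernel_dom_def)

text \<open>Write e as the product of i, the identity of its target, and an arrow k into 1. By
  \<open>commute\<close> k commutes with f, so conjugating f by e is the same as conjugating it by
  i.\<close>

lemma peiffer:
  assumes e: "e \<in> kernel_dom" and f: "f \<in> kernel_dom"
  shows "Id C (Cod C e) \<otimes>\<^bsub>Ars\<^esub> (f \<otimes>\<^bsub>Ars\<^esub> inv\<^bsub>Ars\<^esub> Id C (Cod C e)) = e \<otimes>\<^bsub>Ars\<^esub> (f \<otimes>\<^bsub>Ars\<^esub> inv\<^bsub>Ars\<^esub> e)"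
proof -
  let ?i = "Id C (Cod C e)" and ?k = "inv\<^bsub>Ars\<^esub> Id C (Cod C e) \<otimes>\<^bsub>Ars\<^esub> e"
  have e': "e \<in> Ar C" and f': "f \<in> Ar C" "Dom C f = \<one>\<^bsub>Obs\<^esub>" using e f by (auto simp: kernel_dom_def)
  then have i: "?i \<in> Ar C" "Cod C e \<in> Ob C" using Cod_in by auto
  have k: "?k \<in> Ar C" "Cod C ?k = \<one>\<^bsub>Obs\<^esub>" using i e' by (simp_all add: ar_simps del: idt.hom_inv)
  have "e \<otimes>\<^bsub>Ars\<^esub> (f \<otimes>\<^bsub>Ars\<^esub> inv\<^bsub>Ars\<^esub> e) = (?i \<otimes>\<^bsub>Ars\<^esub> ?k) \<otimes>\<^bsub>Ars\<^esub> (f \<otimes>\<^bsub>Ars\<^esub> inv\<^bsub>Ars\<^esub> (?i \<otimes>\<^bsub>Ars\<^esub> ?k))"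
    using i e' by simp
  also have "\<dots> = ?i \<otimes>\<^bsub>Ars\<^esub> ((?k \<otimes>\<^bsub>Ars\<^esub> f) \<otimes>\<^bsub>Ars\<^esub> inv\<^bsub>Ars\<^esub> ?k) \<otimes>\<^bsub>Ars\<^esub> inv\<^bsub>Ars\<^esub> ?i"
    using i k(1) f' by (simp add: Ar.inv_mult_group[of ?i ?k] Ar.m_assoc closed)
  also have "(?k \<otimes>\<^bsub>Ars\<^esub> f) \<otimes>\<^bsub>Ars\<^esub> inv\<^bsub>Ars\<^esub> ?k = f"
    unfolding commute[OF k f'] using k f' by (simp add: Ar.m_assoc closed)
  finally show ?thesis using i f' by (simp add: Ar.m_assoc closed)
qed

lemma crossed_module_crossed_of: "crossed_module crossed_of"
proof -
  have sel: "HG crossed_of = Obs" "carrier (EG crossed_of) = kernel_dom"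
    "\<And>e f. e \<in> kernel_dom \<Longrightarrow> f \<in> kernel_dom \<Longrightarrow> e \<otimes>\<^bsub>EG crossed_of\<^esub> f = e \<otimes>\<^bsub>Ars\<^esub> f"
    "\<And>e. e \<in> kernel_dom \<Longrightarrow> bd crossed_of e = Cod C e"
    "\<And>x e. x \<in> Ob C \<Longrightarrow> e \<in> kernel_dom \<Longrightarrow>
       act crossed_of x e = Id C x \<otimes>\<^bsub>Ars\<^esub> (e \<otimes>\<^bsub>Ars\<^esub> inv\<^bsub>Ars\<^esub> Id C x)"
    by (simp_all add: crossed_of_def)
  note r = sel kernel_dom_one kernel_dom_inv_in kernel_dom_Ar kernel_dom_mult conj_in_kernel_dom
      conj_inv_in_kernel_dom ar_simps kernel_dom_inv
  have iso: "act crossed_of x \<in> iso (EG crossed_of) (EG crossed_of)" if x: "x \<in> Ob C" for x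
  proof -
    have "act crossed_of x \<in> hom (EG crossed_of) (EG crossed_of)"
      using x by (auto simp: hom_def r)
    moreover have "bij_betw (act crossed_of x) kernel_dom kernel_dom"
      \<comment> \<open>Conjugation by an identity arrow is undone by conjugation with the identity
        of the inverse object.\<close>
      by (rule bij_betw_byWitness[where f' = "act crossed_of (inv\<^bsub>Obs\<^esub> x)"])
        (use x in \<open>auto simp: r\<close>)
    ultimately show ?thesis by (simp add: iso_def sel)
  qed
  have bd: "bd crossed_of \<in> hom (EG crossed_of) Obs"
    by (auto simp: hom_def r)
  show ?thesis
    unfolding crossed_module_def
    using iso bd by (auto simp: kernel_dom_group r Ob.group_axioms peiffer)
qed

text \<open>The semidirect decomposition of the group of arrows: an arrow a with source x factors
  uniquely as an arrow out of 1 times the identity of x. \<open>Pr\<close> records x and the first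
  factor.\<close>

definition to_G_hopf :: "('u scat, 'u sfunctr) mor" where
  "to_G_hopf = \<lparr>Src = C, Tgt = G_cat crossed_of,
     Dat = \<lparr>FOb = (\<lambda>x \<in> Ob C. x),
            FAr = (\<lambda>a \<in> Ar C. Pr (Dom C a) (a \<otimes>\<^bsub>Ars\<^esub> inv\<^bsub>Ars\<^esub> Id C (Dom C a)))\<rparr>\<rparr>"

definition of_G_hopf :: "('u scat, 'u sfunctr) mor" where
  "of_G_hopf = \<lparr>Src = G_cat crossed_of, Tgt = C,
     Dat = \<lparr>FOb = (\<lambda>x \<in> Ob C. x),
            FAr = (\<lambda>p \<in> Ar (G_cat crossed_of). pr2 p \<otimes>\<^bsub>Ars\<^esub> Id C (pr1 p))\<rparr>\<rparr>"

text \<open>By \<open>Comp_eq\<close> the identity of the middle object splits a composite into the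
  product of the two first factors, so composition is preserved. For the product of a and b, moving
  the identity of the source of a past the first factor of b creates the conjugation that is the
  action.\<close>

lemma hopf_iso_to_G_hopf: "hopf_iso CAT (cat_bialg C m u) (G_hopf crossed_of) to_G_hopf"
proof -
  have sel: "HG crossed_of = Obs" "carrier (EG crossed_of) = kernel_dom"
    "\<And>e f. e \<in> kernel_dom \<Longrightarrow> f \<in> kernel_dom \<Longrightarrow> e \<otimes>\<^bsub>EG crossed_of\<^esub> f = e \<otimes>\<^bsub>Ars\<^esub> f"
    "\<And>e. e \<in> kernel_dom \<Longrightarrow> bd crossed_of e = Cod C e"
    "\<And>x e. x \<in> Ob C \<Longrightarrow> e \<in> kernel_dom \<Longrightarrow>
       act crossed_of x e = Id C x \<otimes>\<^bsub>Ars\<^esub> (e \<otimes>\<^bsub>Ars\<^esub> inv\<^bsub>Ars\<^esub> Id C x)"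
    "\<one>\<^bsub>EG crossed_of\<^esub> = \<one>\<^bsub>Ars\<^esub>"
    by (simp_all add: crossed_of_def)
  have kd: "a \<otimes>\<^bsub>Ars\<^esub> inv\<^bsub>Ars\<^esub> Id C x \<in> kernel_dom" if "a \<in> Ar C" "Dom C a = x" for a x
    using that by (auto simp: kernel_dom_def ar_simps)
  \<comment> \<open>The right-nested form in which the action on the first factor of b appears; the
    guarded product of \<open>crossed_of\<close> computes only on members of
    \<open>kernel_dom\<close>.\<close>
  have kd2: "Id C x \<otimes>\<^bsub>Ars\<^esub> (b \<otimes>\<^bsub>Ars\<^esub> (inv\<^bsub>Ars\<^esub> Id C (Dom C b) \<otimes>\<^bsub>Ars\<^esub> inv\<^bsub>Ars\<^esub> Id C x)) \<in> kernel_dom"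
    if "x \<in> Ob C" "b \<in> Ar C" for x b
    using that by (simp add: kernel_dom_def ar_simps)
  have kd': "\<And>e. e \<in> kernel_dom \<Longrightarrow> Dom C e = \<one>\<^bsub>Obs\<^esub>" by (simp add: kernel_dom_def)
  note r = sel kernel_dom_one kernel_dom_inv_in kernel_dom_Ar kernel_dom_mult conj_in_kernel_dom
      ar_simps kd kd' Comp_simps
  have F: "is_functor C (G_cat crossed_of) (Dat to_G_hopf)"
    unfolding is_functor_iff
    by (auto simp: to_G_hopf_def r Comp_eq)
  have G: "is_functor (G_cat crossed_of) C (Dat of_G_hopf)"
    unfolding is_functor_iff
    by (auto simp: of_G_hopf_def r Comp_eq)
  have "inverse_pair CAT to_G_hopf of_G_hopf"
    unfolding inverse_pair_CAT using F G
    by (auto simp: to_G_hopf_def of_G_hopf_def in_homs_CAT cat norm normalized_G_cat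
        category_G_cat[OF crossed_module_crossed_of] r)
  moreover have "monoid_functor C m u (G_mul crossed_of) (G_un crossed_of) (Dat to_G_hopf)"
  proof -
    have "FOb m (Pr x y) = x \<otimes>\<^bsub>Obs\<^esub> y" if "x \<in> Ob C" "y \<in> Ob C" for x y using that
        by (simp add: Obs_def)
    moreover have "FAr m (Pr x y) = x \<otimes>\<^bsub>Ars\<^esub> y" for x y by (simp add: Ars_def)
    moreover have "FOb u Star = \<one>\<^bsub>Obs\<^esub>" "FAr u Star = \<one>\<^bsub>Ars\<^esub>" by (simp_all add: Obs_def Ars_def)
    ultimately show ?thesis
      unfolding monoid_functor_def by (auto simp: to_G_hopf_def r kd2)
  qed
  moreover have "to_G_hopf \<in> homs CAT C (G_cat crossed_of)"
    using F by (simp add: to_G_hopf_def in_homs_CAT cat norm normalized_G_cat category_G_cat[OF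
        crossed_module_crossed_of])
  ultimately show ?thesis
    unfolding G_hopf_eq
    by (subst hopf_iso_cat_bialg_iff)
      (auto simp: cat norm normalized_G_cat category_G_cat is_functor_G_un
          crossed_module_crossed_of invertible_def)
qed

end

section \<open>Uniqueness of antipodes\<close>

context symmetric_monoidal_category
begin

lemma in_homs_iff: "f \<in> homs S X Y \<longleftrightarrow> f \<in> Ar S \<and> Dom S f = X \<and> Cod S f = Y"
  by (simp add: homs_def)

text \<open>Typing by membership in \<open>Ar\<close> and equations for \<open>Dom\<close> and
  \<open>Cod\<close>: with these facts as rewrite rules, simplification discharges the side
  conditions of associativity by itself.\<close>

lemma Comp_Ar:
  assumes "f \<in> Ar S" "g \<in> Ar S" "Dom S g = Cod S f"
  shows "g \<cdot> f \<in> Ar S" "Dom S (g \<cdot> f) = Dom S f" "Cod S (g \<cdot> f) = Cod S g"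
  using Comp_in[of f "Dom S f" "Cod S f" g "Cod S g"] assms by (auto simp: in_homs_iff)

lemma Comp_assoc_Ar:
  "\<lbrakk>f \<in> Ar S; g \<in> Ar S; h \<in> Ar S; Dom S g = Cod S f; Dom S h = Cod S g\<rbrakk> \<Longrightarrow> (h \<cdot> g) \<cdot> f = h \<cdot> (g \<cdot> f)"
  using Comp_assoc[of f "Dom S f" "Cod S f" g "Cod S g" h "Cod S h"] by (auto simp: in_homs_iff)

lemma tarr_Ar:
  assumes "f \<in> Ar S" "g \<in> Ar S"
  shows "f \<odot> g \<in> Ar S" "Dom S (f \<odot> g) = Dom S f \<boxtimes> Dom S g" "Cod S (f \<odot> g) = Cod S f \<boxtimes> Cod S g"
  using tarr_in[of f "Dom S f" "Cod S f" g "Dom S g" "Cod S g"] assms by (auto simp: in_homs_iff)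

lemma tarr_Comp_Ar:
  "\<lbrakk>f \<in> Ar S; g \<in> Ar S; f' \<in> Ar S; g' \<in> Ar S; Dom S g = Cod S f; Dom S g' = Cod S f'\<rbrakk>
    \<Longrightarrow> (g \<odot> g') \<cdot> (f \<odot> f') = (g \<cdot> f) \<odot> (g' \<cdot> f')"
  using tarr_Comp[of f "Dom S f" "Cod S f" g "Cod S g" f' "Dom S f'" "Cod S f'" g' "Cod S g'"]
  by (auto simp: in_homs_iff)

text \<open>In a right-nested composite two tensor factors are adjacent only up to a tail k; this
  version fuses them in front of the tail.\<close>

lemma tarr_Comp_Ar2:
  "\<lbrakk>f \<in> Ar S; g \<in> Ar S; f' \<in> Ar S; g' \<in> Ar S; Dom S g = Cod S f; Dom S g' = Cod S f';
    k \<in> Ar S; Cod S k = Dom S f \<boxtimes> Dom S f'\<rbrakk>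
    \<Longrightarrow> (g \<odot> g') \<cdot> ((f \<odot> f') \<cdot> k) = ((g \<cdot> f) \<odot> (g' \<cdot> f')) \<cdot> k"
  by (subst Comp_assoc_Ar[symmetric]) (auto simp: tarr_Ar tarr_Comp_Ar)

lemma Id_Ar: "X \<in> Ob S \<Longrightarrow> Id S X \<in> Ar S" "X \<in> Ob S \<Longrightarrow> Dom S (Id S X) = X" "X \<in> Ob S \<Longrightarrow> Cod S (Id S X)
    = X"
  using Id_in[of X] by (auto simp: in_homs_iff)

lemma Id_Comp_Ar: "f \<in> Ar S \<Longrightarrow> Id S (Cod S f) \<cdot> f = f" "f \<in> Ar S \<Longrightarrow> f \<cdot> Id S (Dom S f) = f"
  using Id_left[of f "Dom S f" "Cod S f"] Id_right[of f "Dom S f" "Cod S f"]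
      by (auto simp: in_homs_iff)

end

lemma hopf_chi_algebraD:
  assumes "hopf_chi_algebra S X A"
  shows "\<And>x. x \<in> carrier (HG X) \<Longrightarrow> coalgebra S (Coa A x)"
    and "\<And>x y. x \<in> carrier (HG X) \<Longrightarrow> y \<in> carrier (HG X) \<Longrightarrow>
      coalg_mor S (tensor_coalg S (Coa A x) (Coa A y)) (Coa A (x \<otimes>\<^bsub>HG X\<^esub> y)) (mu A x y)"
    and "coalg_mor S (unit_coalg S) (Coa A \<one>\<^bsub>HG X\<^esub>) (eta A)"
    and "\<And>x. x \<in> carrier (HG X) \<Longrightarrow> anti A x \<in> homs S (Crr (Coa A x)) (Crr (Coa A (inv\<^bsub>HG X\<^esub> x)))"
    and "\<And>x. x \<in> carrier (HG X) \<Longrightarrow> invertible S (anti A x)"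
    and "\<And>x e. x \<in> carrier (HG X) \<Longrightarrow> e \<in> carrier (EG X) \<Longrightarrow>
      coalg_mor S (Coa A x) (Coa A (bd X e \<otimes>\<^bsub>HG X\<^esub> x)) (phi A x e)"
    and "\<And>x e. x \<in> carrier (HG X) \<Longrightarrow> e \<in> carrier (EG X) \<Longrightarrow> invertible S (phi A x e)"
    and "\<And>x y z. x \<in> carrier (HG X) \<Longrightarrow> y \<in> carrier (HG X) \<Longrightarrow> z \<in> carrier (HG X) \<Longrightarrow>
      mu A (x \<otimes>\<^bsub>HG X\<^esub> y) z \<cdot>\<^bsub>S\<^esub> (mu A x y \<odot>\<^bsub>S\<^esub> Id S (Crr (Coa A z)))
      = mu A x (y \<otimes>\<^bsub>HG X\<^esub> z) \<cdot>\<^bsub>S\<^esub> (Id S (Crr (Coa A x)) \<odot>\<^bsub>S\<^esub> mu A y z)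
        \<cdot>\<^bsub>S\<^esub> assoc S (Crr (Coa A x)) (Crr (Coa A y)) (Crr (Coa A z))"
    and "\<And>x. x \<in> carrier (HG X) \<Longrightarrow>
      mu A x \<one>\<^bsub>HG X\<^esub> \<cdot>\<^bsub>S\<^esub> (Id S (Crr (Coa A x)) \<odot>\<^bsub>S\<^esub> eta A) = runit S (Crr (Coa A x))"
    and "\<And>x. x \<in> carrier (HG X) \<Longrightarrow>
      mu A \<one>\<^bsub>HG X\<^esub> x \<cdot>\<^bsub>S\<^esub> (eta A \<odot>\<^bsub>S\<^esub> Id S (Crr (Coa A x))) = lunit S (Crr (Coa A x))"
    and "\<And>x. x \<in> carrier (HG X) \<Longrightarrow>
      mu A (inv\<^bsub>HG X\<^esub> x) x \<cdot>\<^bsub>S\<^esub> (anti A x \<odot>\<^bsub>S\<^esub> Id S (Crr (Coa A x))) \<cdot>\<^bsub>S\<^esub> Cmul (Coa A x)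
      = eta A \<cdot>\<^bsub>S\<^esub> Cun (Coa A x)"
    and "\<And>x. x \<in> carrier (HG X) \<Longrightarrow>
      mu A x (inv\<^bsub>HG X\<^esub> x) \<cdot>\<^bsub>S\<^esub> (Id S (Crr (Coa A x)) \<odot>\<^bsub>S\<^esub> anti A x) \<cdot>\<^bsub>S\<^esub> Cmul (Coa A x)
      = eta A \<cdot>\<^bsub>S\<^esub> Cun (Coa A x)"
    and "\<And>x. x \<in> carrier (HG X) \<Longrightarrow> phi A x \<one>\<^bsub>EG X\<^esub> = Id S (Crr (Coa A x))"
    and "\<And>x e f. x \<in> carrier (HG X) \<Longrightarrow> e \<in> carrier (EG X) \<Longrightarrow> f \<in> carrier (EG X) \<Longrightarrow>
      phi A (bd X e \<otimes>\<^bsub>HG X\<^esub> x) f \<cdot>\<^bsub>S\<^esub> phi A x e = phi A x (f \<otimes>\<^bsub>EG X\<^esub> e)"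
    and "\<And>x y e f. x \<in> carrier (HG X) \<Longrightarrow> y \<in> carrier (HG X) \<Longrightarrow> e \<in> carrier (EG X) \<Longrightarrow> f
        \<in> carrier (EG X) \<Longrightarrow>
      mu A (bd X e \<otimes>\<^bsub>HG X\<^esub> x) (bd X f \<otimes>\<^bsub>HG X\<^esub> y) \<cdot>\<^bsub>S\<^esub> (phi A x e \<odot>\<^bsub>S\<^esub> phi A y f)
      = phi A (x \<otimes>\<^bsub>HG X\<^esub> y) (e \<otimes>\<^bsub>EG X\<^esub> act X x f) \<cdot>\<^bsub>S\<^esub> mu A x y"
  using assms unfolding hopf_chi_algebra_def Let_def by simp_all

context symmetric_monoidal_category
begin

lemma coalg_morD:
  assumes "coalg_mor S A B f"
  shows "f \<in> Ar S" "Dom S f = Crr A" "Cod S f = Crr B"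
    "Cmul B \<cdot> f = (f \<odot> f) \<cdot> Cmul A" "Cun B \<cdot> f = Cun A"
  using assms by (auto simp: coalg_mor_def in_homs_iff)

lemma coalgebraD:
  assumes "coalgebra S A"
  shows "Crr A \<in> Ob S" "Cmul A \<in> Ar S" "Dom S (Cmul A) = Crr A" "Cod S (Cmul A) = Crr A \<boxtimes> Crr A"
    "Cun A \<in> Ar S" "Dom S (Cun A) = Crr A" "Cod S (Cun A) = tunit S"
  using assms by (auto simp: coalgebra_def in_homs_iff)

text \<open>Both \<open>g\<close> and \<open>g'\<close> equal the double convolution \<open>g * f * g'\<close>.\<close>

lemma convolution_inverse_unique:
  assumes X: "crossed_module X" and A: "hopf_chi_algebra S X A" and K: "coalgebra S K"
    and y: "y \<in> carrier (HG X)"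
    and f: "f \<in> homs S (Crr K) (Crr (Coa A y))"
    and g: "g \<in> homs S (Crr K) (Crr (Coa A (inv\<^bsub>HG X\<^esub> y)))"
    and g': "g' \<in> homs S (Crr K) (Crr (Coa A (inv\<^bsub>HG X\<^esub> y)))"
    and gf: "mu A (inv\<^bsub>HG X\<^esub> y) y \<cdot> (g \<odot> f) \<cdot> Cmul K = eta A \<cdot> Cun K"
    and fg': "mu A y (inv\<^bsub>HG X\<^esub> y) \<cdot> (f \<odot> g') \<cdot> Cmul K = eta A \<cdot> Cun K"
  shows "g = g'"
proof -
  interpret crossed X by unfold_locales (rule X)
  let ?y = "inv\<^bsub>H\<^esub> y" and ?c = "Crr K" and ?b = "Crr (Coa A y)" and ?b' = "Crr (Coa A (inv\<^bsub>H\<^esub> y))"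
  let ?\<Delta> = "Cmul K" and ?\<epsilon> = "Cun K"
  have y': "?y \<in> carrier H" using y by simp
  note D = hopf_chi_algebraD[OF A]
  note K' = coalgebraD[OF K]
  have ob: "?b \<in> Ob S" "?b' \<in> Ob S" "Crr (Coa A \<one>\<^bsub>H\<^esub>) \<in> Ob S"
    using D(1)[OF y] D(1)[OF y'] D(1)[OF H.one_closed] by (auto simp: coalgebra_def)
  have fg: "f \<in> Ar S" "Dom S f = ?c" "Cod S f = ?b" "g \<in> Ar S" "Dom S g = ?c" "Cod S g = ?b'"
    "g' \<in> Ar S" "Dom S g' = ?c" "Cod S g' = ?b'"
    using f g g' by (auto simp: in_homs_iff)
  have mu: "mu A x z \<in> Ar S" "Dom S (mu A x z) = Crr (Coa A x) \<boxtimes> Crr (Coa A z)"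
    "Cod S (mu A x z) = Crr (Coa A (x \<otimes>\<^bsub>H\<^esub> z))" if "x \<in> carrier H" "z \<in> carrier H" for x z
    using coalg_morD[OF D(2)[OF that]] by (auto simp: tensor_coalg_def)
  have et: "eta A \<in> Ar S" "Dom S (eta A) = tunit S" "Cod S (eta A) = Crr (Coa A \<one>\<^bsub>H\<^esub>)"
    using coalg_morD[OF D(3)] by (auto simp: unit_coalg_def)
  have ru: "runit S x \<in> Ar S" "Dom S (runit S x) = x \<boxtimes> tunit S" "Cod S (runit S x) = x"
    and lu: "lunit S x \<in> Ar S" "Dom S (lunit S x) = tunit S \<boxtimes> x" "Cod S (lunit S x) = x"
    if "x \<in> Ob S" for x using runit_in[OF that] lunit_in[OF that] by (auto simp: in_homs_iff)
  have as: "assoc S a b c \<in> Ar S" "Dom S (assoc S a b c) = (a \<boxtimes> b) \<boxtimes> c" "Cod S (assoc S a b c)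
      = a \<boxtimes> (b \<boxtimes> c)"
    if "a \<in> Ob S" "b \<in> Ob S" "c \<in> Ob S" for a b c
    using assoc_in[OF that] by (auto simp: in_homs_iff)
  note T = fg mu[OF y y'] mu[OF y' y] mu[OF y' H.one_closed] mu[OF H.one_closed y'] et ru[OF
      K'(1)] lu[OF K'(1)]
    ru[OF ob(2)] lu[OF ob(2)]
    as[OF K'(1) K'(1) K'(1)] as[OF ob(2,1,2)] K' ob tunit_in Comp_Ar tarr_Ar Id_Ar y y'
  have Idr: "g \<cdot> Id S ?c = g" "Id S ?b' \<cdot> g = g" "g' \<cdot> Id S ?c = g'" "Id S ?b' \<cdot> g' = g'"
    "Id S (tunit S) \<cdot> ?\<epsilon> = ?\<epsilon>" "?\<epsilon> \<cdot> Id S ?c = ?\<epsilon>"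
    using Id_Comp_Ar[of g] Id_Comp_Ar[of g'] Id_Comp_Ar[of ?\<epsilon>] T by auto
  \<comment> \<open>Convolution with the unit \<eta>\<epsilon> on the right is trivial: the unit law
    of A produces \<open>runit\<close>, its naturality moves g out, and the counit law of K removes
    the rest. The next fact is the mirror image.\<close>
  have g_eq: "mu A ?y \<one>\<^bsub>H\<^esub> \<cdot> (g \<odot> (eta A \<cdot> ?\<epsilon>)) \<cdot> ?\<Delta> = g"
  proof -
    have "g \<odot> (eta A \<cdot> ?\<epsilon>) = (Id S ?b' \<odot> eta A) \<cdot> (g \<odot> ?\<epsilon>)"
      by (subst tarr_Comp_Ar) (simp_all add: T Idr)
    moreover have "g \<odot> ?\<epsilon> = (g \<odot> Id S (tunit S)) \<cdot> (Id S ?c \<odot> ?\<epsilon>)"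
      by (subst tarr_Comp_Ar) (simp_all add: T Idr)
    ultimately have "mu A ?y \<one>\<^bsub>H\<^esub> \<cdot> (g \<odot> (eta A \<cdot> ?\<epsilon>)) \<cdot> ?\<Delta>
      = (mu A ?y \<one>\<^bsub>H\<^esub> \<cdot> (Id S ?b' \<odot> eta A)) \<cdot> ((g \<odot> Id S (tunit S)) \<cdot> ((Id S ?c \<odot> ?\<epsilon>) \<cdot> ?\<Delta>))"
      by (simp add: T Comp_assoc_Ar)
    also have "\<dots> = (runit S ?b' \<cdot> (g \<odot> Id S (tunit S))) \<cdot> ((Id S ?c \<odot> ?\<epsilon>) \<cdot> ?\<Delta>)"
      using D(9)[OF y'] by (simp add: T Comp_assoc_Ar)
    also have "\<dots> = g \<cdot> (runit S ?c \<cdot> ((Id S ?c \<odot> ?\<epsilon>) \<cdot> ?\<Delta>))"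
      unfolding runit_nat[OF g] by (simp add: T Comp_assoc_Ar)
    also have "runit S ?c \<cdot> ((Id S ?c \<odot> ?\<epsilon>) \<cdot> ?\<Delta>) = Id S ?c"
      using K by (simp add: coalgebra_def)
    finally show ?thesis by (simp add: Idr)
  qed
  have g'_eq: "mu A \<one>\<^bsub>H\<^esub> ?y \<cdot> ((eta A \<cdot> ?\<epsilon>) \<odot> g') \<cdot> ?\<Delta> = g'"
  proof -
    have "(eta A \<cdot> ?\<epsilon>) \<odot> g' = (eta A \<odot> Id S ?b') \<cdot> (?\<epsilon> \<odot> g')"
      by (subst tarr_Comp_Ar) (simp_all add: T Idr)
    moreover have "?\<epsilon> \<odot> g' = (Id S (tunit S) \<odot> g') \<cdot> (?\<epsilon> \<odot> Id S ?c)"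
      by (subst tarr_Comp_Ar) (simp_all add: T Idr)
    ultimately have "mu A \<one>\<^bsub>H\<^esub> ?y \<cdot> ((eta A \<cdot> ?\<epsilon>) \<odot> g') \<cdot> ?\<Delta>
      = (mu A \<one>\<^bsub>H\<^esub> ?y \<cdot> (eta A \<odot> Id S ?b')) \<cdot> ((Id S (tunit S) \<odot> g') \<cdot> ((?\<epsilon> \<odot> Id S ?c) \<cdot> ?\<Delta>))"
      by (simp add: T Comp_assoc_Ar)
    also have "\<dots> = (lunit S ?b' \<cdot> (Id S (tunit S) \<odot> g')) \<cdot> ((?\<epsilon> \<odot> Id S ?c) \<cdot> ?\<Delta>)"
      using D(10)[OF y'] by (simp add: T Comp_assoc_Ar)
    also have "\<dots> = g' \<cdot> (lunit S ?c \<cdot> ((?\<epsilon> \<odot> Id S ?c) \<cdot> ?\<Delta>))"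
      unfolding lunit_nat[OF g'] by (simp add: T Comp_assoc_Ar)
    also have "lunit S ?c \<cdot> ((?\<epsilon> \<odot> Id S ?c) \<cdot> ?\<Delta>) = Id S ?c"
      using K by (simp add: coalgebra_def)
    finally show ?thesis by (simp add: Idr)
  qed
  \<comment> \<open>The factor \<eta>\<epsilon> is replaced by f * g'. Coassociativity of K,
    naturality of \<open>assoc\<close> and associativity of \<open>mu\<close> then regroup g * (f *
    g') as (g * f) * g', where g * f is the unit again.\<close>
  have "mu A ?y \<one>\<^bsub>H\<^esub> \<cdot> (g \<odot> (eta A \<cdot> ?\<epsilon>)) \<cdot> ?\<Delta>
    = mu A ?y \<one>\<^bsub>H\<^esub> \<cdot> ((Id S ?b' \<odot> mu A y ?y) \<cdot> ((g \<odot> (f \<odot> g')) \<cdot> ((Id S ?c \<odot> ?\<Delta>) \<cdot> ?\<Delta>)))"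
    unfolding fg'[symmetric] using y by (simp add: T Comp_assoc_Ar tarr_Comp_Ar2 Idr)
  also have "(Id S ?c \<odot> ?\<Delta>) \<cdot> ?\<Delta> = assoc S ?c ?c ?c \<cdot> ((?\<Delta> \<odot> Id S ?c) \<cdot> ?\<Delta>)"
    using K by (simp add: coalgebra_def)
  also have "(g \<odot> (f \<odot> g')) \<cdot> (assoc S ?c ?c ?c \<cdot> ((?\<Delta> \<odot> Id S ?c) \<cdot> ?\<Delta>))
    = ((g \<odot> (f \<odot> g')) \<cdot> assoc S ?c ?c ?c) \<cdot> ((?\<Delta> \<odot> Id S ?c) \<cdot> ?\<Delta>)"
    by (simp add: T Comp_assoc_Ar)
  also have "(g \<odot> (f \<odot> g')) \<cdot> assoc S ?c ?c ?c = assoc S ?b' ?b ?b' \<cdot> ((g \<odot> f) \<odot> g')"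
    by (rule assoc_nat[OF g f g', symmetric])
  also have "mu A ?y \<one>\<^bsub>H\<^esub> \<cdot> ((Id S ?b' \<odot> mu A y ?y) \<cdot> ((assoc S ?b' ?b ?b' \<cdot> ((g \<odot> f) \<odot> g'))
      \<cdot> ((?\<Delta> \<odot> Id S ?c) \<cdot> ?\<Delta>)))
    = (mu A ?y \<one>\<^bsub>H\<^esub> \<cdot> (Id S ?b' \<odot> mu A y ?y) \<cdot> assoc S ?b' ?b ?b') \<cdot> (((g \<odot> f) \<odot> g')
        \<cdot> ((?\<Delta> \<odot> Id S ?c) \<cdot> ?\<Delta>))"
    by (simp add: T Comp_assoc_Ar)
  also have "mu A ?y \<one>\<^bsub>H\<^esub> \<cdot> (Id S ?b' \<odot> mu A y ?y) \<cdot> assoc S ?b' ?b ?b' = mu A \<one>\<^bsub>H\<^esub> ?y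
      \<cdot> (mu A ?y y \<odot> Id S ?b')"
    using D(8)[OF y' y y'] y by simp
  also have "(mu A \<one>\<^bsub>H\<^esub> ?y \<cdot> (mu A ?y y \<odot> Id S ?b')) \<cdot> (((g \<odot> f) \<odot> g') \<cdot> ((?\<Delta> \<odot> Id S ?c) \<cdot> ?\<Delta>))
    = mu A \<one>\<^bsub>H\<^esub> ?y \<cdot> ((mu A ?y y \<cdot> (g \<odot> f) \<cdot> ?\<Delta>) \<odot> g') \<cdot> ?\<Delta>"
    using y by (simp add: T Comp_assoc_Ar tarr_Comp_Ar2 Idr)
  finally show ?thesis unfolding gf using g_eq g'_eq by simp
qed

text \<open>A coalgebra morphism f pulls the antipode law of A back along itself, so composing the
  antipode with f gives a right convolution inverse of f; any left inverse g equals it. The cases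
  needed are f = \<phi>, f an isomorphism of fibres, and f an identity.\<close>

lemma antipode_unique:
  assumes X: "crossed_module X" and A: "hopf_chi_algebra S X A" and K: "coalgebra S K"
    and y: "y \<in> carrier (HG X)"
    and f: "coalg_mor S K (Coa A y) f"
    and g: "g \<in> homs S (Crr K) (Crr (Coa A (inv\<^bsub>HG X\<^esub> y)))"
    and gf: "mu A (inv\<^bsub>HG X\<^esub> y) y \<cdot> (g \<odot> f) \<cdot> Cmul K = eta A \<cdot> Cun K"
  shows "g = anti A y \<cdot> f"
proof (rule convolution_inverse_unique[OF X A K y _ g _ gf])
  interpret crossed X by unfold_locales (rule X)
  note D = hopf_chi_algebraD[OF A]
  note f' = coalg_morD[OF f] and K' = coalgebraD[OF K] and Y = coalgebraD[OF D(1)[OF y]]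
  have s: "anti A y \<in> Ar S" "Dom S (anti A y) = Crr (Coa A y)" "Cod S (anti A y)
      = Crr (Coa A (inv\<^bsub>H\<^esub> y))"
    using D(4)[OF y] by (auto simp: in_homs_iff)
  have mu: "mu A y (inv\<^bsub>H\<^esub> y) \<in> Ar S" "Dom S (mu A y (inv\<^bsub>H\<^esub> y))
      = Crr (Coa A y) \<boxtimes> Crr (Coa A (inv\<^bsub>H\<^esub> y))"
    using coalg_morD[OF D(2)[OF y H.inv_closed[OF y]]] by (auto simp: tensor_coalg_def)
  have et: "eta A \<in> Ar S" "Dom S (eta A) = tunit S"
    using coalg_morD[OF D(3)] by (auto simp: unit_coalg_def)
  note T = f'(1-3) K' Y s mu et Comp_Ar tarr_Ar Id_Ar
  show "f \<in> homs S (Crr K) (Crr (Coa A y))" using f' by (simp add: in_homs_iff)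
  show "anti A y \<cdot> f \<in> homs S (Crr K) (Crr (Coa A (inv\<^bsub>H\<^esub> y)))" by (simp add: T in_homs_iff)
  have "f \<odot> (anti A y \<cdot> f) = (Id S (Crr (Coa A y)) \<odot> anti A y) \<cdot> (f \<odot> f)"
    using Id_Comp_Ar[of f] by (subst tarr_Comp_Ar) (simp_all add: T)
  then have "mu A y (inv\<^bsub>H\<^esub> y) \<cdot> (f \<odot> (anti A y \<cdot> f)) \<cdot> Cmul K
    = mu A y (inv\<^bsub>H\<^esub> y) \<cdot> (Id S (Crr (Coa A y)) \<odot> anti A y) \<cdot> ((f \<odot> f) \<cdot> Cmul K)"
    by (simp add: T Comp_assoc_Ar)
  also have "\<dots> = (mu A y (inv\<^bsub>H\<^esub> y) \<cdot> (Id S (Crr (Coa A y)) \<odot> anti A y) \<cdot> Cmul (Coa A y)) \<cdot> f"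
    unfolding f'(4)[symmetric] by (simp add: T Comp_assoc_Ar)
  also have "\<dots> = eta A \<cdot> (Cun (Coa A y) \<cdot> f)"
    unfolding D(12)[OF y] by (simp add: T Comp_assoc_Ar)
  finally show "mu A y (inv\<^bsub>H\<^esub> y) \<cdot> (f \<odot> (anti A y \<cdot> f)) \<cdot> Cmul K = eta A \<cdot> Cun K"
    by (simp add: f'(5))
qed

end

section \<open>Hopf \<open>\<chi>\<close>-algebras and Hopf algebras in \<open>\<F>(\<S>)\<close>\<close>

lemma functor_Comp:
  "is_functor C D F \<Longrightarrow> f \<in> Ar C \<Longrightarrow> g \<in> Ar C \<Longrightarrow> Dom C g = Cod C f
    \<Longrightarrow> FAr F (g \<cdot>\<^bsub>C\<^esub> f) = FAr F g \<cdot>\<^bsub>D\<^esub> FAr F f"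
  by (auto simp: is_functor_iff)

lemma functor_inverse_pair:
  assumes F: "is_functor C D F" and fg: "inverse_pair C f g" and C: "category C"
  shows "inverse_pair D (FAr F f) (FAr F g)"
proof -
  have f: "f \<in> Ar C" "g \<in> Ar C" "Dom C g = Cod C f" "Cod C g = Dom C f"
    "g \<cdot>\<^bsub>C\<^esub> f = Id C (Dom C f)" "f \<cdot>\<^bsub>C\<^esub> g = Id C (Cod C f)" "Dom C f \<in> Ob C" "Cod C f \<in> Ob C"
    using fg C by (auto simp: inverse_pair_def homs_def category.Dom_in category.Cod_in)
  then show ?thesis
    using functor_Comp[OF F f(1-3)] functor_Comp[OF F f(2,1) f(4)[symmetric]]
    by (simp add: inverse_pair_def homs_def functor_in[OF F])
qed

text \<open>\<open>G_cat X\<close> is a groupoid. Hence the arrows \<phi> of a transported algebra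
  are invertible by functoriality alone.\<close>

lemma inverse_pair_G_cat:
  assumes "crossed_module X" "x \<in> carrier (HG X)" "e \<in> carrier (EG X)"
  shows "inverse_pair (G_cat X) (Pr x e) (Pr (bd X e \<otimes>\<^bsub>HG X\<^esub> x) (inv\<^bsub>EG X\<^esub> e))"
proof -
  interpret crossed X by unfold_locales (rule assms)
  show ?thesis using assms by (simp add: inverse_pair_def homs_def)
qed

lemma FA_obj_sel [simp]:
  "fst (FA_obj X A) = G_cat X"
  "x \<in> carrier (HG X) \<Longrightarrow> FOb (snd (FA_obj X A)) x = Crr (Coa A x)"
  "x \<in> carrier (HG X) \<Longrightarrow> e \<in> carrier (EG X) \<Longrightarrow> FAr (snd (FA_obj X A)) (Pr x e) = phi A x e"
  by (simp_all add: FA_obj_def)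

abbreviation "FA_cmul X A \<equiv> \<lambda>x \<in> carrier (HG X). Cmul (Coa A x)"
abbreviation "FA_cun X A \<equiv> \<lambda>x \<in> carrier (HG X). Cun (Coa A x)"
abbreviation "FA_mul X A \<equiv> \<lambda>p \<in> ptimes (carrier (HG X)) (carrier (HG X)). mu A (pr1 p) (pr2 p)"
abbreviation "FA_unt A \<equiv> \<lambda>x \<in> {Star}. eta A"

lemma FA_hopf_eq: "FA_hopf S (X, A) =
    fs_bialg S (FA_obj X A) (G_mul X) (G_un X) (FA_cmul X A) (FA_cun X A) (FA_mul X A) (FA_unt A)"
  by (simp add: FA_hopf_def fs_bialg_def Let_def G_cmul_def G_cun_def diag_functor_def
      terminal_functor_def)

lemma fiber_FA [simp]: "x \<in> carrier (HG X) \<Longrightarrow> fiber (FA_obj X A) (FA_cmul X A) (FA_cun X A) x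
    = Coa A x"
  by (simp add: fiber_def)

lemma base_FA_hopf: "base (FA_hopf S (X, A)) = G_hopf X"
  by (simp add: FA_hopf_eq base_fs_bialg G_hopf_eq)

context symmetric_monoidal_category
begin

text \<open>The axioms correspond one to one: the two rules for \<phi> under composition say that it
  is a functor, its being a coalgebra morphism is naturality of coproduct and counit, and its
  compatibility with \<open>mu\<close> is naturality of the product.\<close>

lemma fibered_bialgebra_FA:
  assumes X: "crossed_module X" and A: "hopf_chi_algebra S X A"
  shows "fibered_bialgebra S (FA_obj X A) (G_mul X) (G_un X) (FA_cmul X A) (FA_cun X A) (FA_mul X
      A) (FA_unt A)"
proof -
  interpret crossed X by unfold_locales (rule X)
  note D = hopf_chi_algebraD[OF A]
  have "is_functor (G_cat X) S (snd (FA_obj X A))"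
    unfolding is_functor_iff
    by (auto simp: D(13) D(14) coalg_morD[OF D(6)] coalgebraD[OF D(1)]) (auto simp: FA_obj_def)
  then have "FA_obj X A \<in> fs_obj S"
    by (simp add: in_fs_obj category_G_cat[OF X] normalized_G_cat)
  then show ?thesis
    unfolding fibered_bialgebra_def fibered_coalgebra_def
    using cat_monoid_G[OF X] D(3) by (simp add: D(1,2,6,8-10,15))
qed

text \<open>Naturality of the antipode is not an axiom: both sides are convolution inverses of \<open>\<phi>\<^bsub>x,e\<^esub>\<close>.\<close>

lemma FA_anti_natural:
  assumes X: "crossed_module X" and A: "hopf_chi_algebra S X A" and x: "x \<in> carrier (HG X)"
      and e: "e \<in> carrier (EG X)"
  shows "anti A (bd X e \<otimes>\<^bsub>HG X\<^esub> x) \<cdot> phi A x e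
    = phi A (inv\<^bsub>HG X\<^esub> x) (act X (inv\<^bsub>HG X\<^esub> x) (inv\<^bsub>EG X\<^esub> e)) \<cdot> anti A x"
proof -
  interpret crossed X by unfold_locales (rule X)
  \<comment> \<open>The name protects the argument of \<open>phi\<close> from the rewrite rules for
    the action, which would change it into a form the typing facts do not match.\<close>
  define d where "d = act X (inv\<^bsub>H\<^esub> x) (inv\<^bsub>E\<^esub> e)"
  let ?x = "inv\<^bsub>H\<^esub> x" and ?e = d and ?y = "bd X e \<otimes>\<^bsub>H\<^esub> x"
  have x': "?x \<in> carrier H" and e': "?e \<in> carrier E" and y: "?y \<in> carrier H" using x e
      by (auto simp: d_def)
  note D = hopf_chi_algebraD[OF A]
  have iy: "bd X ?e \<otimes>\<^bsub>H\<^esub> ?x = inv\<^bsub>H\<^esub> ?y"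
    using x e by (simp add: d_def H.m_assoc H.inv_mult_group)
  note p = coalg_morD[OF D(6)[OF x e]] and p' = coalg_morD[OF D(6)[OF x' e'], unfolded iy]
  note K = coalgebraD[OF D(1)[OF x]] coalgebraD[OF D(1)[OF x']]
  have s: "anti A x \<in> Ar S" "Dom S (anti A x) = Crr (Coa A x)" "Cod S (anti A x) = Crr (Coa A ?x)"
    using D(4)[OF x] by (auto simp: in_homs_iff)
  have mu: "mu A a b \<in> Ar S" "Dom S (mu A a b) = Crr (Coa A a) \<boxtimes> Crr (Coa A b)"
     "Cod S (mu A a b) = Crr (Coa A (a \<otimes>\<^bsub>H\<^esub> b))" if "a \<in> carrier H" "b \<in> carrier H" for a b
    using coalg_morD[OF D(2)[OF that]] by (auto simp: tensor_coalg_def)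
  have et: "eta A \<in> Ar S" "Dom S (eta A) = tunit S" "Cod S (eta A) = Crr (Coa A \<one>\<^bsub>H\<^esub>)"
    using coalg_morD[OF D(3)] by (auto simp: unit_coalg_def)
  note T = p(1-3) p'(1-3) K s mu et Comp_Ar tarr_Ar Id_Ar x x' y e e'
  have "phi A ?x ?e \<cdot> anti A x = anti A ?y \<cdot> phi A x e"
  proof (rule antipode_unique[OF X A D(1)[OF x] y D(6)[OF x e]])
    show "phi A ?x ?e \<cdot> anti A x \<in> homs S (Crr (Coa A x)) (Crr (Coa A (inv\<^bsub>H\<^esub> ?y)))"
      by (simp add: in_homs_iff T)
    have "(phi A ?x ?e \<cdot> anti A x) \<odot> phi A x e = (phi A ?x ?e \<odot> phi A x e)
        \<cdot> (anti A x \<odot> Id S (Crr (Coa A x)))"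
      using Id_Comp_Ar[of "phi A x e"] by (subst tarr_Comp_Ar) (simp_all add: T)
    then have "mu A (inv\<^bsub>H\<^esub> ?y) ?y \<cdot> ((phi A ?x ?e \<cdot> anti A x) \<odot> phi A x e) \<cdot> Cmul (Coa A x)
      = (mu A (bd X ?e \<otimes>\<^bsub>H\<^esub> ?x) ?y \<cdot> (phi A ?x ?e \<odot> phi A x e))
          \<cdot> (anti A x \<odot> Id S (Crr (Coa A x))) \<cdot> Cmul (Coa A x)"
      unfolding iy by (simp add: T Comp_assoc_Ar)
    also have "\<dots> = (phi A (?x \<otimes>\<^bsub>H\<^esub> x) (?e \<otimes>\<^bsub>E\<^esub> act X ?x e) \<cdot> mu A ?x x)
        \<cdot> (anti A x \<odot> Id S (Crr (Coa A x))) \<cdot> Cmul (Coa A x)"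
      using D(15)[OF x' x e' e] by simp
    \<comment> \<open>By the choice of d its product with the translate of e is the unit of E, and
      \<phi> at the unit is an identity.\<close>
    also have "phi A (?x \<otimes>\<^bsub>H\<^esub> x) (?e \<otimes>\<^bsub>E\<^esub> act X ?x e) = Id S (Crr (Coa A \<one>\<^bsub>H\<^esub>))"
      using x e by (simp add: D(13) d_def)
    also have "(Id S (Crr (Coa A \<one>\<^bsub>H\<^esub>)) \<cdot> mu A ?x x) \<cdot> (anti A x \<odot> Id S (Crr (Coa A x)))
        \<cdot> Cmul (Coa A x)
      = mu A ?x x \<cdot> (anti A x \<odot> Id S (Crr (Coa A x))) \<cdot> Cmul (Coa A x)"
      using Id_Comp_Ar(1)[of "mu A ?x x"] x by (simp add: T)
    finally show "mu A (inv\<^bsub>H\<^esub> ?y) ?y \<cdot> ((phi A ?x ?e \<cdot> anti A x) \<odot> phi A x e) \<cdot> Cmul (Coa A x)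
        = eta A \<cdot> Cun (Coa A x)"
      using D(11)[OF x] by simp
  qed
  then show ?thesis by (simp add: d_def)
qed

lemma antipode_FA:
  assumes X: "crossed_module X" and A: "hopf_chi_algebra S X A"
  shows "antipode (FS S) (FA_hopf S (X, A)) (FA_anti (X, A)) \<and> invertible (FS S) (FA_anti (X, A))"
proof -
  interpret crossed X by unfold_locales (rule X)
  note D = hopf_chi_algebraD[OF A]
  have P: "FA_obj X A \<in> fs_obj S" using fibered_bialgebra_FA[OF X A]
      by (simp add: fibered_bialgebra_def)
  have s: "FA_anti (X, A) \<in> homs (FS S) (FA_obj X A) (FA_obj X A)"
    using P D(4) FA_anti_natural[OF X A]
    by (auto simp: in_homs_FS FA_anti_def is_functor_G_anti[OF X])
  moreover have "antipode (FS S) (FA_hopf S (X, A)) (FA_anti (X, A))"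
    unfolding FA_hopf_eq antipode_fs_bialg_iff
    using s cat_antipode_G[OF X] D(11,12) by (simp add: FA_anti_def)
  moreover have "invertible (FS S) (FA_anti (X, A))"
    unfolding invertible_FS_iff[OF s] using invertible_G_anti[OF X] D(5)
        by (simp add: FA_anti_def base_mor_def)
  ultimately show ?thesis by blast
qed

lemma hopf_algebra_FA:
  "crossed_module X \<Longrightarrow> hopf_chi_algebra S X A \<Longrightarrow> hopf_algebra (FS S) (FA_hopf S (X, A))"
  using antipode_FA[of X A] fibered_bialgebra_FA[of X A]
  unfolding hopf_algebra_def by (auto simp: FA_hopf_eq bialgebra_fs_bialg_iff)

text \<open>\<open>anti\<close> is absent from the comparison: as a convolution inverse of the
  identity it is fixed by the remaining components. Normalization extends the agreement to all
  arguments.\<close>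

lemma chi_alg_eqI:
  assumes A: "(X, A) \<in> chi_pairs S" and B: "(X, B) \<in> chi_pairs S"
    and Coa: "\<And>x. x \<in> carrier (HG X) \<Longrightarrow> Coa A x = Coa B x"
    and mu: "\<And>x y. x \<in> carrier (HG X) \<Longrightarrow> y \<in> carrier (HG X) \<Longrightarrow> mu A x y = mu B x y"
    and eta: "eta A = eta B"
    and phi: "\<And>x e. x \<in> carrier (HG X) \<Longrightarrow> e \<in> carrier (EG X) \<Longrightarrow> phi A x e = phi B x e"
  shows "A = B"
proof -
  have X: "crossed_module X" and A': "hopf_chi_algebra S X A" "normalized_chialg X A"
    and B': "hopf_chi_algebra S X B" "normalized_chialg X B"
    using A B by (auto simp: chi_pairs_def)
  interpret crossed X by unfold_locales (rule X)
  note D = hopf_chi_algebraD[OF A'(1)] and DB = hopf_chi_algebraD[OF B'(1)]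
  have "anti A x = anti B x" if x: "x \<in> carrier H" for x
  proof -
    have x': "inv\<^bsub>H\<^esub> x \<in> carrier H" using x by simp
    let ?i = "Id S (Crr (Coa B x))"
    \<comment> \<open>The identity is \<phi> at the unit of E, which is known to be a coalgebra
      morphism.\<close>
    have "coalg_mor S (Coa B x) (Coa B x) ?i"
      using DB(13)[OF x] DB(6)[OF x E.one_closed] x by simp
    then have "anti A x = anti B x \<cdot> ?i"
      by (rule antipode_unique[OF X B'(1) DB(1)[OF x] x])
        (use D(4)[OF x] D(11)[OF x] Coa[OF x] Coa[OF x'] mu[OF x' x] eta in auto)
    also have "\<dots> = anti B x" using DB(4)[OF x] by (rule Id_right)
    finally show ?thesis .
  qed
  then have "anti A = anti B" "Coa A = Coa B"
    using A'(2) B'(2) Coa by (auto simp: normalized_chialg_def extensional_eq_iff)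
  moreover have "mu A x y = mu B x y" for x y
    using A'(2) B'(2) mu by (cases "x \<in> carrier H \<and> y \<in> carrier H") (simp_all add:
        normalized_chialg_def)
  moreover have "phi A x e = phi B x e" for x e
    using A'(2) B'(2) phi by (cases "x \<in> carrier H \<and> e \<in> carrier E") (simp_all add:
        normalized_chialg_def)
  ultimately show ?thesis using eta by (intro chialg.equality) (simp_all add: fun_eq_iff)
qed

end

section \<open>Transport of fibres along an identification of the base\<close>

definition transport_alg :: "'u scrossed \<Rightarrow> ('u, 'o, 'a) fobj \<Rightarrow> ('u univ \<Rightarrow> 'a) \<Rightarrow> ('u univ \<Rightarrow> 'a) \<Rightarrow>
    ('u univ \<Rightarrow> 'a)
    \<Rightarrow> ('u univ \<Rightarrow> 'a) \<Rightarrow> ('u univ \<Rightarrow> 'a) \<Rightarrow> 'u sfunctr \<Rightarrow> ('u univ, 'u univ, 'o, 'a) chialg" where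
  "transport_alg X P \<delta> \<epsilon> \<mu> \<eta> s G =
     \<lparr>Coa = (\<lambda>x \<in> carrier (HG X). fiber P \<delta> \<epsilon> (FOb G x)),
      mu = (\<lambda>x y. if x \<in> carrier (HG X) \<and> y \<in> carrier (HG X) then \<mu> (Pr (FOb G x) (FOb G y)) else
          undefined),
      eta = \<eta> Star,
      anti = (\<lambda>x \<in> carrier (HG X). s (FOb G x)),
      phi = (\<lambda>x e. if x \<in> carrier (HG X) \<and> e \<in> carrier (EG X) then FAr (snd P) (FAr G (Pr x e))
          else undefined)\<rparr>"

text \<open>A Hopf algebra in \<open>FS S\<close> with a chosen isomorphism \<Gamma> from its base
  to the group object of X. The inverse G carries x and e back to the base, where the fibres
  live.\<close>

locale based_hopf = symmetric_monoidal_category S + crossed X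
  for S :: "('o, 'a, 'z) smc_scheme" (structure) and X :: "'u scrossed" +
  fixes P :: "('u, 'o, 'a) fobj" and m u :: "'u sfunctr" and \<delta> \<epsilon> \<mu> \<eta> :: "'u univ \<Rightarrow> 'a"
    and s :: "('u, 'o, 'a) fmor" and \<Gamma> G :: "('u scat, 'u sfunctr) mor"
  assumes bialg: "bialgebra (FS S) (fs_bialg S P m u \<delta> \<epsilon> \<mu> \<eta>)"
    and s: "antipode (FS S) (fs_bialg S P m u \<delta> \<epsilon> \<mu> \<eta>) s" "invertible (FS S) s"
    and norm: "normalized_crossed X"
    and \<Gamma>: "hopf_iso CAT (cat_bialg (fst P) m u) (G_hopf X) \<Gamma>" and G: "inverse_pair CAT \<Gamma> G"
begin

abbreviation "gob \<equiv> FOb (Dat G)"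
abbreviation "gar \<equiv> FAr (Dat G)"

lemma fib: "fibered_bialgebra S P m u \<delta> \<epsilon> \<mu> \<eta>"
  using bialg by (simp add: bialgebra_fs_bialg_iff)

lemma P: "P \<in> fs_obj S" and monoid: "cat_monoid (fst P) m u"
  using fib by (auto simp: fibered_bialgebra_def)

lemma mul: "is_functor (prod_cat (fst P) (fst P)) (fst P) m" and unt: "is_functor one_cat (fst P) u"
  using monoid by (auto simp: cat_monoid_def)

lemma \<Gamma>_homs: "\<Gamma> \<in> homs CAT (fst P) (G_cat X)"
  and \<Gamma>_mon: "monoid_functor (fst P) m u (G_mul X) (G_un X) (Dat \<Gamma>)"
  using \<Gamma> unfolding G_hopf_eq
  by (auto simp: hopf_iso_cat_bialg_iff fs_objD[OF P] category_G_cat[OF crossed] normalized_G_cat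
      is_functor_G_un[OF crossed])

lemma \<Gamma>_functor: "is_functor (fst P) (G_cat X) (Dat \<Gamma>)" and \<Gamma>_sel: "Src \<Gamma> = fst P" "Tgt \<Gamma> = G_cat X"
  using \<Gamma>_homs by (auto simp: in_homs_CAT)

lemma G_functor: "is_functor (G_cat X) (fst P) (Dat G)"
  using G by (simp add: inverse_pair_CAT in_homs_CAT \<Gamma>_sel)

lemma inverse [simp]:
  "x \<in> Ob (fst P) \<Longrightarrow> gob (FOb (Dat \<Gamma>) x) = x"
  "a \<in> Ar (fst P) \<Longrightarrow> gar (FAr (Dat \<Gamma>) a) = a"
  "x \<in> carrier H \<Longrightarrow> FOb (Dat \<Gamma>) (gob x) = x"
  "x \<in> carrier H \<Longrightarrow> e \<in> carrier E \<Longrightarrow> FAr (Dat \<Gamma>) (gar (Pr x e)) = Pr x e"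
  using G by (auto simp: inverse_pair_CAT \<Gamma>_sel)

lemma G_in [simp]: "x \<in> carrier H \<Longrightarrow> gob x \<in> Ob (fst P)"
  using functor_in(1)[OF G_functor, of x] by simp

lemma G_ar [simp]:
  assumes "x \<in> carrier H" "e \<in> carrier E"
  shows "gar (Pr x e) \<in> Ar (fst P)" "Dom (fst P) (gar (Pr x e)) = gob x"
    "Cod (fst P) (gar (Pr x e)) = gob (bd X e \<otimes>\<^bsub>H\<^esub> x)"
  using functor_in(2-4)[OF G_functor, of "Pr x e"] assms by auto

lemma \<Gamma>_in: "x \<in> Ob (fst P) \<Longrightarrow> FOb (Dat \<Gamma>) x \<in> carrier H"
  using functor_in(1)[OF \<Gamma>_functor, of x] by simp

lemma G_mult:
  assumes "x \<in> carrier H" "y \<in> carrier H"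
  shows "FOb m (Pr (gob x) (gob y)) = gob (x \<otimes>\<^bsub>H\<^esub> y)"
proof -
  have "FOb (Dat \<Gamma>) (FOb m (Pr (gob x) (gob y))) = x \<otimes>\<^bsub>H\<^esub> y"
    using \<Gamma>_mon assms by (simp add: monoid_functor_def)
  from arg_cong[OF this, of "gob"] show ?thesis
    using assms by (simp add: mul_functor_in(1)[OF mul])
qed

lemma G_mult_ar:
  assumes "x \<in> carrier H" "e \<in> carrier E" "y \<in> carrier H" "f \<in> carrier E"
  shows "FAr m (Pr (gar (Pr x e)) (gar (Pr y f)))
    = gar (Pr (x \<otimes>\<^bsub>H\<^esub> y) (e \<otimes>\<^bsub>E\<^esub> act X x f))"
proof -
  have "FAr (Dat \<Gamma>) (FAr m (Pr (gar (Pr x e)) (gar (Pr y f)))) = Pr (x \<otimes>\<^bsub>H\<^esub> y) (e \<otimes>\<^bsub>E\<^esub> act X x f)"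
    using \<Gamma>_mon assms by (simp add: monoid_functor_def)
  from arg_cong[OF this, of "gar"] show ?thesis
    using assms by (simp add: mul_functor_in(2)[OF mul])
qed

lemma G_one: "FOb u Star = gob \<one>\<^bsub>H\<^esub>"
proof -
  have "FOb (Dat \<Gamma>) (FOb u Star) = \<one>\<^bsub>H\<^esub>" using \<Gamma>_mon by (simp add: monoid_functor_def)
  from arg_cong[OF this, of "gob"] show ?thesis by (simp add: unit_functor_in(1)[OF unt])
qed

lemma s_homs: "s \<in> homs (FS S) P P" and s_anti: "cat_antipode (fst P) m u (fun_of s)"
  using s(1) by (auto simp: antipode_fs_bialg_iff)

text \<open>The antipode is known only through its axioms. On objects \<Gamma> turns its value into
  a left inverse in H, which is the inverse.\<close>

lemma G_inv:
  assumes x: "x \<in> carrier H"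
  shows "FOb (fun_of s) (gob x) = gob (inv\<^bsub>H\<^esub> x)"
proof -
  let ?t = "FOb (fun_of s) (gob x)"
  have t: "?t \<in> Ob (fst P)"
    using s_anti functor_in(1)[of "fst P" "fst P" "fun_of s"] x by (simp add: cat_antipode_def)
  have "FOb m (Pr ?t (gob x)) = FOb u Star" using s_anti x by (simp add: cat_antipode_def)
  moreover have "FOb (Dat \<Gamma>) (FOb m (Pr ?t (gob x))) = FOb (G_mul X) (Pr (FOb (Dat \<Gamma>) ?t) (FOb
      (Dat \<Gamma>) (gob x)))"
    "FOb (Dat \<Gamma>) (FOb u Star) = \<one>\<^bsub>H\<^esub>"
    using \<Gamma>_mon t x by (simp_all add: monoid_functor_def)
  ultimately have "FOb (Dat \<Gamma>) ?t \<otimes>\<^bsub>H\<^esub> x = \<one>\<^bsub>H\<^esub>"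
    using x \<Gamma>_in[OF t] by simp
  then have "inv\<^bsub>H\<^esub> x = FOb (Dat \<Gamma>) ?t" using x \<Gamma>_in[OF t] by (intro H.inv_equality) auto
  then show ?thesis using t by simp
qed

definition "alg = transport_alg X P \<delta> \<epsilon> \<mu> \<eta> (cmp s) (Dat G)"

lemma alg_sel [simp]:
  "x \<in> carrier H \<Longrightarrow> Coa alg x = fiber P \<delta> \<epsilon> (gob x)"
  "x \<in> carrier H \<Longrightarrow> y \<in> carrier H \<Longrightarrow> mu alg x y = \<mu> (Pr (gob x) (gob y))"
  "eta alg = \<eta> Star"
  "x \<in> carrier H \<Longrightarrow> anti alg x = cmp s (gob x)"
  "x \<in> carrier H \<Longrightarrow> e \<in> carrier E \<Longrightarrow> phi alg x e = FAr (snd P) (gar (Pr x e))"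
  by (simp_all add: alg_def transport_alg_def)

lemma alg_in: "(X, alg) \<in> chi_pairs S"
proof -
  have n: "normalized_chialg X alg"
    by (simp add: normalized_chialg_def alg_def transport_alg_def)
  note F = fib[unfolded fibered_bialgebra_def fibered_coalgebra_def]
  note PF = fs_objD(3)[OF P]
  \<comment> \<open>The arrows \<phi> of \<open>alg\<close> are the values of this composite functor
    on a groupoid, hence invertible.\<close>
  have "is_functor (G_cat X) S (comp_functor (G_cat X) (snd P) (Dat G))"
    by (rule is_functor_comp[OF category_G_cat[OF crossed] G_functor PF])
  from functor_inverse_pair[OF this inverse_pair_G_cat[OF crossed] category_G_cat[OF crossed]]
  have phi_inv: "invertible S (FAr (snd P) (gar (Pr x e)))" if "x \<in> carrier H" "e \<in> carrier E"
      for x e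
    using that by (auto simp: invertible_def)
  have phi_mor: "coalg_mor S (fiber P \<delta> \<epsilon> (gob x)) (fiber P \<delta> \<epsilon> (gob (bd X e \<otimes>\<^bsub>H\<^esub> x)))
      (FAr (snd P) (gar (Pr x e)))" if "x \<in> carrier H" "e \<in> carrier E" for x e
  proof -
    have "\<forall>a \<in> Ar (fst P). coalg_mor S (fiber P \<delta> \<epsilon> (Dom (fst P) a)) (fiber P \<delta> \<epsilon> (Cod (fst P) a))
        (FAr (snd P) a)"
      using F by blast
    from bspec[OF this G_ar(1)[OF that]] show ?thesis using that by simp
  qed
  have phi_mu: "\<mu> (Pr (gob (bd X e \<otimes>\<^bsub>H\<^esub> x)) (gob (bd X f \<otimes>\<^bsub>H\<^esub> y)))
       \<cdot> (FAr (snd P) (gar (Pr x e)) \<odot> FAr (snd P) (gar (Pr y f)))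
      = FAr (snd P) (gar (Pr (x \<otimes>\<^bsub>H\<^esub> y) (e \<otimes>\<^bsub>E\<^esub> act X x f))) \<cdot> \<mu> (Pr (gob x) (gob y))"
    if "x \<in> carrier H" "e \<in> carrier E" "y \<in> carrier H" "f \<in> carrier E" for x e y f
  proof -
    have "\<forall>a \<in> Ar (fst P). \<forall>b \<in> Ar (fst P).
          \<mu> (Pr (Cod (fst P) a) (Cod (fst P) b)) \<cdot> (FAr (snd P) a \<odot> FAr (snd P) b)
          = FAr (snd P) (FAr m (Pr a b)) \<cdot> \<mu> (Pr (Dom (fst P) a) (Dom (fst P) b))"
      using F by blast
    from bspec[OF bspec[OF this G_ar(1)[OF that(1,2)]] G_ar(1)[OF that(3,4)]] show ?thesis
      using that by (simp add: G_mult_ar)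
  qed
  have phi_one: "FAr (snd P) (gar (Pr x \<one>\<^bsub>E\<^esub>)) = Id S (FOb (snd P) (gob x))" if "x \<in> carrier H"
      for x
    using functor_in(5)[OF G_functor, of x] functor_in(5)[OF PF, of "gob x"] that by simp
  have phi_comp: "FAr (snd P) (gar (Pr (bd X e \<otimes>\<^bsub>H\<^esub> x) f)) \<cdot> FAr (snd P) (gar (Pr x e))
      = FAr (snd P) (gar (Pr x (f \<otimes>\<^bsub>E\<^esub> e)))"
    if "x \<in> carrier H" "e \<in> carrier E" "f \<in> carrier E" for x e f
  proof -
    have "gar (Pr (bd X e \<otimes>\<^bsub>H\<^esub> x) f \<cdot>\<^bsub>G_cat X\<^esub> Pr x e)
      = gar (Pr (bd X e \<otimes>\<^bsub>H\<^esub> x) f) \<cdot>\<^bsub>fst P\<^esub> gar (Pr x e)"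
      using G_functor that by (simp add: is_functor_iff)
    moreover have "FAr (snd P) (gar (Pr (bd X e \<otimes>\<^bsub>H\<^esub> x) f) \<cdot>\<^bsub>fst P\<^esub> gar (Pr x e))
      = FAr (snd P) (gar (Pr (bd X e \<otimes>\<^bsub>H\<^esub> x) f)) \<cdot> FAr (snd P) (gar (Pr x e))"
      using PF that by (simp add: is_functor_iff)
    ultimately show ?thesis using that by simp
  qed
  have anti_homs: "cmp s (gob x) \<in> homs S (FOb (snd P) (gob x)) (FOb (snd P) (gob (inv\<^bsub>H\<^esub> x)))"
    "invertible S (cmp s (gob x))" if "x \<in> carrier H" for x
    using s_homs s(2) invertible_FS_iff[OF s_homs] that by (auto simp: in_homs_FS G_inv[symmetric])
  have anti_eq: "\<mu> (Pr (gob (inv\<^bsub>H\<^esub> x)) (gob x)) \<cdot> (cmp s (gob x) \<odot> Id S (FOb (snd P) (gob x)))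
      \<cdot> \<delta> (gob x)
       = \<eta> Star \<cdot> \<epsilon> (gob x)"
    "\<mu> (Pr (gob x) (gob (inv\<^bsub>H\<^esub> x))) \<cdot> (Id S (FOb (snd P) (gob x)) \<odot> cmp s (gob x)) \<cdot> \<delta> (gob x)
       = \<eta> Star \<cdot> \<epsilon> (gob x)" if "x \<in> carrier H" for x
    using s(1) that by (auto simp: antipode_fs_bialg_iff G_inv[symmetric])
  have rest: "\<And>x. x \<in> carrier H \<Longrightarrow> coalgebra S (fiber P \<delta> \<epsilon> (gob x))"
    "coalg_mor S (unit_coalg S) (fiber P \<delta> \<epsilon> (gob \<one>\<^bsub>H\<^esub>)) (\<eta> Star)"
    "\<And>x y. x \<in> carrier H \<Longrightarrow> y \<in> carrier H \<Longrightarrow>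
       coalg_mor S (tensor_coalg S (fiber P \<delta> \<epsilon> (gob x)) (fiber P \<delta> \<epsilon> (gob y)))
         (fiber P \<delta> \<epsilon> (gob (x \<otimes>\<^bsub>H\<^esub> y))) (\<mu> (Pr (gob x) (gob y)))"
    "\<And>x y z. x \<in> carrier H \<Longrightarrow> y \<in> carrier H \<Longrightarrow> z \<in> carrier H \<Longrightarrow>
       \<mu> (Pr (gob (x \<otimes>\<^bsub>H\<^esub> y)) (gob z)) \<cdot> (\<mu> (Pr (gob x) (gob y)) \<odot> Id S (FOb (snd P) (gob z)))
       = \<mu> (Pr (gob x) (gob (y \<otimes>\<^bsub>H\<^esub> z))) \<cdot> (Id S (FOb (snd P) (gob x)) \<odot> \<mu> (Pr (gob y) (gob z)))
            \<cdot> assoc S (FOb (snd P) (gob x)) (FOb (snd P) (gob y)) (FOb (snd P) (gob z))"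
    "\<And>x. x \<in> carrier H \<Longrightarrow> \<mu> (Pr (gob \<one>\<^bsub>H\<^esub>) (gob x)) \<cdot> (\<eta> Star \<odot> Id S (FOb (snd P) (gob x)))
        = lunit S (FOb (snd P) (gob x))"
    "\<And>x. x \<in> carrier H \<Longrightarrow> \<mu> (Pr (gob x) (gob \<one>\<^bsub>H\<^esub>)) \<cdot> (Id S (FOb (snd P) (gob x)) \<odot> \<eta> Star)
        = runit S (FOb (snd P) (gob x))"
    using F by (simp_all add: G_one[symmetric] G_mult[symmetric])
  have "hopf_chi_algebra S X alg"
    unfolding hopf_chi_algebra_def Let_def
    by (simp add: rest phi_inv phi_mor phi_mu phi_one phi_comp anti_homs anti_eq)
  with n norm crossed show ?thesis by (simp add: chi_pairs_def)
qed

text \<open>With identity components, the morphism equations compare the structure of A directly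
  with the transported one: cancelling identities turns them into equalities of coalgebras,
  products, unit and \<phi>. One direction gives existence of the Hopf \<chi>-algebra over \<Gamma>,
  the other its uniqueness.\<close>

lemma over_hopf_iff:
  assumes "(X, A) \<in> chi_pairs S"
  shows "hopf_iso (FS S) (fs_bialg S P m u \<delta> \<epsilon> \<mu> \<eta>) (FA_hopf S (X, A)) (over_mor S P (FA_obj X A)
      \<Gamma>) \<longleftrightarrow>
    (\<forall>x \<in> carrier H. Coa A x = Coa alg x) \<and> (\<forall>x \<in> carrier H. \<forall>y \<in> carrier H. mu A x y = mu alg x y)
    \<and> eta A = eta alg \<and> (\<forall>x \<in> carrier H. \<forall>e \<in> carrier E. phi A x e = phi alg x e)"
proof -
  have A: "hopf_chi_algebra S X A" using assms by (simp add: chi_pairs_def)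
  note D = hopf_chi_algebraD[OF A]
  let ?f = "over_mor S P (FA_obj X A) \<Gamma>" and ?F = "FOb (snd P)" and ?G = gob and ?\<Gamma> = "FOb (Dat \<Gamma>)"
  note F = fib[unfolded fibered_bialgebra_def fibered_coalgebra_def]
  note PF = fs_objD(3)[OF P]
  have Q: "FA_obj X A \<in> fs_obj S" using fibered_bialgebra_FA[OF crossed A]
      by (simp add: fibered_bialgebra_def)
  have \<Gamma>_base: "base_mor ?f = \<Gamma>" and f_sel: "fun_of ?f = Dat \<Gamma>" "\<And>x. x \<in> Ob (fst P) \<Longrightarrow> cmp ?f x
      = Id S (?F x)"
    "Src ?f = P" "Tgt ?f = FA_obj X A" "cmp ?f \<in> extensional (Ob (fst P))"
    by (simp_all add: base_mor_def over_mor_def \<Gamma>_sel mor_eq_iff)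
  have Fob: "?F x \<in> Ob S" if "x \<in> Ob (fst P)" for x using functor_in(1)[OF PF that] .
  have \<Gamma>_inv: "invertible CAT \<Gamma>" using G by (auto simp: invertible_def)
  have iff: "hopf_iso (FS S) (fs_bialg S P m u \<delta> \<epsilon> \<mu> \<eta>) (FA_hopf S (X, A)) ?f \<longleftrightarrow>
    ?f \<in> homs (FS S) P (FA_obj X A)
    \<and> (\<forall>x \<in> Ob (fst P). coalg_mor S (fiber P \<delta> \<epsilon> x) (Coa A (?\<Gamma> x)) (Id S (?F x))
        \<and> invertible S (Id S (?F x)))
    \<and> (\<forall>x \<in> Ob (fst P). \<forall>y \<in> Ob (fst P). Id S (?F (FOb m (Pr x y))) \<cdot> \<mu> (Pr x y)
         = mu A (?\<Gamma> x) (?\<Gamma> y) \<cdot> (Id S (?F x) \<odot> Id S (?F y)))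
    \<and> Id S (?F (FOb u Star)) \<cdot> \<eta> Star = eta A"
    unfolding FA_hopf_eq
    by (subst hopf_iso_fs_bialg_iff[OF P Q])
      (use F in \<open>simp_all add: is_functor_G_un[OF crossed] \<Gamma>_base f_sel \<Gamma>_inv \<Gamma>_mon \<Gamma>_in
         mul_functor_in(1)[OF mul] unit_functor_in(1)[OF unt]\<close>)
  show ?thesis
  proof
    assume "hopf_iso (FS S) (fs_bialg S P m u \<delta> \<epsilon> \<mu> \<eta>) (FA_hopf S (X, A)) ?f"
    then have h: "?f \<in> homs (FS S) P (FA_obj X A)"
      "\<And>x. x \<in> Ob (fst P) \<Longrightarrow> coalg_mor S (fiber P \<delta> \<epsilon> x) (Coa A (?\<Gamma> x)) (Id S (?F x))"
      "\<And>x y. x \<in> Ob (fst P) \<Longrightarrow> y \<in> Ob (fst P) \<Longrightarrow> Id S (?F (FOb m (Pr x y))) \<cdot> \<mu> (Pr x y)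
         = mu A (?\<Gamma> x) (?\<Gamma> y) \<cdot> (Id S (?F x) \<odot> Id S (?F y))"
      "Id S (?F (FOb u Star)) \<cdot> \<eta> Star = eta A"
      unfolding iff by blast+
    have coa: "Coa A x = fiber P \<delta> \<epsilon> (?G x)" if x: "x \<in> carrier H" for x
    proof -
      note c = coalg_morD[OF h(2)[OF G_in[OF x]]]
      have ob: "?F (?G x) \<in> Ob S" using Fob x by simp
      have crr: "Crr (Coa A x) = ?F (?G x)" using c(3) ob x by (simp add: Id_Ar)
      have "Cmul (Coa A x) = \<delta> (?G x)"
      proof -
        have "\<delta> (?G x) \<in> homs S (?F (?G x)) (?F (?G x) \<boxtimes> ?F (?G x))"
          using F x by (simp add: coalgebra_def)
        then have "Id S (?F (?G x) \<boxtimes> ?F (?G x)) \<cdot> \<delta> (?G x) = \<delta> (?G x)" by (rule Id_left)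
        moreover have "Cmul (Coa A x) \<cdot> Id S (?F (?G x)) = Cmul (Coa A x)"
          using Id_Comp_Ar(2)[of "Cmul (Coa A x)"] coalgebraD[OF D(1)[OF x]] crr by simp
        ultimately show ?thesis using c(4) x ob by (simp add: tarr_Id)
      qed
      moreover have "Cun (Coa A x) = \<epsilon> (?G x)"
        using c(5) x Id_Comp_Ar(2)[of "Cun (Coa A x)"] coalgebraD[OF D(1)[OF x]] crr by simp
      ultimately show ?thesis using crr by (simp add: fiber_def)
    qed
    have mu: "mu A x y = \<mu> (Pr (?G x) (?G y))" if xy: "x \<in> carrier H" "y \<in> carrier H" for x y
    proof -
      have ob: "?F (?G x) \<in> Ob S" "?F (?G y) \<in> Ob S" using Fob xy by auto
      have "\<mu> (Pr (?G x) (?G y)) \<in> homs S (?F (?G x) \<boxtimes> ?F (?G y)) (?F (FOb m (Pr (?G x) (?G y))))"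
        using F xy by (simp add: coalg_mor_def tensor_coalg_def)
      from Id_left[OF this] h(3)[OF G_in G_in] xy
      have "mu A x y \<cdot> (Id S (?F (?G x)) \<odot> Id S (?F (?G y))) = \<mu> (Pr (?G x) (?G y))" by simp
      moreover have "mu A x y \<in> homs S (?F (?G x) \<boxtimes> ?F (?G y)) (Crr (Coa A (x \<otimes>\<^bsub>H\<^esub> y)))"
        using D(2)[OF xy] coa xy by (simp add: coalg_mor_def tensor_coalg_def)
      ultimately show ?thesis using Id_right ob by (simp add: tarr_Id)
    qed
    have eta: "eta A = \<eta> Star"
    proof -
      have "\<eta> Star \<in> homs S (tunit S) (?F (FOb u Star))"
        using F by (simp add: coalg_mor_def unit_coalg_def)
      with h(4) Id_left show ?thesis by simp
    qed
    have phi: "phi A x e = FAr (snd P) (gar (Pr x e))" if xe: "x \<in> carrier H" "e \<in> carrier E"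
        for x e
    proof -
      have nat: "\<forall>a \<in> Ar (fst P). cmp ?f (Cod (fst P) a) \<cdot> FAr (snd P) a
          = FAr (snd (FA_obj X A)) (FAr (fun_of ?f) a) \<cdot> cmp ?f (Dom (fst P) a)"
        using h(1) by (simp add: in_homs_FS)
      have "Id S (?F (?G (bd X e \<otimes>\<^bsub>H\<^esub> x))) \<cdot> FAr (snd P) (gar (Pr x e)) = phi A x e
          \<cdot> Id S (?F (?G x))"
        using bspec[OF nat G_ar(1)[OF xe]] xe by (simp add: f_sel)
      moreover have "FAr (snd P) (gar (Pr x e)) \<in> homs S (?F (?G x)) (?F (?G (bd X e \<otimes>\<^bsub>H\<^esub> x)))"
        using fs_functor_homs[OF P G_ar(1)[OF xe]] xe by simp
      moreover have "phi A x e \<in> homs S (?F (?G x)) (Crr (Coa A (bd X e \<otimes>\<^bsub>H\<^esub> x)))"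
        using D(6)[OF xe] coa xe by (simp add: coalg_mor_def)
      ultimately show ?thesis using Id_left Id_right by simp
    qed
    show "(\<forall>x \<in> carrier H. Coa A x = Coa alg x) \<and> (\<forall>x \<in> carrier H. \<forall>y \<in> carrier H. mu A x y
        = mu alg x y)
      \<and> eta A = eta alg \<and> (\<forall>x \<in> carrier H. \<forall>e \<in> carrier E. phi A x e = phi alg x e)"
      using coa mu eta phi by simp
  next
    assume "(\<forall>x \<in> carrier H. Coa A x = Coa alg x) \<and> (\<forall>x \<in> carrier H. \<forall>y \<in> carrier H. mu A x y
        = mu alg x y)
      \<and> eta A = eta alg \<and> (\<forall>x \<in> carrier H. \<forall>e \<in> carrier E. phi A x e = phi alg x e)"
    then have a: "\<And>x. x \<in> carrier H \<Longrightarrow> Coa A x = fiber P \<delta> \<epsilon> (?G x)"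
      "\<And>x y. x \<in> carrier H \<Longrightarrow> y \<in> carrier H \<Longrightarrow> mu A x y = \<mu> (Pr (?G x) (?G y))" "eta A = \<eta> Star"
      "\<And>x e. x \<in> carrier H \<Longrightarrow> e \<in> carrier E \<Longrightarrow> phi A x e = FAr (snd P) (gar (Pr x e))" by auto
    \<comment> \<open>Every arrow of the base is the image under G of some \<open>Pr x e\<close>,
      where \<phi> of A is by assumption the functor of P; the identities on the two sides then
      cancel.\<close>
    have nat: "Id S (?F (Cod (fst P) a)) \<cdot> FAr (snd P) a = FAr (snd (FA_obj X A)) (FAr (Dat \<Gamma>) a)
        \<cdot> Id S (?F (Dom (fst P) a))"
      if a': "a \<in> Ar (fst P)" for a
    proof -
      have "FAr (Dat \<Gamma>) a \<in> Ar (G_cat X)" using functor_in(2)[OF \<Gamma>_functor a'] .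
      then obtain x e where xe: "FAr (Dat \<Gamma>) a = Pr x e" "x \<in> carrier H" "e \<in> carrier E" by auto
      then have "FAr (snd (FA_obj X A)) (FAr (Dat \<Gamma>) a) = FAr (snd P) a"
        using a(4)[of x e] inverse(2)[OF a'] by simp
      then show ?thesis using fs_functor_homs[OF P a'] Id_left Id_right by simp
    qed
    have inv_Id: "invertible S (Id S x)" if "x \<in> Ob S" for x
      unfolding invertible_def inverse_pair_def
      by (rule exI[of _ "Id S x"]) (use that Id_in[OF that] Id_left[OF Id_in[OF that]] in \<open>simp
          add: homs_def\<close>)
    have "?f \<in> homs (FS S) P (FA_obj X A)"
      unfolding in_homs_FS f_sel using P Q \<Gamma>_functor nat Fob Id_in
      by (simp add: f_sel \<Gamma>_in a category.Dom_in category.Cod_in fs_objD(1)[OF P])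
    moreover have "coalg_mor S (fiber P \<delta> \<epsilon> x) (Coa A (?\<Gamma> x)) (Id S (?F x))" if x: "x
        \<in> Ob (fst P)" for x
    proof -
      have "coalgebra S (fiber P \<delta> \<epsilon> x)" using F x by blast
      note K = coalgebraD[OF this]
      show ?thesis
        using K Id_Comp_Ar[of "\<delta> x"] Id_Comp_Ar[of "\<epsilon> x"] x
        by (simp add: coalg_mor_def a \<Gamma>_in Id_in tarr_Id)
    qed
    moreover have "Id S (?F (FOb m (Pr x y))) \<cdot> \<mu> (Pr x y) = mu A (?\<Gamma> x) (?\<Gamma> y)
        \<cdot> (Id S (?F x) \<odot> Id S (?F y))"
      if xy: "x \<in> Ob (fst P)" "y \<in> Ob (fst P)" for x y
    proof -
      have "\<mu> (Pr x y) \<in> homs S (?F x \<boxtimes> ?F y) (?F (FOb m (Pr x y)))"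
        using F xy by (simp add: coalg_mor_def tensor_coalg_def)
      then show ?thesis using Id_left Id_right xy Fob by (simp add: a \<Gamma>_in tarr_Id)
    qed
    moreover have "Id S (?F (FOb u Star)) \<cdot> \<eta> Star = eta A"
    proof -
      have "\<eta> Star \<in> homs S (tunit S) (?F (FOb u Star))"
        using F by (simp add: coalg_mor_def unit_coalg_def)
      with a(3) Id_left show ?thesis by simp
    qed
    ultimately show "hopf_iso (FS S) (fs_bialg S P m u \<delta> \<epsilon> \<mu> \<eta>) (FA_hopf S (X, A)) ?f"
      unfolding iff using inv_Id Fob by blast
  qed
qed

end

section \<open>Isomorphisms and the correspondence\<close>

definition iso_functor :: "'u scrossed \<Rightarrow> ('u univ \<Rightarrow> 'u univ) \<Rightarrow> ('u univ \<Rightarrow> 'u univ) \<Rightarrow> 'u sfunctr"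
    where
  "iso_functor X \<beta> \<alpha> =
     \<lparr>FOb = (\<lambda>x \<in> carrier (HG X). \<beta> x), FAr = (\<lambda>a \<in> Ar (G_cat X). Pr (\<beta> (pr1 a)) (\<alpha> (pr2 a)))\<rparr>"

lemma iso_functor_sel [simp]:
  "x \<in> carrier (HG X) \<Longrightarrow> FOb (iso_functor X \<beta> \<alpha>) x = \<beta> x"
  "x \<in> carrier (HG X) \<Longrightarrow> e \<in> carrier (EG X) \<Longrightarrow> FAr (iso_functor X \<beta> \<alpha>) (Pr x e) = Pr (\<beta> x) (\<alpha> e)"
  by (simp_all add: iso_functor_def)

lemma crossed_isoD:
  assumes "crossed_module X" "crossed_module Y" "crossed_iso X Y \<beta> \<alpha>"
  shows "group_hom (HG X) (HG Y) \<beta>" "group_hom (EG X) (EG Y) \<alpha>"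
    "bij_betw \<beta> (carrier (HG X)) (carrier (HG Y))" "bij_betw \<alpha> (carrier (EG X)) (carrier (EG Y))"
    "\<And>e. e \<in> carrier (EG X) \<Longrightarrow> bd Y (\<alpha> e) = \<beta> (bd X e)"
    "\<And>x e. x \<in> carrier (HG X) \<Longrightarrow> e \<in> carrier (EG X) \<Longrightarrow> \<alpha> (act X x e) = act Y (\<beta> x) (\<alpha> e)"
  using assms by (auto simp: crossed_iso_def group_hom_def group_hom_axioms_def iso_def
      crossed_module_def)

lemma crossed_iso_inv:
  assumes X: "crossed_module X" and Y: "crossed_module Y" and i: "crossed_iso X Y \<beta> \<alpha>"
  shows "crossed_iso Y X (inv_into (carrier (HG X)) \<beta>) (inv_into (carrier (EG X)) \<alpha>)"
proof -
  interpret X: crossed X by unfold_locales (rule X)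
  interpret Y: crossed Y by unfold_locales (rule Y)
  note d = crossed_isoD[OF X Y i]
  let ?b = "inv_into (carrier (HG X)) \<beta>" and ?a = "inv_into (carrier (EG X)) \<alpha>"
  have b: "?b y \<in> carrier (HG X)" "\<beta> (?b y) = y" if "y \<in> carrier (HG Y)" for y
    using d(3) that by (auto simp: bij_betw_def inv_into_into f_inv_into_f)
  have a: "?a f \<in> carrier (EG X)" "\<alpha> (?a f) = f" if "f \<in> carrier (EG Y)" for f
    using d(4) that by (auto simp: bij_betw_def inv_into_into f_inv_into_f)
  have b': "?b (\<beta> x) = x" if "x \<in> carrier (HG X)" for x
    using d(3) that by (auto simp: bij_betw_def)
  have a': "?a (\<alpha> e) = e" if "e \<in> carrier (EG X)" for e
    using d(4) that by (auto simp: bij_betw_def)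
  have "bd X (?a f) = ?b (bd Y f)" if f: "f \<in> carrier (EG Y)" for f
    using d(5)[OF a(1)[OF f]] b'[of "bd X (?a f)"] a[OF f] by simp
  moreover have "?a (act Y y f) = act X (?b y) (?a f)" if "y \<in> carrier (HG Y)" "f
      \<in> carrier (EG Y)" for y f
    using d(6)[OF b(1) a(1)] that a'[of "act X (?b y) (?a f)"] b[OF that(1)] a[OF that(2)] by simp
  moreover have "?b \<in> iso (HG Y) (HG X)" "?a \<in> iso (EG Y) (EG X)"
    using i by (auto simp: crossed_iso_def intro: X.H.iso_set_sym X.E.iso_set_sym)
  ultimately show ?thesis by (simp add: crossed_iso_def)
qed

lemma is_functor_iso_functor:
  assumes X: "crossed_module X" and Y: "crossed_module Y" and i: "crossed_iso X Y \<beta> \<alpha>"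
  shows "is_functor (G_cat X) (G_cat Y) (iso_functor X \<beta> \<alpha>)"
proof -
  interpret X: crossed X by unfold_locales (rule X)
  interpret Y: crossed Y by unfold_locales (rule Y)
  note d = crossed_isoD[OF X Y i]
  interpret b: group_hom "HG X" "HG Y" \<beta> by (rule d(1))
  interpret a: group_hom "EG X" "EG Y" \<alpha> by (rule d(2))
  show ?thesis
    by (auto simp: is_functor_iff d(5)) (auto simp: iso_functor_def)
qed

lemma invertible_iso_functor:
  assumes X: "crossed_module X" and Y: "crossed_module Y" and i: "crossed_iso X Y \<beta> \<alpha>"
  shows "invertible CAT \<lparr>Src = G_cat X, Tgt = G_cat Y, Dat = iso_functor X \<beta> \<alpha>\<rparr>"
proof -
  note d = crossed_isoD[OF X Y i] and d' = crossed_isoD[OF Y X crossed_iso_inv[OF X Y i]]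
  let ?b = "inv_into (carrier (HG X)) \<beta>" and ?a = "inv_into (carrier (EG X)) \<alpha>"
  have b: "?b (\<beta> x) = x" if "x \<in> carrier (HG X)" for x using d(3) that by (auto simp: bij_betw_def)
  have a: "?a (\<alpha> x) = x" if "x \<in> carrier (EG X)" for x using d(4) that by (auto simp: bij_betw_def)
  have b': "\<beta> (?b x) = x" if "x \<in> carrier (HG Y)" for x using d(3) that
      by (auto simp: bij_betw_def f_inv_into_f)
  have a': "\<alpha> (?a x) = x" if "x \<in> carrier (EG Y)" for x using d(4) that
      by (auto simp: bij_betw_def f_inv_into_f)
  show ?thesis
    unfolding invertible_def inverse_pair_CAT
    using is_functor_iso_functor[OF X Y i] is_functor_iso_functor[OF Y X crossed_iso_inv[OF X Y i]]
    by (intro exI[of _ "\<lparr>Src = G_cat Y, Tgt = G_cat X, Dat = iso_functor Y ?b ?a\<rparr>"])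
      (auto simp: in_homs_CAT category_G_cat X Y normalized_G_cat a b a' b'
        bij_betwE[OF d(3)] bij_betwE[OF d(4)] bij_betwE[OF d'(3)] bij_betwE[OF d'(4)])
qed

lemma monoid_iso_functor:
  assumes X: "crossed_module X" and Y: "crossed_module Y" and i: "crossed_iso X Y \<beta> \<alpha>"
  shows "monoid_functor (G_cat X) (G_mul X) (G_un X) (G_mul Y) (G_un Y) (iso_functor X \<beta> \<alpha>)"
proof -
  interpret X: crossed X by unfold_locales (rule X)
  interpret Y: crossed Y by unfold_locales (rule Y)
  note d = crossed_isoD[OF X Y i]
  interpret b: group_hom "HG X" "HG Y" \<beta> by (rule d(1))
  interpret a: group_hom "EG X" "EG Y" \<alpha> by (rule d(2))
  show ?thesis by (auto simp: monoid_functor_def d(6))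
qed

text \<open>Both \<beta> and \<alpha> are read off from F: \<beta> on objects, \<alpha> on arrows
  out of 1. They determine F because such arrows and identities generate all arrows under the
  product.\<close>

lemma iso_functorE:
  assumes X: "crossed_module X" and Y: "crossed_module Y"
    and F: "is_functor (G_cat X) (G_cat Y) F"
    and inv: "invertible CAT \<lparr>Src = G_cat X, Tgt = G_cat Y, Dat = F\<rparr>"
    and mon: "monoid_functor (G_cat X) (G_mul X) (G_un X) (G_mul Y) (G_un Y) F"
  obtains \<beta> \<alpha> where "crossed_iso X Y \<beta> \<alpha>" "F = iso_functor X \<beta> \<alpha>"
proof
  interpret X: crossed X by unfold_locales (rule X)
  interpret Y: crossed Y by unfold_locales (rule Y)
  let ?HX = "carrier (HG X)" and ?EX = "carrier (EG X)" and ?HY = "carrier (HG Y)" and ?EY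
      = "carrier (EG Y)"
  define \<beta> where "\<beta> = FOb F"
  \<comment> \<open>F fixes the object 1, so it maps arrows out of 1 to arrows out of 1, and only
    their second component carries information.\<close>
  define \<alpha> where "\<alpha> e = pr2 (FAr F (Pr \<one>\<^bsub>HG X\<^esub> e))" for e
  obtain G where G: "inverse_pair CAT \<lparr>Src = G_cat X, Tgt = G_cat Y, Dat = F\<rparr> G"
    using inv by (auto simp: invertible_def)
  then have GF: "is_functor (G_cat Y) (G_cat X) (Dat G)"
    and i1: "\<And>x. x \<in> ?HX \<Longrightarrow> FOb (Dat G) (FOb F x) = x"
    and i2: "\<And>a. a \<in> ptimes ?HX ?EX \<Longrightarrow> FAr (Dat G) (FAr F a) = a"
    and i3: "\<And>y. y \<in> ?HY \<Longrightarrow> FOb F (FOb (Dat G) y) = y"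
    and i4: "\<And>b. b \<in> ptimes ?HY ?EY \<Longrightarrow> FAr F (FAr (Dat G) b) = b"
    by (auto simp: inverse_pair_CAT in_homs_CAT)
  have \<beta>: "\<beta> x \<in> ?HY" if "x \<in> ?HX" for x
    using functor_in(1)[OF F, of x] that by (simp add: \<beta>_def)
  have \<beta>_mult: "\<beta> (x \<otimes>\<^bsub>HG X\<^esub> y) = \<beta> x \<otimes>\<^bsub>HG Y\<^esub> \<beta> y" if "x \<in> ?HX" "y \<in> ?HX" for x y
    using mon that \<beta> by (simp add: monoid_functor_def \<beta>_def)
  have \<beta>_one: "\<beta> \<one>\<^bsub>HG X\<^esub> = \<one>\<^bsub>HG Y\<^esub>"
    using mon by (simp add: monoid_functor_def \<beta>_def)
  have F_Id: "FAr F (Pr x \<one>\<^bsub>EG X\<^esub>) = Pr (\<beta> x) \<one>\<^bsub>EG Y\<^esub>" if "x \<in> ?HX" for x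
    using functor_in(5)[OF F, of x] that \<beta> by (simp add: \<beta>_def)
  have F_one: "FAr F (Pr \<one>\<^bsub>HG X\<^esub> e) = Pr \<one>\<^bsub>HG Y\<^esub> (\<alpha> e)" and \<alpha>: "\<alpha> e \<in> ?EY" and
    bd: "bd Y (\<alpha> e) = \<beta> (bd X e)" if e: "e \<in> ?EX" for e
  proof -
    note f = functor_in(2-4)[OF F, of "Pr \<one>\<^bsub>HG X\<^esub> e"]
    have "FAr F (Pr \<one>\<^bsub>HG X\<^esub> e) \<in> ptimes ?HY ?EY" using f(1) e by simp
    then obtain y h where yh: "FAr F (Pr \<one>\<^bsub>HG X\<^esub> e) = Pr y h" "y \<in> ?HY" "h \<in> ?EY" by auto
    then have "\<alpha> e = h" "y = \<one>\<^bsub>HG Y\<^esub>"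
      using f(2) e \<beta>_one by (auto simp: \<alpha>_def \<beta>_def)
    with yh f(3) e show "FAr F (Pr \<one>\<^bsub>HG X\<^esub> e) = Pr \<one>\<^bsub>HG Y\<^esub> (\<alpha> e)" "\<alpha> e \<in> ?EY" "bd Y (\<alpha> e)
        = \<beta> (bd X e)"
      by (auto simp: \<beta>_def)
  qed
  have mon_ar: "FAr F (FAr (G_mul X) (Pr a b)) = FAr (G_mul Y) (Pr (FAr F a) (FAr F b))"
    if "a \<in> ptimes ?HX ?EX" "b \<in> ptimes ?HX ?EX" for a b
  proof -
    have *: "\<forall>a \<in> Ar (G_cat X). \<forall>b \<in> Ar (G_cat X). FAr F (FAr (G_mul X) (Pr a b))
        = FAr (G_mul Y) (Pr (FAr F a) (FAr F b))"
      using mon unfolding monoid_functor_def by (elim conjE)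
    show ?thesis using bspec[OF bspec[OF *, of a], of b] that by (simp only: G_cat_sel)
  qed
  \<comment> \<open>The arrow e with source x is the product of the arrow e out of 1 and the
    identity of x, in this order.\<close>
  have F_eq: "FAr F (Pr x e) = Pr (\<beta> x) (\<alpha> e)" if "x \<in> ?HX" "e \<in> ?EX" for x e
    using mon_ar[of "Pr \<one>\<^bsub>HG X\<^esub> e" "Pr x \<one>\<^bsub>EG X\<^esub>"] that \<beta> \<alpha> by (simp add: F_one F_Id)
  have \<alpha>_mult: "\<alpha> (e \<otimes>\<^bsub>EG X\<^esub> f) = \<alpha> e \<otimes>\<^bsub>EG Y\<^esub> \<alpha> f" if "e \<in> ?EX" "f \<in> ?EX" for e f
    using mon_ar[of "Pr \<one>\<^bsub>HG X\<^esub> e" "Pr \<one>\<^bsub>HG X\<^esub> f"] that \<alpha> by (simp add: F_one)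
  have \<alpha>_one: "\<alpha> \<one>\<^bsub>EG X\<^esub> = \<one>\<^bsub>EG Y\<^esub>"
    using F_Id[of "\<one>\<^bsub>HG X\<^esub>"] F_one[of "\<one>\<^bsub>EG X\<^esub>"] by simp
  \<comment> \<open>In the opposite order, the product of the identity of x with the arrow e out of
    1 has second component the translate of e by x.\<close>
  have \<alpha>_act: "\<alpha> (act X x e) = act Y (\<beta> x) (\<alpha> e)" if "x \<in> ?HX" "e \<in> ?EX" for x e
    using mon_ar[of "Pr x \<one>\<^bsub>EG X\<^esub>" "Pr \<one>\<^bsub>HG X\<^esub> e"] that \<beta> \<alpha> by (simp add: F_one F_Id F_eq \<alpha>_one)
  have "bij_betw \<beta> ?HX ?HY"
    by (rule bij_betw_byWitness[where f' = "FOb (Dat G)"])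
      (use i1 i3 \<beta> functor_in(1)[OF GF] in \<open>auto simp: \<beta>_def\<close>)
  moreover have "bij_betw \<alpha> ?EX ?EY"
    unfolding bij_betw_def
  proof (intro conjI inj_onI equalityI subsetI)
    fix e f assume ef: "e \<in> ?EX" "f \<in> ?EX" "\<alpha> e = \<alpha> f"
    then have "FAr (Dat G) (FAr F (Pr \<one>\<^bsub>HG X\<^esub> e)) = FAr (Dat G) (FAr F (Pr \<one>\<^bsub>HG X\<^esub> f))"
      by (simp add: F_one)
    with ef show "e = f" by (simp add: i2)
  next
    fix f assume f: "f \<in> ?EY"
    have "FAr (Dat G) (Pr \<one>\<^bsub>HG Y\<^esub> f) \<in> ptimes ?HX ?EX"
      using functor_in(2)[OF GF, of "Pr \<one>\<^bsub>HG Y\<^esub> f"] f by simp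
    then obtain x e where xe: "FAr (Dat G) (Pr \<one>\<^bsub>HG Y\<^esub> f) = Pr x e" "x \<in> ?HX" "e \<in> ?EX" by auto
    with i4[of "Pr \<one>\<^bsub>HG Y\<^esub> f"] f have "\<alpha> e = f" by (simp add: F_eq)
    with xe show "f \<in> \<alpha> ` ?EX" by auto
  qed (use \<alpha> in auto)
  ultimately show "crossed_iso X Y \<beta> \<alpha>"
    using \<beta> \<alpha> \<beta>_mult \<alpha>_mult \<alpha>_act bd by (auto simp: crossed_iso_def iso_def hom_def)
  have "is_functor (G_cat X) (G_cat Y) (iso_functor X \<beta> \<alpha>)"
    by (rule is_functor_iso_functor[OF X Y]) fact
  then show "F = iso_functor X \<beta> \<alpha>"
    using F by (simp add: functr_eq_iff F_eq) (simp add: \<beta>_def)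
qed

context symmetric_monoidal_category
begin

lemma FA_hopf_iso_iff:
  assumes X: "crossed_module X" and A: "hopf_chi_algebra S X A"
    and Y: "crossed_module Y" and B: "hopf_chi_algebra S Y B"
    and i: "crossed_iso X Y \<beta> \<alpha>" and \<theta>: "\<theta> \<in> extensional (carrier (HG X))"
  shows "hopf_iso (FS S) (FA_hopf S (X, A)) (FA_hopf S (Y, B))
      \<lparr>Src = FA_obj X A, Tgt = FA_obj Y B, Dat = (iso_functor X \<beta> \<alpha>, \<theta>)\<rparr> \<longleftrightarrow>
     (\<forall>x \<in> carrier (HG X).
          coalg_mor S (Coa A x) (Coa B (\<beta> x)) (\<theta> x) \<and> invertible S (\<theta> x))
     \<and> (\<forall>x \<in> carrier (HG X). \<forall>y \<in> carrier (HG X).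
          \<theta> (x \<otimes>\<^bsub>HG X\<^esub> y) \<cdot>\<^bsub>S\<^esub> mu A x y = mu B (\<beta> x) (\<beta> y) \<cdot>\<^bsub>S\<^esub> (\<theta> x \<odot>\<^bsub>S\<^esub> \<theta> y))
     \<and> \<theta> \<one>\<^bsub>HG X\<^esub> \<cdot>\<^bsub>S\<^esub> eta A = eta B
     \<and> (\<forall>x \<in> carrier (HG X). \<forall>e \<in> carrier (EG X).
          \<theta> (bd X e \<otimes>\<^bsub>HG X\<^esub> x) \<cdot>\<^bsub>S\<^esub> phi A x e = phi B (\<beta> x) (\<alpha> e) \<cdot>\<^bsub>S\<^esub> \<theta> x)"
proof -
  interpret X: crossed X by unfold_locales (rule X)
  interpret Y: crossed Y by unfold_locales (rule Y)
  note d = crossed_isoD[OF X Y i]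
  have mem: "\<And>x. x \<in> carrier (HG X) \<Longrightarrow> \<beta> x \<in> carrier (HG Y)" "\<And>e. e \<in> carrier (EG X) \<Longrightarrow> \<alpha> e
      \<in> carrier (EG Y)"
    using bij_betwE[OF d(3)] bij_betwE[OF d(4)] by auto
  have P: "FA_obj X A \<in> fs_obj S" and Q: "FA_obj Y B \<in> fs_obj S"
    using fibered_bialgebra_FA[OF X A] fibered_bialgebra_FA[OF Y B]
        by (simp_all add: fibered_bialgebra_def)
  let ?f = "\<lparr>Src = FA_obj X A, Tgt = FA_obj Y B, Dat = (iso_functor X \<beta> \<alpha>, \<theta>)\<rparr>"
  have "base_mor ?f = \<lparr>Src = G_cat X, Tgt = G_cat Y, Dat = iso_functor X \<beta> \<alpha>\<rparr>"
    by (simp add: base_mor_def)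
  then have inv: "invertible CAT (base_mor ?f)" using invertible_iso_functor[OF X Y i]
      by (simp only:)
  have f: "?f \<in> homs (FS S) (FA_obj X A) (FA_obj Y B) \<longleftrightarrow>
    (\<forall>x \<in> carrier (HG X). \<theta> x \<in> homs S (Crr (Coa A x)) (Crr (Coa B (\<beta> x))))
    \<and> (\<forall>x \<in> carrier (HG X). \<forall>e \<in> carrier (EG X).
          \<theta> (bd X e \<otimes>\<^bsub>HG X\<^esub> x) \<cdot>\<^bsub>S\<^esub> phi A x e = phi B (\<beta> x) (\<alpha> e) \<cdot>\<^bsub>S\<^esub> \<theta> x)"
    using P Q \<theta> is_functor_iso_functor[OF X Y i]
    by (simp add: in_homs_FS mem)
  have "coalg_mor S (Coa A x) (Coa B (\<beta> x)) (\<theta> x) \<Longrightarrow> \<theta> x \<in> homs S (Crr (Coa A x)) (Crr (Coa B (\<beta>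
      x)))" for x
    by (simp add: coalg_mor_def)
  then show ?thesis
    unfolding FA_hopf_eq
    by (subst hopf_iso_fs_bialg_iff[OF P Q])
      (auto simp: is_functor_G_un[OF Y] inv f monoid_iso_functor[OF X Y i] mem)
qed

text \<open>Multiplicativity of \<theta> and its compatibility with the units make \<theta> after
  the antipode of A a left convolution inverse of \<theta> in B. By \<open>antipode_unique\<close>
  it is the antipode of B after \<theta>.\<close>

lemma FA_iso_anti:
  assumes X: "crossed_module X" and A: "hopf_chi_algebra S X A"
    and Y: "crossed_module Y" and B: "hopf_chi_algebra S Y B"
    and i: "crossed_iso X Y \<beta> \<alpha>"
    and \<theta>: "\<And>x. x \<in> carrier (HG X) \<Longrightarrow> coalg_mor S (Coa A x) (Coa B (\<beta> x)) (\<theta> x)"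
    and mul: "\<And>x y. x \<in> carrier (HG X) \<Longrightarrow> y \<in> carrier (HG X) \<Longrightarrow>
          \<theta> (x \<otimes>\<^bsub>HG X\<^esub> y) \<cdot> mu A x y = mu B (\<beta> x) (\<beta> y) \<cdot> (\<theta> x \<odot> \<theta> y)"
    and unt: "\<theta> \<one>\<^bsub>HG X\<^esub> \<cdot> eta A = eta B"
    and x: "x \<in> carrier (HG X)"
  shows "\<theta> (inv\<^bsub>HG X\<^esub> x) \<cdot> anti A x = anti B (\<beta> x) \<cdot> \<theta> x"
proof -
  interpret X: crossed X by unfold_locales (rule X)
  interpret Y: crossed Y by unfold_locales (rule Y)
  note d = crossed_isoD[OF X Y i]
  interpret b: group_hom "HG X" "HG Y" \<beta> by (rule d(1))
  let ?x = "inv\<^bsub>HG X\<^esub> x"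
  have x': "?x \<in> carrier (HG X)" using x by simp
  note D = hopf_chi_algebraD[OF A] and DB = hopf_chi_algebraD[OF B]
  note K = coalgebraD[OF D(1)[OF x]]
  note t = coalg_morD(1-3)[OF \<theta>[OF x]] coalg_morD(1-3)[OF \<theta>[OF x']] coalg_morD(1-3)[OF \<theta>[OF
      X.H.one_closed]]
  have s: "anti A x \<in> Ar S" "Dom S (anti A x) = Crr (Coa A x)" "Cod S (anti A x) = Crr (Coa A ?x)"
    using D(4)[OF x] by (auto simp: in_homs_iff)
  have m: "mu A ?x x \<in> Ar S" "Dom S (mu A ?x x) = Crr (Coa A ?x) \<boxtimes> Crr (Coa A x)"
    "Cod S (mu A ?x x) = Crr (Coa A \<one>\<^bsub>HG X\<^esub>)"
    using coalg_morD(1-3)[OF D(2)[OF x' x]] x by (auto simp: tensor_coalg_def)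
  have mB: "mu B (\<beta> ?x) (\<beta> x) \<in> Ar S" "Dom S (mu B (\<beta> ?x) (\<beta> x))
      = Crr (Coa B (\<beta> ?x)) \<boxtimes> Crr (Coa B (\<beta> x))"
    using coalg_morD(1-3)[OF DB(2)[of "\<beta> ?x" "\<beta> x"]] x x' by (auto simp: tensor_coalg_def simp
        del: b.hom_inv)
  have et: "eta A \<in> Ar S" "Dom S (eta A) = tunit S" "Cod S (eta A) = Crr (Coa A \<one>\<^bsub>HG X\<^esub>)"
    using coalg_morD(1-3)[OF D(3)] by (auto simp: unit_coalg_def)
  note T = K t s m mB et Comp_Ar tarr_Ar Id_Ar
  show ?thesis
  proof (rule antipode_unique[OF Y B D(1)[OF x] _ \<theta>[OF x]])
    show "\<beta> x \<in> carrier (HG Y)" using x by simp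
    have ib: "inv\<^bsub>HG Y\<^esub> \<beta> x = \<beta> ?x" using x by simp
    show "\<theta> ?x \<cdot> anti A x \<in> homs S (Crr (Coa A x)) (Crr (Coa B (inv\<^bsub>HG Y\<^esub> \<beta> x)))"
      unfolding ib by (simp add: in_homs_iff T del: b.hom_inv)
    have "(\<theta> ?x \<cdot> anti A x) \<odot> \<theta> x = (\<theta> ?x \<odot> \<theta> x) \<cdot> (anti A x \<odot> Id S (Crr (Coa A x)))"
      using Id_Comp_Ar[of "\<theta> x"] by (subst tarr_Comp_Ar) (simp_all add: T)
    then have "mu B (\<beta> ?x) (\<beta> x) \<cdot> ((\<theta> ?x \<cdot> anti A x) \<odot> \<theta> x) \<cdot> Cmul (Coa A x)
      = (mu B (\<beta> ?x) (\<beta> x) \<cdot> (\<theta> ?x \<odot> \<theta> x)) \<cdot> (anti A x \<odot> Id S (Crr (Coa A x))) \<cdot> Cmul (Coa A x)"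
      by (simp add: T Comp_assoc_Ar del: b.hom_inv)
    also have "\<dots> = \<theta> \<one>\<^bsub>HG X\<^esub> \<cdot> (mu A ?x x \<cdot> (anti A x \<odot> Id S (Crr (Coa A x))) \<cdot> Cmul (Coa A x))"
      using mul[OF x' x] x by (simp add: T Comp_assoc_Ar del: b.hom_inv flip: mul[OF x' x])
    also have "\<dots> = eta B \<cdot> Cun (Coa A x)"
      unfolding D(11)[OF x] unt[symmetric] by (simp add: T Comp_assoc_Ar)
    finally show "mu B (inv\<^bsub>HG Y\<^esub> \<beta> x) (\<beta> x) \<cdot> ((\<theta> ?x \<cdot> anti A x) \<odot> \<theta> x) \<cdot> Cmul (Coa A x) = eta B
        \<cdot> Cun (Coa A x)"
      unfolding ib .
  qed
qed

text \<open>\<open>pair_iso\<close> asks for compatibility with antipodes and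
  \<open>hopf_iso\<close> does not; the missing equation is supplied by
  \<open>FA_iso_anti\<close>.\<close>

lemma pair_iso_iff:
  assumes p: "(X, A) \<in> chi_pairs S" and q: "(Y, B) \<in> chi_pairs S"
  shows "pair_iso S (X, A) (Y, B) \<longleftrightarrow> (\<exists>f. hopf_iso (FS S) (FA_hopf S (X, A)) (FA_hopf S (Y, B)) f)"
proof
  have X: "crossed_module X" and A: "hopf_chi_algebra S X A" and Y: "crossed_module Y"
      and B: "hopf_chi_algebra S Y B"
    using p q by (auto simp: chi_pairs_def)
  interpret X: crossed X by unfold_locales (rule X)
  {
    assume "pair_iso S (X, A) (Y, B)"
    then obtain \<beta> \<alpha> \<theta> where i: "crossed_iso X Y \<beta> \<alpha>" and \<theta>: "(\<forall>x \<in> carrier (HG X).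
          coalg_mor S (Coa A x) (Coa B (\<beta> x)) (\<theta> x) \<and> invertible S (\<theta> x))
     \<and> (\<forall>x \<in> carrier (HG X). \<forall>y \<in> carrier (HG X).
          \<theta> (x \<otimes>\<^bsub>HG X\<^esub> y) \<cdot>\<^bsub>S\<^esub> mu A x y = mu B (\<beta> x) (\<beta> y) \<cdot>\<^bsub>S\<^esub> (\<theta> x \<odot>\<^bsub>S\<^esub> \<theta> y))
     \<and> \<theta> \<one>\<^bsub>HG X\<^esub> \<cdot>\<^bsub>S\<^esub> eta A = eta B
     \<and> (\<forall>x \<in> carrier (HG X). \<forall>e \<in> carrier (EG X).
          \<theta> (bd X e \<otimes>\<^bsub>HG X\<^esub> x) \<cdot>\<^bsub>S\<^esub> phi A x e = phi B (\<beta> x) (\<alpha> e) \<cdot>\<^bsub>S\<^esub> \<theta> x)"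
      unfolding pair_iso_def by blast
    \<comment> \<open>Components of an arrow in \<open>FS S\<close> must be extensional, whereas
      \<open>pair_iso\<close> constrains \<theta> only on the carrier.\<close>
    let ?\<theta> = "restrict \<theta> (carrier (HG X))"
    have "hopf_iso (FS S) (FA_hopf S (X, A)) (FA_hopf S (Y, B))
      \<lparr>Src = FA_obj X A, Tgt = FA_obj Y B, Dat = (iso_functor X \<beta> \<alpha>, ?\<theta>)\<rparr>"
      using \<theta> by (subst FA_hopf_iso_iff[OF X A Y B i]) simp_all
    then show "\<exists>f. hopf_iso (FS S) (FA_hopf S (X, A)) (FA_hopf S (Y, B)) f" by blast
  }
  assume "\<exists>f. hopf_iso (FS S) (FA_hopf S (X, A)) (FA_hopf S (Y, B)) f"
  then obtain f where f: "hopf_iso (FS S) (FA_hopf S (X, A)) (FA_hopf S (Y, B)) f" by blast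
  have P: "FA_obj X A \<in> fs_obj S" and Q: "FA_obj Y B \<in> fs_obj S"
    using fibered_bialgebra_FA[OF X A] fibered_bialgebra_FA[OF Y B]
        by (simp_all add: fibered_bialgebra_def)
  have f': "f \<in> homs (FS S) (FA_obj X A) (FA_obj Y B)" "invertible CAT (base_mor f)"
    "monoid_functor (G_cat X) (G_mul X) (G_un X) (G_mul Y) (G_un Y) (fun_of f)"
    using f unfolding FA_hopf_eq
    by (subst (asm) hopf_iso_fs_bialg_iff[OF P Q]; simp add: is_functor_G_un[OF Y])+
  have F: "is_functor (G_cat X) (G_cat Y) (fun_of f)" and sel: "Src f = FA_obj X A" "Tgt f
      = FA_obj Y B"
    and ext: "cmp f \<in> extensional (carrier (HG X))"
    using f'(1) by (auto simp: in_homs_FS)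
  have "invertible CAT \<lparr>Src = G_cat X, Tgt = G_cat Y, Dat = fun_of f\<rparr>"
    using f'(2) by (simp add: base_mor_def sel)
  from iso_functorE[OF X Y F this f'(3)] obtain \<beta> \<alpha> where
    i: "crossed_iso X Y \<beta> \<alpha>" and Fe: "fun_of f = iso_functor X \<beta> \<alpha>" .
  have fe: "f = \<lparr>Src = FA_obj X A, Tgt = FA_obj Y B, Dat = (iso_functor X \<beta> \<alpha>, cmp f)\<rparr>"
    by (simp add: mor_eq_iff sel Fe[symmetric])
  note h = f[unfolded FA_hopf_iso_iff[OF X A Y B i ext, folded fe]]
  have "\<forall>x \<in> carrier (HG X). cmp f (inv\<^bsub>HG X\<^esub> x) \<cdot> anti A x = anti B (\<beta> x) \<cdot> cmp f x"
    using h by (intro ballI FA_iso_anti[OF X A Y B i]) auto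
  with h i show "pair_iso S (X, A) (Y, B)" unfolding pair_iso_def by blast
qed

section \<open>From Hopf algebras in \<open>FS S\<close> to pairs\<close>

lemma hopf_algebra_FS_E:
  assumes "hopf_algebra (FS S) Z"
  obtains P m u \<delta> \<epsilon> \<mu> \<eta> s where "Z = fs_bialg S P m u \<delta> \<epsilon> \<mu> \<eta>" "bialgebra (FS S) (fs_bialg S P m u
      \<delta> \<epsilon> \<mu> \<eta>)"
    "antipode (FS S) (fs_bialg S P m u \<delta> \<epsilon> \<mu> \<eta>) s" "invertible (FS S) s"
  using assms bialgebra_FS_eq[of Z] unfolding hopf_algebra_def by metis

text \<open>Bialgebra, antipode and invertibility all project to the base, which is thereby a group
  object; \<open>group_cat\<close> then provides the crossed module.\<close>

lemma hopf_algebra_base: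
  assumes "hopf_algebra (FS S) Z"
  shows "hopf_algebra CAT (base Z)
    \<and> (\<exists>\<chi> \<Gamma>. crossed_module \<chi> \<and> normalized_crossed \<chi> \<and> hopf_iso CAT (base Z) (G_hopf \<chi>) \<Gamma>)"
proof -
  obtain P m u \<delta> \<epsilon> \<mu> \<eta> s where Z: "Z = fs_bialg S P m u \<delta> \<epsilon> \<mu> \<eta>"
    and b: "bialgebra (FS S) (fs_bialg S P m u \<delta> \<epsilon> \<mu> \<eta>)"
    and s: "antipode (FS S) (fs_bialg S P m u \<delta> \<epsilon> \<mu> \<eta>) s" "invertible (FS S) s"
    using hopf_algebra_FS_E[OF assms] .
  have P: "P \<in> fs_obj S" and M: "cat_monoid (fst P) m u"
    using b by (auto simp: bialgebra_fs_bialg_iff fibered_bialgebra_def)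
  have sh: "s \<in> homs (FS S) P P" and sa: "cat_antipode (fst P) m u (fun_of s)"
    using s by (auto simp: antipode_fs_bialg_iff)
  have "antipode CAT (cat_bialg (fst P) m u) (base_mor s)"
    using sh sa by (simp add: antipode_cat_bialg_iff fs_objD[OF P] in_homs_FS)
  moreover have "invertible CAT (base_mor s)" using s(2) invertible_FS_iff[OF sh] by blast
  ultimately have "hopf_algebra CAT (base Z)"
    using M unfolding hopf_algebra_def Z base_fs_bialg bialgebra_cat_bialg_iff by blast
  moreover interpret group_cat "fst P" m u "fun_of s" by unfold_locales (rule M sa)+
  have "crossed_module crossed_of \<and> normalized_crossed crossed_of
      \<and> hopf_iso CAT (base Z) (G_hopf crossed_of) to_G_hopf"
    using crossed_module_crossed_of normalized_crossed_of hopf_iso_to_G_hopf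
        by (simp add: Z base_fs_bialg)
  ultimately show ?thesis by blast
qed

text \<open>By \<open>over_hopf_iff\<close> every candidate shares its components with
  \<open>alg\<close>, apart from the antipode, which \<open>chi_alg_eqI\<close> recovers.\<close>

lemma ex1_over_iso:
  assumes Z: "hopf_algebra (FS S) Z" and X: "crossed_module \<chi>" "normalized_crossed \<chi>"
    and \<Gamma>: "hopf_iso CAT (base Z) (G_hopf \<chi>) \<Gamma>"
  shows "\<exists>!A. (\<chi>, A) \<in> chi_pairs S
             \<and> hopf_iso (FS S) Z (FA_hopf S (\<chi>, A)) (over_mor S (Crr Z) (FA_obj \<chi> A) \<Gamma>)"
proof -
  obtain P m u \<delta> \<epsilon> \<mu> \<eta> s where Z: "Z = fs_bialg S P m u \<delta> \<epsilon> \<mu> \<eta>"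
    and b: "bialgebra (FS S) (fs_bialg S P m u \<delta> \<epsilon> \<mu> \<eta>)"
    and s: "antipode (FS S) (fs_bialg S P m u \<delta> \<epsilon> \<mu> \<eta>) s" "invertible (FS S) s"
    using hopf_algebra_FS_E[OF Z] .
  obtain G where G: "inverse_pair CAT \<Gamma> G" using \<Gamma> by (auto simp: hopf_iso_def invertible_def)
  have \<Gamma>': "hopf_iso CAT (cat_bialg (fst P) m u) (G_hopf \<chi>) \<Gamma>"
    using \<Gamma> by (simp only: Z base_fs_bialg)
  interpret based_hopf S \<chi> P m u \<delta> \<epsilon> \<mu> \<eta> s \<Gamma> G
    by (rule based_hopf.intro[OF symmetric_monoidal_category_axioms crossed.intro[OF X(1)]
          based_hopf_axioms.intro[OF b s X(2) \<Gamma>' G]])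
  have crr: "Crr Z = P" by (simp add: Z fs_bialg_def)
  show ?thesis unfolding crr unfolding Z
  proof (rule ex1I[of _ alg])
    show "(\<chi>, alg) \<in> chi_pairs S \<and> hopf_iso (FS S) (fs_bialg S P m u \<delta> \<epsilon> \<mu> \<eta>) (FA_hopf S (\<chi>, alg))
        (over_mor S P (FA_obj \<chi> alg) \<Gamma>)"
      using alg_in over_hopf_iff[OF alg_in] by blast
    fix A assume a: "(\<chi>, A) \<in> chi_pairs S \<and> hopf_iso (FS S) (fs_bialg S P m u \<delta> \<epsilon> \<mu> \<eta>) (FA_hopf S
        (\<chi>, A)) (over_mor S P (FA_obj \<chi> A) \<Gamma>)"
    then show "A = alg"
      using over_hopf_iff[of A] by (intro chi_alg_eqI[OF _ alg_in]) blast+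
  qed
qed

text \<open>When the base is literally \<open>G_hopf \<chi>\<close>, the identity can serve as
  identification. The fibres are then left in place, so the comparison with \<open>FA_hopf\<close>
  is an equality.\<close>

lemma FA_hopf_surj:
  assumes Z: "hopf_algebra (FS S) Z" and X: "crossed_module \<chi>" "normalized_crossed \<chi>"
      and base: "base Z = G_hopf \<chi>"
  shows "\<exists>p \<in> chi_pairs S. Z = FA_hopf S p"
proof -
  obtain P m u \<delta> \<epsilon> \<mu> \<eta> s where Z: "Z = fs_bialg S P m u \<delta> \<epsilon> \<mu> \<eta>"
    and b: "bialgebra (FS S) (fs_bialg S P m u \<delta> \<epsilon> \<mu> \<eta>)"
    and s: "antipode (FS S) (fs_bialg S P m u \<delta> \<epsilon> \<mu> \<eta>) s" "invertible (FS S) s"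
    using hopf_algebra_FS_E[OF Z] .
  have e: "fst P = G_cat \<chi>" "m = G_mul \<chi>" "u = G_un \<chi>"
    using base by (auto simp: Z base_fs_bialg G_hopf_eq cat_bialg_def)
  \<comment> \<open>The identity of \<open>CAT\<close> serves both as \<Gamma> and as its inverse in
    \<open>based_hopf\<close>.\<close>
  define I where "I = Id CAT (G_cat \<chi>)"
  have I_sel: "Src I = G_cat \<chi>" "Tgt I = G_cat \<chi>" "Dat I = id_functor (G_cat \<chi>)"
      by (simp_all add: I_def)
  note cat = category_G_cat[OF X(1)] normalized_G_cat[of \<chi>]
  have I: "I \<in> homs CAT (G_cat \<chi>) (G_cat \<chi>)" and II: "inverse_pair CAT I I"
    using cat is_functor_id[OF cat(1)] by (simp_all add: in_homs_CAT inverse_pair_CAT I_sel)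
  interpret crossed \<chi> by unfold_locales (rule X)
  have "monoid_functor (G_cat \<chi>) (G_mul \<chi>) (G_un \<chi>) (G_mul \<chi>) (G_un \<chi>) (Dat I)"
    by (simp add: monoid_functor_def I_sel)
  moreover have "invertible CAT I" using II unfolding invertible_def by blast
  ultimately have "hopf_iso CAT (G_hopf \<chi>) (G_hopf \<chi>) I"
    using I hopf_iso_cat_bialg_iff[OF cat cat is_functor_G_un[OF X(1)]] unfolding G_hopf_eq by blast
  then have \<Gamma>': "hopf_iso CAT (cat_bialg (fst P) m u) (G_hopf \<chi>) I"
    unfolding e G_hopf_eq .
  interpret based_hopf S \<chi> P m u \<delta> \<epsilon> \<mu> \<eta> s I I
    by (rule based_hopf.intro[OF symmetric_monoidal_category_axioms crossed.intro[OF X(1)]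
          based_hopf_axioms.intro[OF b s X(2) \<Gamma>' II]])
  note F = fib[unfolded fibered_bialgebra_def fibered_coalgebra_def e]
  have PF: "is_functor (G_cat \<chi>) S (snd P)" using fs_objD(3)[OF P] e by simp
  have A: "(\<chi>, alg) \<in> chi_pairs S" by (rule alg_in)
  then have Q: "is_functor (G_cat \<chi>) S (snd (FA_obj \<chi> alg))"
    using fibered_bialgebra_FA[of \<chi> alg] fs_objD(3)[of "FA_obj \<chi> alg" S]
    by (auto simp: chi_pairs_def fibered_bialgebra_def)
  have "P = FA_obj \<chi> alg"
    using e by (auto simp: prod_eq_iff functr_eq_iff[OF PF Q] I_sel)
  moreover have "\<delta> = FA_cmul \<chi> alg" "\<epsilon> = FA_cun \<chi> alg"
    using F by (auto simp: extensional_eq_iff I_sel)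
  moreover have "\<mu> = FA_mul \<chi> alg"
    using F by (auto simp: extensional_eq_iff I_sel)
  moreover have "\<eta> = FA_unt alg"
    using F by (auto simp: extensional_eq_iff I_sel)
  ultimately have "Z = FA_hopf S (\<chi>, alg)"
    unfolding FA_hopf_eq Z e by simp
  with A show ?thesis by blast
qed

end

text \<open>Each component of a crossed module can be read off from \<open>G_hopf\<close>: the
  groups from objects and arrows, the boundary from targets of arrows out of 1, the action from
  products with identities. Normalization settles arguments outside the carriers.\<close>

lemma G_hopf_inj:
  assumes X: "crossed_module X" "normalized_crossed X" and Y: "crossed_module Y"
      "normalized_crossed Y"
    and e: "G_hopf X = G_hopf Y"
  shows "X = Y"
proof -
  interpret X: crossed X by unfold_locales (rule X)
  interpret Y: crossed Y by unfold_locales (rule Y)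
  have c: "G_cat X = G_cat Y" "G_mul X = G_mul Y" "G_un X = G_un Y"
    using e by (auto simp: G_hopf_eq cat_bialg_def)
  have H: "carrier (HG X) = carrier (HG Y)" using arg_cong[OF c(1), of Ob] by simp
  have "ptimes (carrier (HG X)) (carrier (EG X)) = ptimes (carrier (HG X)) (carrier (EG Y))"
    using arg_cong[OF c(1), of Ar] H by simp
  \<comment> \<open>The arrows only give the product of the two carriers; pairing with the unit,
    which lies in the nonempty first carrier, isolates the second.\<close>
  then have "Pr \<one>\<^bsub>HG X\<^esub> e \<in> ptimes (carrier (HG X)) (carrier (EG X)) \<longleftrightarrow> Pr \<one>\<^bsub>HG X\<^esub> e
      \<in> ptimes (carrier (HG X)) (carrier (EG Y))" for e
    by simp
  then have E: "carrier (EG X) = carrier (EG Y)" by auto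
  have ones: "\<one>\<^bsub>HG X\<^esub> = \<one>\<^bsub>HG Y\<^esub>" "\<one>\<^bsub>EG X\<^esub> = \<one>\<^bsub>EG Y\<^esub>"
    using arg_cong[OF c(3), of "\<lambda>F. FAr F Star"] by auto
  have Hm: "x \<otimes>\<^bsub>HG X\<^esub> y = x \<otimes>\<^bsub>HG Y\<^esub> y" if "x \<in> carrier (HG X)" "y \<in> carrier (HG X)" for x y
    using arg_cong[OF c(2), of "\<lambda>F. FOb F (Pr x y)"] that H by simp
  have bd: "bd X e = bd Y e" if "e \<in> carrier (EG X)" for e
  proof -
    have "bd X e = Cod (G_cat X) (Pr \<one>\<^bsub>HG X\<^esub> e)" using that by simp
    also have "\<dots> = Cod (G_cat Y) (Pr \<one>\<^bsub>HG Y\<^esub> e)" by (simp only: c ones)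
    also have "\<dots> = bd Y e" using that E by simp
    finally show ?thesis .
  qed
  have act: "act X x e = act Y x e" if "x \<in> carrier (HG X)" "e \<in> carrier (EG X)" for x e
  proof -
    \<comment> \<open>The product of the identity of x with the arrow e out of 1 exhibits the action
      as its second component.\<close>
    have "act X x e = pr2 (FAr (G_mul X) (Pr (Pr x \<one>\<^bsub>EG X\<^esub>) (Pr \<one>\<^bsub>HG X\<^esub> e)))" using that by simp
    also have "\<dots> = pr2 (FAr (G_mul Y) (Pr (Pr x \<one>\<^bsub>EG Y\<^esub>) (Pr \<one>\<^bsub>HG Y\<^esub> e)))" by (simp only: c ones)
    also have "\<dots> = act Y x e" using that E H by simp
    finally show ?thesis .
  qed
  have Em: "e \<otimes>\<^bsub>EG X\<^esub> f = e \<otimes>\<^bsub>EG Y\<^esub> f" if "e \<in> carrier (EG X)" "f \<in> carrier (EG X)" for e f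
  proof -
    have "e \<otimes>\<^bsub>EG X\<^esub> f = pr2 (FAr (G_mul X) (Pr (Pr \<one>\<^bsub>HG X\<^esub> e) (Pr \<one>\<^bsub>HG X\<^esub> f)))" using that by simp
    also have "\<dots> = pr2 (FAr (G_mul Y) (Pr (Pr \<one>\<^bsub>HG Y\<^esub> e) (Pr \<one>\<^bsub>HG Y\<^esub> f)))" by (simp only: c ones)
    also have "\<dots> = e \<otimes>\<^bsub>EG Y\<^esub> f" using that E by simp
    finally show ?thesis .
  qed
  note n = X(2) Y(2)
  have "x \<otimes>\<^bsub>HG X\<^esub> y = x \<otimes>\<^bsub>HG Y\<^esub> y" for x y
    using n Hm H by (cases "x \<in> carrier (HG X) \<and> y \<in> carrier (HG X)") (simp_all add:
        normalized_crossed_def)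
  then have "HG X = HG Y" using H ones by (intro monoid.equality) (simp_all add: fun_eq_iff)
  moreover have "x \<otimes>\<^bsub>EG X\<^esub> y = x \<otimes>\<^bsub>EG Y\<^esub> y" for x y
    using n Em E by (cases "x \<in> carrier (EG X) \<and> y \<in> carrier (EG X)") (simp_all add:
        normalized_crossed_def)
  then have "EG X = EG Y" using E ones by (intro monoid.equality) (simp_all add: fun_eq_iff)
  moreover have "bd X = bd Y"
    using n bd E by (auto simp: normalized_crossed_def extensional_eq_iff)
  moreover have "act X x y = act Y x y" for x y
    using n act E H by (cases "x \<in> carrier (HG X) \<and> y \<in> carrier (EG X)") (simp_all add:
        normalized_crossed_def)
  ultimately show ?thesis by (intro crossed.equality) (simp_all add: fun_eq_iff)
qed

text \<open>The base determines the crossed module, and the components determine all of A except the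
  antipode, which the record \<open>bialg\<close> does not store and \<open>chi_alg_eqI\<close>
  restores.\<close>

lemma (in symmetric_monoidal_category) FA_hopf_inj: "inj_on (FA_hopf S) (chi_pairs S)"
proof (rule inj_onI, clarify)
  fix X Y A B
  assume p: "(X, A) \<in> chi_pairs S" and q: "(Y, B) \<in> chi_pairs S" and e: "FA_hopf S (X, A)
      = FA_hopf S (Y, B)"
  have "X = Y"
    using G_hopf_inj[of X Y] p q arg_cong[OF e, of base] by (simp add: base_FA_hopf chi_pairs_def)
  have X: "crossed_module X" using p by (simp add: chi_pairs_def)
  interpret crossed X by unfold_locales (rule X)
  have eqs: "FA_obj X A = FA_obj X B" "FA_cmul X A = FA_cmul X B" "FA_cun X A = FA_cun X B"
    "FA_mul X A = FA_mul X B"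
    using e \<open>X = Y\<close> by (auto simp: FA_hopf_eq fs_bialg_def)
  have "A = B"
  proof (rule chi_alg_eqI[OF p])
    show "(X, B) \<in> chi_pairs S" using q \<open>X = Y\<close> by simp
    fix x assume x: "x \<in> carrier H"
    show "Coa A x = Coa B x"
      using fiber_FA[OF x, of A] fiber_FA[OF x, of B] eqs by simp
    show "mu A x y = mu B x y" if "y \<in> carrier H" for y
      using fun_cong[OF eqs(4), of "Pr x y"] x that by simp
    show "phi A x e = phi B x e" if "e \<in> carrier E" for e
      using arg_cong[OF eqs(1), of "\<lambda>P. FAr (snd P) (Pr x e)"] x that by simp
  next
    show "eta A = eta B" using arg_cong[OF e, of "\<lambda>Z. cmp (Unt Z) Star"]
        by (simp add: FA_hopf_eq fs_bialg_def)
  qed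
  with \<open>X = Y\<close> show "X = Y \<and> A = B" by simp
qed

theorem theorem10p2:
  fixes S :: "('o, 'a) smc"
  assumes "symmetric_monoidal_category S"
  shows
    \<comment> \<open>bijection onto the Hopf algebras whose underlying Hopf algebra in \<open>CAT\<close> is some \<open>G_hopf \<chi>\<close>\<close>
    "bij_betw (FA_hopf S) (chi_pairs S :: ('u scrossed \<times> ('u univ, 'u univ, 'o, 'a) chialg) set)
       {X. hopf_algebra (FS S) X
           \<and> (\<exists>\<chi>. crossed_module \<chi> \<and> normalized_crossed \<chi> \<and> base X = G_hopf \<chi>)}
     \<and> (\<forall>p \<in> (chi_pairs S :: ('u scrossed \<times> ('u univ, 'u univ, 'o, 'a) chialg) set).
          base (FA_hopf S p) = G_hopf (fst p)
          \<and> antipode (FS S) (FA_hopf S p) (FA_anti p) \<and> invertible (FS S) (FA_anti p))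
     \<comment> \<open>every Hopf algebra in \<open>FS S\<close> lies over some \<open>G_hopf \<chi>\<close>, up to isomorphism of the base \<dots>\<close>
     \<and> (\<forall>X :: (('u, 'o, 'a) fobj, ('u, 'o, 'a) fmor) bialg. hopf_algebra (FS S) X \<longrightarrow>
          hopf_algebra CAT (base X)
          \<and> (\<exists>\<chi> \<Gamma>. crossed_module \<chi> \<and> normalized_crossed \<chi> \<and> hopf_iso CAT (base X) (G_hopf \<chi>) \<Gamma>))
     \<comment> \<open>\<dots> and any such identification of the base determines a unique Hopf \<open>\<chi>\<close>-algebra\<close>
     \<and> (\<forall>(X :: (('u, 'o, 'a) fobj, ('u, 'o, 'a) fmor) bialg) \<chi> \<Gamma>.
          hopf_algebra (FS S) X \<and> crossed_module \<chi> \<and> normalized_crossed \<chi>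
          \<and> hopf_iso CAT (base X) (G_hopf \<chi>) \<Gamma> \<longrightarrow>
          (\<exists>!A. (\<chi>, A) \<in> chi_pairs S
             \<and> hopf_iso (FS S) X (FA_hopf S (\<chi>, A)) (over_mor S (Crr X) (FA_obj \<chi> A) \<Gamma>)))
     \<comment> \<open>isomorphism classes correspond\<close>
     \<and> (\<forall>p \<in> (chi_pairs S :: ('u scrossed \<times> ('u univ, 'u univ, 'o, 'a) chialg) set).
        \<forall>q \<in> chi_pairs S.
          pair_iso S p q \<longleftrightarrow> (\<exists>f. hopf_iso (FS S) (FA_hopf S p) (FA_hopf S q) f))"
proof -
  interpret symmetric_monoidal_category S by fact
  have "FA_hopf S ` chi_pairs S = {X. hopf_algebra (FS S) X
      \<and> (\<exists>\<chi> :: 'u scrossed. crossed_module \<chi> \<and> normalized_crossed \<chi> \<and> base X = G_hopf \<chi>)}"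
    using hopf_algebra_FA FA_hopf_surj by (fastforce simp: chi_pairs_def base_FA_hopf)
  with FA_hopf_inj have bij: "bij_betw (FA_hopf S) (chi_pairs S) {X. hopf_algebra (FS S) X
      \<and> (\<exists>\<chi> :: 'u scrossed. crossed_module \<chi> \<and> normalized_crossed \<chi> \<and> base X = G_hopf \<chi>)}"
    by (simp add: bij_betw_def)
  show ?thesis
  proof (intro conjI ballI allI impI)
    fix p assume "p \<in> (chi_pairs S :: ('u scrossed \<times> ('u univ, 'u univ, 'o, 'a) chialg) set)"
    then show "base (FA_hopf S p) = G_hopf (fst p)" "antipode (FS S) (FA_hopf S p) (FA_anti p)"
      "invertible (FS S) (FA_anti p)"
      using antipode_FA by (auto simp: base_FA_hopf chi_pairs_def)
    fix q assume "q \<in> (chi_pairs S :: ('u scrossed \<times> ('u univ, 'u univ, 'o, 'a) chialg) set)"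
    with \<open>p \<in> chi_pairs S\<close> show "pair_iso S p q \<longleftrightarrow> (\<exists>f. hopf_iso (FS S) (FA_hopf S p) (FA_hopf S q)
        f)"
      by (cases p, cases q) (simp only: pair_iso_iff)
  next
    fix X :: "(('u, 'o, 'a) fobj, ('u, 'o, 'a) fmor) bialg" and \<chi> \<Gamma>
    assume "hopf_algebra (FS S) X \<and> crossed_module \<chi> \<and> normalized_crossed \<chi>
        \<and> hopf_iso CAT (base X) (G_hopf \<chi>) \<Gamma>"
    then show "\<exists>!A. (\<chi>, A) \<in> chi_pairs S
             \<and> hopf_iso (FS S) X (FA_hopf S (\<chi>, A)) (over_mor S (Crr X) (FA_obj \<chi> A) \<Gamma>)"
      by (elim conjE) (rule ex1_over_iso)
  qed (use bij hopf_algebra_base in blast)+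
qed

end
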